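(* Let $\mathbb K$ be a field of characteristic $p>0$. The following three conditions are equivalent: (i) every finitely presented graded $\mathbb K$-algebra of linear growth has rational Hilbert series; (ii) every finitely presented graded $\mathbb K$-algebra of linear growth is automaton with respect to some degree-lexicographical order on the monomials in some finite homogeneous generating set; (iii) $\mathbb K$ is an algebraic extension of its prime subfield $\mathbb F_p$. In particular, if $\mathbb K$ is not algebraic over $\mathbb F_p$, there exists a finitely presented (indeed quadratic, $6$-generated) graded $\mathbb K$-algebra of linear growth whose Hilbert series is not rational.
   Context: All algebras are associative, unital, finitely generated, and $\mathbb Z$-graded of the form $A=A_0\oplus A_1\oplus\cdots$ with $A_0=\mathbb K$ (generators of positive degree). The Hilbert function is $h_A(n)=\dim A_n$ and the Hilbert series is $H_A(z)=\sum_{n\ge0}h_A(n)z^n$. $A$ has linear growth if $h_A$ is bounded. Given a finite set $S$ of homogeneous generators and an admissible order on words over $S$, a word is normal if it is not the leading word of any element of the ideal of relations of $A$ (in the free algebra on $S$); normal words form a basis of $A$. $A$ is automaton (with respect to $S$ and the order) if the set of normal words is a regular language. A degree-lexicographical order compares words first by degree (sum of degrees of letters) and then lexicographically with respect to a fixed total order on $S$. *)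

theory Defs
  imports "HOL-Library.Function_Algebras" "HOL-Computational_Algebra.Polynomial_FPS"
begin

text \<open>Free associative algebra over a field on letters 0..<k (nat), elements are
  functions from words to coefficients (finite support checked separately).\<close>

type_synonym 'k fa = "nat list \<Rightarrow> 'k"

definition fa_scale :: "'k::field \<Rightarrow> 'k fa \<Rightarrow> 'k fa" where
  "fa_scale c f = (\<lambda>w. c * f w)"

definition fa_supp :: "'k::field fa \<Rightarrow> nat list set" where
  "fa_supp f = {w. f w \<noteq> 0}"

definition fa_mono :: "nat list \<Rightarrow> 'k::field fa" where
  "fa_mono w = (\<lambda>v. if v = w then 1 else 0)"

definition fa_mult :: "'k::field fa \<Rightarrow> 'k fa \<Rightarrow> 'k fa" where
  "fa_mult f g = (\<lambda>w. \<Sum>i\<le>length w. f (take i w) * g (drop i w))"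

definition fa_prod :: "'k::field fa list \<Rightarrow> 'k fa" where
  "fa_prod fs = foldr fa_mult fs (fa_mono [])"

definition wdeg :: "(nat \<Rightarrow> nat) \<Rightarrow> nat list \<Rightarrow> nat" where
  "wdeg d w = sum_list (map d w)"

definition in_fa :: "nat \<Rightarrow> 'k::field fa \<Rightarrow> bool" where
  "in_fa k f \<longleftrightarrow> finite (fa_supp f) \<and> fa_supp f \<subseteq> lists {..<k}"

definition homog_of :: "nat \<Rightarrow> (nat \<Rightarrow> nat) \<Rightarrow> nat \<Rightarrow> 'k::field fa \<Rightarrow> bool" where
  "homog_of k d n f \<longleftrightarrow> in_fa k f \<and> (\<forall>w\<in>fa_supp f. wdeg d w = n)"

definition graded_component :: "nat \<Rightarrow> (nat \<Rightarrow> nat) \<Rightarrow> nat \<Rightarrow> 'k::field fa set" where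
  "graded_component k d n = {f. homog_of k d n f}"

definition fa_ideal :: "nat \<Rightarrow> 'k::field fa set \<Rightarrow> 'k fa set" where
  "fa_ideal k R = module.span fa_scale
     {fa_mult (fa_mult (fa_mono u) r) (fa_mono v) | u v r.
        u \<in> lists {..<k} \<and> v \<in> lists {..<k} \<and> r \<in> R}"

definition finite_presentation :: "nat \<Rightarrow> (nat \<Rightarrow> nat) \<Rightarrow> 'k::field fa set \<Rightarrow> bool" where
  "finite_presentation k d R \<longleftrightarrow> (\<forall>i<k. 0 < d i) \<and> finite R \<and>
     (\<forall>r\<in>R. \<exists>n>0. homog_of k d n r)"

text \<open>Hilbert function: dim A_n = dim F_n - dim (I \<inter> F_n)\<close>
definition hilbert_fun :: "nat \<Rightarrow> (nat \<Rightarrow> nat) \<Rightarrow> 'k::field fa set \<Rightarrow> nat \<Rightarrow> nat" where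
  "hilbert_fun k d R n =
     vector_space.dim fa_scale (graded_component k d n :: 'k fa set)
     - vector_space.dim fa_scale (fa_ideal k R \<inter> graded_component k d n)"

definition linear_growth :: "nat \<Rightarrow> (nat \<Rightarrow> nat) \<Rightarrow> 'k::field fa set \<Rightarrow> bool" where
  "linear_growth k d R \<longleftrightarrow> (\<exists>C. \<forall>n. hilbert_fun k d R n \<le> C)"

definition rational_series :: "(nat \<Rightarrow> nat) \<Rightarrow> bool" where
  "rational_series h \<longleftrightarrow> (\<exists>p q :: rat poly. q \<noteq> 0 \<and>
     fps_of_poly q * Abs_fps (\<lambda>n. of_nat (h n)) = fps_of_poly p)"

definition fa_eval :: "(nat \<Rightarrow> 'k::field fa) \<Rightarrow> 'k fa \<Rightarrow> 'k fa" where
  "fa_eval f u = (\<Sum>w\<in>fa_supp u. fa_scale (u w) (fa_prod (map f w)))"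

text \<open>f 0, ..., f (m-1) represent a finite set of homogeneous generators (of degrees
  e j > 0) of the algebra A = F_k / I, pairwise distinct in A\<close>
definition generating_family ::
  "nat \<Rightarrow> (nat \<Rightarrow> nat) \<Rightarrow> 'k::field fa set \<Rightarrow> nat \<Rightarrow> (nat \<Rightarrow> nat) \<Rightarrow> (nat \<Rightarrow> 'k fa) \<Rightarrow> bool" where
  "generating_family k d R m e f \<longleftrightarrow>
     (\<forall>j<m. 0 < e j \<and> homog_of k d (e j) (f j)) \<and>
     (\<forall>i<m. \<forall>j<m. i \<noteq> j \<longrightarrow> f i - f j \<notin> fa_ideal k R) \<and>
     (\<forall>g. in_fa k g \<longrightarrow> (\<exists>u. in_fa m u \<and> g - fa_eval f u \<in> fa_ideal k R))"

definition pres_kernel :: "nat \<Rightarrow> 'k::field fa set \<Rightarrow> nat \<Rightarrow> (nat \<Rightarrow> 'k fa) \<Rightarrow> 'k fa set" where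
  "pres_kernel k R m f = {u. in_fa m u \<and> fa_eval f u \<in> fa_ideal k R}"

definition deglex_less :: "(nat \<Rightarrow> nat) \<Rightarrow> (nat \<Rightarrow> nat) \<Rightarrow> nat list \<Rightarrow> nat list \<Rightarrow> bool" where
  "deglex_less e r v w \<longleftrightarrow> wdeg e v < wdeg e w \<or>
     (wdeg e v = wdeg e w \<and> (map r v, map r w) \<in> lexord {(a, b). a < b})"

definition is_leading :: "(nat \<Rightarrow> nat) \<Rightarrow> (nat \<Rightarrow> nat) \<Rightarrow> 'k::field fa \<Rightarrow> nat list \<Rightarrow> bool" where
  "is_leading e r u w \<longleftrightarrow> u w \<noteq> 0 \<and> (\<forall>v. u v \<noteq> 0 \<and> v \<noteq> w \<longrightarrow> deglex_less e r v w)"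

definition normal_words ::
  "nat \<Rightarrow> (nat \<Rightarrow> nat) \<Rightarrow> (nat \<Rightarrow> nat) \<Rightarrow> 'k::field fa set \<Rightarrow> nat list set" where
  "normal_words m e r J = {w \<in> lists {..<m}. \<not> (\<exists>u\<in>J. is_leading e r u w)}"

definition regular_lang :: "nat \<Rightarrow> nat list set \<Rightarrow> bool" where
  "regular_lang m L \<longleftrightarrow> (\<exists>(Q::nat set) q0 \<delta> F. finite Q \<and> q0 \<in> Q \<and>
     (\<forall>q\<in>Q. \<forall>a<m. \<delta> q a \<in> Q) \<and> F \<subseteq> Q \<and>
     L = {w \<in> lists {..<m}. foldl \<delta> q0 w \<in> F})"

definition automaton_presentable :: "nat \<Rightarrow> (nat \<Rightarrow> nat) \<Rightarrow> 'k::field fa set \<Rightarrow> bool" where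
  "automaton_presentable k d R \<longleftrightarrow> (\<exists>m e f r. generating_family k d R m e f \<and>
     inj_on r {..<m} \<and> regular_lang m (normal_words m e r (pres_kernel k R m f)))"

text \<open>algebraic over the prime subfield (= the image of the integers)\<close>
definition algebraic_prime :: "'k::field \<Rightarrow> bool" where
  "algebraic_prime x \<longleftrightarrow> (\<exists>q::'k poly. q \<noteq> 0 \<and> (\<forall>i. coeff q i \<in> \<int>) \<and> poly q x = 0)"

end

theory Submission
  imports Defs
begin

text \<open>An automaton algebra has a regular set of normal words, whose growth series counts the
  dimensions; if the growth is bounded, the vector of these counts over all states of the automaton
  is eventually periodic.

  If the field is algebraic over its prime field, some power of Frobenius fixes the coefficients of
  all relations, hence all coefficients of normal forms, which therefore lie in a finite set. With
  respect to the bases of normal words, a window of consecutive homogeneous components with its left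
  multiplications by letters can look in only finitely many ways. A window as long as the degrees
  of the relations determines the next component, so equal windows have equal futures,
  and the language of normal words has finitely many left quotients.

  If \<open>t\<close> is transcendental, we use that \<open>(1 + t)\<^sup>n = 1 + t\<^sup>n\<close> precisely when \<open>n\<close> is a power of
  the characteristic (Lech), and build a quadratic algebra whose Hilbert function tests this equation.\<close>

section \<open>Eventually periodic sequences and regular languages\<close>

text \<open>Words grow on the left throughout: suffixes of normal words are normal, and a window is
  described by the structure constants of left multiplication. This is why left quotients are
  counted. There are finitely many windows for two reasons: linear growth bounds the number of basis
  words per degree, and Frobenius confines the structure constants to the roots of
  \<open>X^q = X\<close>, because a semilinear map that fixes the relations preserves the ideal and
  so fixes the unique normal forms. Irrationality rests on two facts about
  \<open>(1 + t)^n = 1 + t^n\<close>. It holds for arbitrarily large n, the powers of p. If the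
  Hilbert function had period P far out, it would also hold at \<open>(1 + p * P) * p^n1\<close>;
  taking p-th roots leaves the exponent \<open>M = 1 + p * P\<close>, and as M is 1 modulo p, the
  polynomial \<open>1 + X^M - (1 + X)^M\<close> has linear coefficient -1, so t would be algebraic.
  The commutation factors 1, t, 1 + t in the relations are the bases of these powers.\<close>

lemma eventually_periodic_of_finite_window:
  fixes h :: "nat \<Rightarrow> 'a"
  assumes fin: "finite (range h)"
    and det: "\<And>n m. n0 \<le> n \<Longrightarrow> n0 \<le> m \<Longrightarrow> (\<forall>j<l. h (n + j) = h (m + j)) \<Longrightarrow> h (n + l) = h (m + l)"
  obtains P n1 where "0 < P" "\<forall>n\<ge>n1. h (n + P) = h n"
proof -
  define W where "W n = map (\<lambda>j. h (n + j)) [0..<l]" for n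
  have W_iff: "W n = W m \<longleftrightarrow> (\<forall>j<l. h (n + j) = h (m + j))" for n m
    by (auto simp: W_def)
  have "W ` {n0..} \<subseteq> {xs. set xs \<subseteq> range h \<and> length xs = l}"
    by (auto simp: W_def)
  hence "finite (W ` {n0..})"
    using finite_lists_length_eq[OF fin] finite_subset by blast
  moreover have "infinite {n0..}" by (simp add: infinite_Ici)
  ultimately have "\<not> inj_on W {n0..}" using finite_imageD by blast
  then obtain a b where ab: "n0 \<le> a" "a < b" "W a = W b"
    unfolding inj_on_def by (metis atLeast_iff linorder_neqE_nat)
  have step: "\<forall>j<l. h (a + t + j) = h (b + t + j)" for t
  proof (induction t)
    case 0
    then show ?case using ab(3) by (simp add: W_iff)
  next
    case (Suc t)
    have "h (a + t + l) = h (b + t + l)"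
      by (rule det) (use ab Suc in auto)
    moreover have "j < l \<Longrightarrow> Suc j < l \<or> Suc j = l" for j by auto
    ultimately show ?case using Suc by force
  qed
  have all: "h (a + t) = h (b + t)" for t
  \<comment> \<open>For l = 0 the window imposes no condition, and \<open>det\<close> alone makes h
    constant from \<open>n0\<close> on.\<close>
  proof (cases "l = 0")
    case True
    then show ?thesis using det[of "a + t" "b + t"] ab by simp
  next
    case False
    then show ?thesis using step[of t] by auto
  qed
  show thesis
  proof (rule that[of "b - a" a])
    show "0 < b - a" using ab by simp
    show "\<forall>n\<ge>a. h (n + (b - a)) = h n"
    proof (intro allI impI)
      fix n assume "a \<le> n"
      then show "h (n + (b - a)) = h n"
        using all[of "n - a"] ab by (simp add: add.commute)
    qed
  qed
qed

text \<open>Multiplication by 1 - X^P cancels the periodic tail and leaves a polynomial.\<close>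

lemma rational_series_of_eventually_periodic:
  fixes h :: "nat \<Rightarrow> nat"
  assumes "0 < P" and per: "\<forall>n\<ge>n1. h (n + P) = h n"
  shows "rational_series h"
proof -
  define H :: "rat fps" where "H = Abs_fps (\<lambda>n. of_nat (h n))"
  define q :: "rat poly" where "q = 1 - monom 1 P"
  have nth: "fps_nth (fps_of_poly q * H) n = 0" if "n1 + P \<le> n" for n
  proof -
    have "fps_nth (fps_of_poly q * H) n = of_nat (h n) - of_nat (h (n - P))"
      using that by (simp add: q_def H_def fps_of_poly_diff fps_of_poly_monom algebra_simps
          fps_X_power_mult_nth)
    also have "h n = h (n - P)"
      using per[rule_format, of "n - P"] that by simp
    finally show ?thesis by simp
  qed
  define p where "p = Poly (map (fps_nth (fps_of_poly q * H)) [0..<n1 + P])"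
  have "fps_of_poly q * H = fps_of_poly p"
    by (rule fps_ext) (auto simp: p_def nth nth_default_def)
  moreover have "q \<noteq> 0"
  proof -
    have "coeff q 0 = 1" using assms by (simp add: q_def)
    thus ?thesis by (metis coeff_0 zero_neq_one)
  qed
  ultimately show ?thesis unfolding rational_series_def H_def by blast
qed

text \<open>The denominator is a linear recurrence that determines a value from the l preceding
  ones, and a bounded sequence of naturals has finitely many windows.\<close>

lemma eventually_periodic_of_rational_series:
  fixes h :: "nat \<Rightarrow> nat"
  assumes "rational_series h" and bnd: "\<And>n. h n \<le> C"
  obtains P n1 where "0 < P" "\<forall>n\<ge>n1. h (n + P) = h n"
proof -
  define H :: "rat fps" where "H = Abs_fps (\<lambda>n. of_nat (h n))"
  obtain p q :: "rat poly" where q0: "q \<noteq> 0" and eq: "fps_of_poly q * H = fps_of_poly p"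
    using assms(1) unfolding rational_series_def H_def by blast
  \<comment> \<open>The constant term of q may vanish, so the recurrence is solved with the lowest
    nonzero coefficient, which multiplies the latest value \<open>h (n + l)\<close>.\<close>
  define i0 where "i0 = (LEAST i. coeff q i \<noteq> 0)"
  have ex: "coeff q (degree q) \<noteq> 0" using q0 by simp
  have i0: "coeff q i0 \<noteq> 0" unfolding i0_def using ex by (rule LeastI)
  have i0_least: "coeff q i = 0" if "i < i0" for i
    using not_less_Least[of i "\<lambda>i. coeff q i \<noteq> 0"] that unfolding i0_def by blast
  have i0_le: "i0 \<le> degree q" using i0 by (rule le_degree)
  define l where "l = degree q - i0"
  \<comment> \<open>This is the coefficient at n + l + i0 = n + degree q, beyond the degree of
    p.\<close>
  have rec: "(\<Sum>i=i0..degree q. coeff q i * of_nat (h (n + l + i0 - i))) = 0"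
    if n: "degree p < n" for n
  proof -
    have "fps_nth (fps_of_poly q * H) (n + l + i0) = 0"
      unfolding eq using n by (simp add: coeff_eq_0)
    hence "(\<Sum>i=0..n+l+i0. coeff q i * of_nat (h (n + l + i0 - i))) = 0"
      by (simp add: fps_mult_nth H_def)
    also have "(\<Sum>i=0..n+l+i0. coeff q i * of_nat (h (n + l + i0 - i)) :: rat)
        = (\<Sum>i=i0..degree q. coeff q i * of_nat (h (n + l + i0 - i)))"
      using i0_le by (intro sum.mono_neutral_right)
        (auto simp: l_def i0_least coeff_eq_0 not_le)
    finally show ?thesis .
  qed
  have split: "(\<Sum>i=i0..degree q. coeff q i * of_nat (h (n + l + i0 - i)))
      = coeff q i0 * of_nat (h (n + l)) + (\<Sum>i=Suc i0..degree q. coeff q i * of_nat (h (n + l + i0 - i)))" for n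
    using i0_le by (subst sum.atLeast_Suc_atMost) auto
  show thesis
  proof (rule eventually_periodic_of_finite_window[of h "degree p + 1" l])
    show "finite (range h)"
      by (rule finite_subset[of _ "{..C}"]) (use bnd in auto)
  next
    fix n m
    assume n: "degree p + 1 \<le> n" "degree p + 1 \<le> m" and win: "\<forall>j<l. h (n + j) = h (m + j)"
    have same: "h (n + l + i0 - i) = h (m + l + i0 - i)" if "i \<in> {Suc i0..degree q}" for i
    proof -
      have "l + i0 - i < l" and e: "n + l + i0 - i = n + (l + i0 - i)" "m + l + i0 - i = m + (l + i0 - i)"
        using that i0_le by (auto simp: l_def)
      thus ?thesis unfolding e using win by blast
    qed
    have "(\<Sum>i=Suc i0..degree q. coeff q i * of_nat (h (n + l + i0 - i)))
       = (\<Sum>i=Suc i0..degree q. coeff q i * (of_nat (h (m + l + i0 - i)) :: rat))"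
      by (rule sum.cong[OF refl]) (simp only: same)
    moreover have "degree p < n" "degree p < m" using n by auto
    ultimately have "coeff q i0 * of_nat (h (n + l)) = coeff q i0 * of_nat (h (m + l))"
      using rec[of n] rec[of m] unfolding split by (simp only: add_eq_0_iff2 neg_equal_iff_equal)
    thus "h (n + l) = h (m + l)" using i0 by simp
  qed (use that in blast)
qed

text \<open>The automaton has the right quotients of \<open>L\<close> as states; each of them is
  determined by the set of left quotients it meets, so there are finitely many.\<close>
lemma regular_lang_of_finite_left_quotients:
  assumes L: "L \<subseteq> lists {..<m}"
    and fin: "finite ((\<lambda>w. {u \<in> lists {..<m}. u @ w \<in> L}) ` lists {..<m})"
  shows "regular_lang m L"
proof -
  let ?S = "(\<lambda>w. {u \<in> lists {..<m}. u @ w \<in> L}) ` lists {..<m}"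
  define T where "T u = {s \<in> ?S. u \<in> s}" for u
  have "T ` lists {..<m} \<subseteq> Pow ?S" by (auto simp: T_def)
  hence finT: "finite (T ` lists {..<m})" by (rule finite_subset) (simp add: fin)
  have T_iff: "u @ w \<in> L \<longleftrightarrow> v @ w \<in> L"
    if "T u = T v" "u \<in> lists {..<m}" "v \<in> lists {..<m}" "w \<in> lists {..<m}" for u v w
  proof -
    have "{u \<in> lists {..<m}. u @ w \<in> L} \<in> T u \<longleftrightarrow> {u \<in> lists {..<m}. u @ w \<in> L} \<in> T v"
      using that by simp
    thus ?thesis using that by (auto simp: T_def)
  qed
  have T_eqI: "T u = T v" if "u \<in> lists {..<m}" "v \<in> lists {..<m}"
     "\<And>w. w \<in> lists {..<m} \<Longrightarrow> u @ w \<in> L \<longleftrightarrow> v @ w \<in> L" for u v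
    using that by (auto simp: T_def)
  have T_snoc: "T (u @ [x]) = T (v @ [x])" if "T u = T v" "u \<in> lists {..<m}" "v \<in> lists {..<m}" "x < m" for u v x
  proof (rule T_eqI)
    fix w assume "w \<in> lists {..<m}"
    thus "(u @ [x]) @ w \<in> L \<longleftrightarrow> (v @ [x]) @ w \<in> L"
      using T_iff[OF that(1-3), of "x # w"] that by simp
  qed (use that in auto)
  \<comment> \<open>The states required by \<open>regular_lang\<close> are natural numbers, so the
    finitely many values of T are encoded by an injection.\<close>
  from finT obtain g :: "nat list set set \<Rightarrow> nat" where g: "inj_on g (T ` lists {..<m})"
    using finite_imp_inj_to_nat_seg by metis
  \<comment> \<open>One word represents each state; by \<open>T_snoc\<close> the transition does not
    depend on the choice.\<close>
  define rep where "rep q = (SOME u. u \<in> lists {..<m} \<and> g (T u) = q)" for q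
  define \<delta> where "\<delta> q x = g (T (rep q @ [x]))" for q x
  define Q where "Q = (\<lambda>u. g (T u)) ` lists {..<m}"
  have rep: "rep (g (T u)) \<in> lists {..<m} \<and> T (rep (g (T u))) = T u" if "u \<in> lists {..<m}" for u
  proof -
    have "rep (g (T u)) \<in> lists {..<m} \<and> g (T (rep (g (T u)))) = g (T u)"
      unfolding rep_def by (rule someI[of _ u]) (use that in auto)
    thus ?thesis using g that by (auto dest: inj_onD)
  qed
  have \<delta>: "\<delta> (g (T u)) x = g (T (u @ [x]))" if "u \<in> lists {..<m}" "x < m" for u x
    unfolding \<delta>_def using T_snoc[of "rep (g (T u))" u x] rep[OF that(1)] that by simp
  have run: "foldl \<delta> (g (T [])) u = g (T u)" if "u \<in> lists {..<m}" for u
    using that by (induction u rule: rev_induct) (auto simp: \<delta>)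
  define F where "F = (\<lambda>u. g (T u)) ` L"
  have "finite Q" using finite_imageI[OF finT, of g] by (simp add: Q_def image_image)
  moreover have "g (T []) \<in> Q" by (auto simp: Q_def)
  moreover have "\<forall>q\<in>Q. \<forall>a<m. \<delta> q a \<in> Q"
    by (auto simp: Q_def \<delta> intro!: imageI)
  moreover have "F \<subseteq> Q" unfolding F_def Q_def using L by blast
  moreover have "L = {w \<in> lists {..<m}. foldl \<delta> (g (T [])) w \<in> F}"
  proof -
    have "w \<in> L" if w: "w \<in> lists {..<m}" "g (T w) \<in> F" for w
    proof -
      obtain v where v: "v \<in> L" "g (T w) = g (T v)" using w by (auto simp: F_def)
      hence "T w = T v" using g w L by (auto dest: inj_onD)
      thus ?thesis using T_iff[of w v "[]"] v w L by auto
    qed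
    hence "foldl \<delta> (g (T [])) w \<in> F \<longleftrightarrow> w \<in> L" if "w \<in> lists {..<m}" for w
      unfolding run[OF that] using that by (auto simp: F_def)
    thus ?thesis using L by blast
  qed
  ultimately show ?thesis unfolding regular_lang_def by blast
qed

section \<open>The free algebra\<close>

text \<open>The dimension of V/U: the family b is a basis of V modulo U, and together with a basis
  of U it is one of V. The finite set S makes the dimensions genuine, so that the difference of
  naturals is the true codimension.\<close>

lemma (in vector_space) dim_diff_eq_card:
  assumes S: "finite S" "V \<subseteq> span S" and V: "subspace V" and U: "subspace U" "U \<subseteq> V"
    and X: "finite X" "b ` X \<subseteq> V"
    and ind: "\<And>c. (\<Sum>i\<in>X. scale (c i) (b i)) \<in> U \<Longrightarrow> \<forall>i\<in>X. c i = 0"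
    and sp: "V \<subseteq> span (b ` X \<union> U)"
  shows "dim V - dim U = card X"
proof -
  obtain B where B: "B \<subseteq> U" "independent B" "U \<subseteq> span B" "card B = dim U"
    using basis_exists by blast
  have finB: "finite B"
    using independent_span_bound[OF S(1) B(2)] B(1) U(2) S(2) by blast
  have notin: "b i \<notin> U" if "i \<in> X" for i
  proof
    assume "b i \<in> U"
    hence "(\<Sum>j\<in>X. scale (if j = i then 1 else 0) (b j)) \<in> U"
      using that X(1) by (simp add: if_distrib[of "\<lambda>c. scale c _"] cong: if_cong)
    from ind[OF this] that show False by (metis zero_neq_one)
  qed
  have inj: "inj_on b X"
  proof (rule inj_onI, rule ccontr)
    fix i j assume ij: "i \<in> X" "j \<in> X" "b i = b j" "i \<noteq> j"
    have "(\<Sum>l\<in>X. scale (if l = i then 1 else if l = j then - 1 else 0) (b l))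
        = (\<Sum>l\<in>X. (if l = i then b i else 0) - (if l = j then b j else 0))"
      by (intro sum.cong) (use ij in auto)
    also have "\<dots> = 0" using ij X by (simp add: sum_subtractf)
    finally have "(\<Sum>l\<in>X. scale (if l = i then 1 else if l = j then - 1 else 0) (b l)) \<in> U"
      using U by (simp add: subspace_0)
    from ind[OF this] ij show False by (metis zero_neq_one)
  qed
  have disj: "b ` X \<inter> B = {}" using notin B by blast
  have "independent (b ` X \<union> B)"
  proof
    assume "dependent (b ` X \<union> B)"
    then obtain u where u: "\<exists>v\<in>b ` X \<union> B. u v \<noteq> 0" "(\<Sum>v\<in>b ` X \<union> B. scale (u v) v) = 0"
      using dependent_finite[of "b ` X \<union> B"] X finB by auto
    have split: "(\<Sum>i\<in>X. scale (u (b i)) (b i)) + (\<Sum>v\<in>B. scale (u v) v) = 0"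
      using u(2) disj X finB inj by (simp add: sum.union_disjoint sum.reindex)
    have "(\<Sum>v\<in>B. scale (u v) v) \<in> U"
      using U B by (intro subspace_sum subspace_scale) auto
    hence "(\<Sum>i\<in>X. scale (u (b i)) (b i)) \<in> U"
      using split U by (metis add_eq_0_iff2 subspace_neg)
    hence z: "\<forall>i\<in>X. u (b i) = 0" by (rule ind)
    hence "(\<Sum>v\<in>B. scale (u v) v) = 0" using split by simp
    hence "\<forall>v\<in>B. u v = 0" using B(2) dependent_finite[OF finB] by blast
    thus False using u(1) z by blast
  qed
  moreover have "V \<subseteq> span (b ` X \<union> B)"
  proof -
    have "b ` X \<union> U \<subseteq> span (b ` X \<union> B)"
      using B(3) span_mono[of B "b ` X \<union> B"] span_superset[of "b ` X \<union> B"] by blast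
    hence "span (b ` X \<union> U) \<subseteq> span (b ` X \<union> B)"
      by (simp add: span_minimal)
    thus ?thesis using sp by blast
  qed
  ultimately have "dim V = card (b ` X \<union> B)"
    using X B U by (intro dim_unique) auto
  also have "\<dots> = card X + dim U"
    using disj X finB inj B by (simp add: card_Un_disjoint card_image)
  finally show ?thesis by simp
qed

interpretation fa: vector_space "fa_scale :: 'k::field \<Rightarrow> 'k fa \<Rightarrow> 'k fa"
  by unfold_locales (auto simp: fa_scale_def fun_eq_iff algebra_simps)

lemma sum_fun_apply: "(\<Sum>i\<in>A. f i) x = (\<Sum>i\<in>A. f i x)"
  for f :: "'a \<Rightarrow> 'b \<Rightarrow> 'c::comm_monoid_add"
  by (induction A rule: infinite_finite_induct) auto

lemma fa_scale_apply: "fa_scale c f w = c * f w"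
  by (simp add: fa_scale_def)

text \<open>Induction rules introduce eta-expanded functions, inside which these rules would fire.\<close>
declare plus_fun_apply [simp del] zero_fun_apply [simp del] minus_apply [simp del] uminus_apply [simp del]

lemmas fa_apply = plus_fun_apply zero_fun_apply minus_apply uminus_apply fa_scale_apply

lemma fa_mono_apply: "fa_mono w v = (if v = w then 1 else 0)"
  by (simp add: fa_mono_def)

lemma fa_supp_mono [simp]: "fa_supp (fa_mono w :: 'k::field fa) = {w}"
  by (auto simp: fa_supp_def fa_mono_def)

lemma in_fa_mono [simp]: "in_fa k (fa_mono w :: 'k::field fa) \<longleftrightarrow> w \<in> lists {..<k}"
  by (simp add: in_fa_def)

lemma fa_expand:
  fixes f :: "'k::field fa"
  assumes "finite A" "fa_supp f \<subseteq> A"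
  shows "f = (\<Sum>w\<in>A. fa_scale (f w) (fa_mono w))"
proof
  fix v
  have "(\<Sum>w\<in>A. fa_scale (f w) (fa_mono w)) v = (\<Sum>w\<in>A. if w = v then f w else 0)"
    by (auto simp: sum_fun_apply fa_mono_apply fa_apply intro!: sum.cong)
  also have "\<dots> = f v" using assms by (auto simp: fa_supp_def)
  finally show "f v = (\<Sum>w\<in>A. fa_scale (f w) (fa_mono w)) v" by simp
qed

text \<open>Turns conditions on supports into membership in a span, from which \<open>in_fa\<close>
  and \<open>homog_of\<close> inherit their closure properties.\<close>

lemma fa_span_mono_iff:
  "f \<in> fa.span (fa_mono ` A) \<longleftrightarrow> finite (fa_supp f) \<and> fa_supp f \<subseteq> A"
proof
  assume "f \<in> fa.span (fa_mono ` A)"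
  then show "finite (fa_supp f) \<and> fa_supp f \<subseteq> A"
  proof (induction rule: fa.span_induct)
    case base
    show ?case
    proof (rule fa.subspaceI)
      show "0 \<in> {x. finite (fa_supp x) \<and> fa_supp x \<subseteq> A}" by (simp add: fa_supp_def fa_apply)
    next
      fix x y :: "'a fa"
      assume "x \<in> {x. finite (fa_supp x) \<and> fa_supp x \<subseteq> A}" "y \<in> {x. finite (fa_supp x) \<and> fa_supp x \<subseteq> A}"
      moreover have "fa_supp (x + y) \<subseteq> fa_supp x \<union> fa_supp y" by (auto simp: fa_supp_def fa_apply)
      ultimately show "x + y \<in> {x. finite (fa_supp x) \<and> fa_supp x \<subseteq> A}"
        using finite_subset by blast
    next
      fix c and x :: "'a fa"
      assume "x \<in> {x. finite (fa_supp x) \<and> fa_supp x \<subseteq> A}"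
      moreover have "fa_supp (fa_scale c x) \<subseteq> fa_supp x" by (auto simp: fa_supp_def fa_apply)
      ultimately show "fa_scale c x \<in> {x. finite (fa_supp x) \<and> fa_supp x \<subseteq> A}"
        using finite_subset by blast
    qed
  qed auto
next
  assume f: "finite (fa_supp f) \<and> fa_supp f \<subseteq> A"
  have "(\<Sum>w\<in>fa_supp f. fa_scale (f w) (fa_mono w)) \<in> fa.span (fa_mono ` A)"
    using f by (intro fa.span_sum fa.span_scale fa.span_base) auto
  thus "f \<in> fa.span (fa_mono ` A)" using fa_expand[of "fa_supp f" f] f by simp
qed

lemma in_fa_iff_span: "in_fa k f \<longleftrightarrow> f \<in> fa.span (fa_mono ` lists {..<k})"
  by (simp add: in_fa_def fa_span_mono_iff)

lemma in_fa_add: "in_fa k f \<Longrightarrow> in_fa k g \<Longrightarrow> in_fa k (f + g)"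
  and in_fa_diff: "in_fa k f \<Longrightarrow> in_fa k g \<Longrightarrow> in_fa k (f - g)"
  and in_fa_scale: "in_fa k f \<Longrightarrow> in_fa k (fa_scale c f)"
  and in_fa_0 [simp]: "in_fa k 0"
  and in_fa_sum: "(\<And>i. i \<in> A \<Longrightarrow> in_fa k (F i)) \<Longrightarrow> in_fa k (\<Sum>i\<in>A. F i)"
  by (auto simp: in_fa_iff_span intro: fa.span_add fa.span_diff fa.span_scale fa.span_zero fa.span_sum)

lemma in_fa_induct [consumes 1, case_names zero add scale mono]:
  assumes "in_fa k f" "P 0" "\<And>f g. in_fa k f \<Longrightarrow> in_fa k g \<Longrightarrow> P f \<Longrightarrow> P g \<Longrightarrow> P (f + g)"
    "\<And>c f. in_fa k f \<Longrightarrow> P f \<Longrightarrow> P (fa_scale c f)" "\<And>w. w \<in> lists {..<k} \<Longrightarrow> P (fa_mono w)"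
  shows "P f"
proof -
  have "f \<in> fa.span (fa_mono ` lists {..<k})" using assms(1) by (simp add: in_fa_iff_span)
  hence "in_fa k f \<and> P f"
  proof (induction rule: fa.span_induct)
    case base
    show ?case
      by (rule fa.subspaceI) (use assms in \<open>auto intro: in_fa_add in_fa_scale\<close>)
  next
    case (step x)
    then show ?case using assms(5) by fastforce
  qed
  thus ?thesis by simp
qed

lemma fa_mult_add_left: "fa_mult (f + g) h = fa_mult f h + fa_mult g h"
  and fa_mult_add_right: "fa_mult f (g + h) = fa_mult f g + fa_mult f h"
  and fa_mult_scale_left: "fa_mult (fa_scale c f) g = fa_scale c (fa_mult f g)"
  and fa_mult_scale_right: "fa_mult f (fa_scale c g) = fa_scale c (fa_mult f g)"
  and fa_mult_0_left [simp]: "fa_mult 0 g = 0"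
  and fa_mult_0_right [simp]: "fa_mult f 0 = 0"
  by (auto simp: fa_mult_def fun_eq_iff fa_apply algebra_simps sum.distrib sum_distrib_left)

lemma fa_mult_sum_left: "fa_mult (\<Sum>i\<in>A. F i) g = (\<Sum>i\<in>A. fa_mult (F i) g)"
  by (induction A rule: infinite_finite_induct) (auto simp: fa_mult_add_left)

lemma fa_mult_sum_right: "fa_mult g (\<Sum>i\<in>A. F i) = (\<Sum>i\<in>A. fa_mult g (F i))"
  by (induction A rule: infinite_finite_induct) (auto simp: fa_mult_add_right)

lemma fa_mult_diff_right: "fa_mult f (g - h) = fa_mult f g - fa_mult f h"
  and fa_mult_diff_left: "fa_mult (f - g) h = fa_mult f h - fa_mult g h"
  by (auto simp: fa_mult_def fun_eq_iff fa_apply algebra_simps sum_subtractf)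

lemma fa_mult_mono_apply:
  "fa_mult (fa_mono u) f w = (if take (length u) w = u then f (drop (length u) w) else 0)"
proof -
  have "fa_mult (fa_mono u) f w
      = (\<Sum>i\<le>length w. if i = length u then (if take i w = u then f (drop i w) else 0) else 0)"
    unfolding fa_mult_def by (intro sum.cong) (auto simp: fa_mono_apply)
  also have "\<dots> = (if take (length u) w = u then f (drop (length u) w) else 0)"
    by (auto simp: not_le)
  finally show ?thesis .
qed

lemma fa_mult_mono_mono [simp]: "fa_mult (fa_mono u) (fa_mono v) = fa_mono (u @ v)"
proof
  fix w
  show "fa_mult (fa_mono u) (fa_mono v) w = (fa_mono (u @ v) :: 'a fa) w"
    by (auto simp: fa_mult_mono_apply fa_mono_apply) (metis append_take_drop_id)
qed

lemma in_fa_mult: "in_fa k f \<Longrightarrow> in_fa k g \<Longrightarrow> in_fa k (fa_mult f g)"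
proof (induction rule: in_fa_induct)
  case (mono u)
  from mono(2) show ?case
    by (induction rule: in_fa_induct)
      (use mono in \<open>auto simp: fa_mult_add_right fa_mult_scale_right intro: in_fa_add in_fa_scale\<close>)
qed (auto simp: fa_mult_add_left fa_mult_scale_left intro: in_fa_add in_fa_scale)

lemma fa_mult_assoc:
  assumes "in_fa k f" "in_fa k g" "in_fa k h"
  shows "fa_mult (fa_mult f g) h = fa_mult f (fa_mult g h)"
  using assms
proof (induction rule: in_fa_induct)
  case (mono u)
  from mono(2,3) show ?case
  proof (induction rule: in_fa_induct)
    case (mono v)
    from mono(2) show ?case
      by (induction rule: in_fa_induct)
        (auto simp: fa_mult_add_right fa_mult_scale_right)
  qed (auto simp: fa_mult_add_left fa_mult_scale_left fa_mult_add_right fa_mult_scale_right)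
qed (auto simp: fa_mult_add_left fa_mult_scale_left)

lemma fa_mult_Nil_left [simp]: "fa_mult (fa_mono []) f = f"
  by (rule ext) (simp add: fa_mult_mono_apply)

lemma wdeg_simps [simp]:
  "wdeg d [] = 0" "wdeg d (x # w) = d x + wdeg d w" "wdeg d (u @ v) = wdeg d u + wdeg d v"
  by (auto simp: wdeg_def)

definition words_of_deg :: "nat \<Rightarrow> (nat \<Rightarrow> nat) \<Rightarrow> nat \<Rightarrow> nat list set" where
  "words_of_deg k d n = {w \<in> lists {..<k}. wdeg d w = n}"

lemma length_le_wdeg: "(\<And>i. i < k \<Longrightarrow> 0 < d i) \<Longrightarrow> w \<in> lists {..<k} \<Longrightarrow> length w \<le> wdeg d w"
proof (induction w)
  case (Cons a w)
  then have "0 < d a" "length w \<le> wdeg d w" by auto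
  then show ?case by simp
qed simp

lemma finite_words_of_deg:
  assumes "\<And>i. i < k \<Longrightarrow> 0 < d i"
  shows "finite (words_of_deg k d n)"
proof (rule finite_subset)
  show "words_of_deg k d n \<subseteq> {w. set w \<subseteq> {..<k} \<and> length w \<le> n}"
    using length_le_wdeg[of k d] assms by (fastforce simp: words_of_deg_def)
  show "finite {w. set w \<subseteq> {..<k} \<and> length w \<le> n}"
    by (rule finite_lists_length_le) simp
qed

lemma homog_of_iff_span: 
  "homog_of k d n f \<longleftrightarrow> f \<in> fa.span (fa_mono ` words_of_deg k d n)"
  by (auto simp: homog_of_def fa_span_mono_iff in_fa_def words_of_deg_def)

lemma graded_component_eq_span: "graded_component k d n = fa.span (fa_mono ` words_of_deg k d n)"
  by (auto simp: graded_component_def homog_of_iff_span)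

lemma homog_of_in_fa: "homog_of k d n f \<Longrightarrow> in_fa k f"
  by (simp add: homog_of_def)

lemma homog_of_mult:
  assumes "homog_of k d n f" "homog_of k d m g"
  shows "homog_of k d (n + m) (fa_mult f g)"
proof -
  have f: "f = (\<Sum>u\<in>fa_supp f. fa_scale (f u) (fa_mono u))"
    and g: "g = (\<Sum>u\<in>fa_supp g. fa_scale (g u) (fa_mono u))"
    using assms by (auto intro!: fa_expand simp: homog_of_def in_fa_def)
  have "fa_mult f g = (\<Sum>u\<in>fa_supp f. \<Sum>v\<in>fa_supp g. fa_scale (f u) (fa_scale (g v) (fa_mono (u @ v))))"
    by (subst f, subst g, subst sum.swap) (simp add: mult.commute fa_mult_sum_left fa_mult_sum_right fa_mult_scale_left fa_mult_scale_right fa.scale_sum_right)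
  also have "\<dots> \<in> fa.span (fa_mono ` words_of_deg k d (n + m))"
    using assms by (intro fa.span_sum fa.span_scale fa.span_base imageI)
      (auto simp: words_of_deg_def homog_of_def in_fa_def)
  finally show ?thesis by (simp add: homog_of_iff_span)
qed

definition hcomp :: "(nat \<Rightarrow> nat) \<Rightarrow> nat \<Rightarrow> 'k::field fa \<Rightarrow> 'k fa" where
  "hcomp d n f = (\<lambda>w. if wdeg d w = n then f w else 0)"

lemma hcomp_add: "hcomp d n (f + g) = hcomp d n f + hcomp d n g"
  and hcomp_scale: "hcomp d n (fa_scale c f) = fa_scale c (hcomp d n f)"
  and hcomp_0 [simp]: "hcomp d n 0 = 0"
  and hcomp_diff: "hcomp d n (f - g) = hcomp d n f - hcomp d n g"
  by (auto simp: hcomp_def fun_eq_iff fa_apply)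

lemma hcomp_homog: "homog_of k d n f \<Longrightarrow> hcomp d m f = (if n = m then f else 0)"
  by (auto simp: hcomp_def homog_of_def fa_supp_def fun_eq_iff fa_apply)

lemma homog_of_hcomp: "in_fa k f \<Longrightarrow> homog_of k d n (hcomp d n f)"
proof -
  assume "in_fa k f"
  moreover have "fa_supp (hcomp d n f) \<subseteq> fa_supp f" by (auto simp: fa_supp_def hcomp_def)
  ultimately show ?thesis
    unfolding homog_of_def in_fa_def using finite_subset
    by (auto simp: fa_supp_def hcomp_def split: if_splits)
qed

lemma homog_of_mono [simp]: "homog_of k d n (fa_mono w :: 'k::field fa) \<longleftrightarrow> w \<in> words_of_deg k d n"
  by (auto simp: homog_of_def words_of_deg_def)

abbreviation sandwich :: "nat list \<Rightarrow> 'k::field fa \<Rightarrow> nat list \<Rightarrow> 'k fa" where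
  "sandwich u r v \<equiv> fa_mult (fa_mult (fa_mono u) r) (fa_mono v)"

lemma fa_ideal_base: "u \<in> lists {..<k} \<Longrightarrow> v \<in> lists {..<k} \<Longrightarrow> r \<in> R \<Longrightarrow> sandwich u r v \<in> fa_ideal k R"
  unfolding fa_ideal_def by (rule fa.span_base) blast

lemma subspace_fa_ideal: "fa.subspace (fa_ideal k R)"
  unfolding fa_ideal_def by (rule fa.subspace_span)

lemma fa_ideal_induct [consumes 1, case_names zero add scale base]:
  assumes "f \<in> fa_ideal k R" "P 0" 
    "\<And>f g. f \<in> fa_ideal k R \<Longrightarrow> g \<in> fa_ideal k R \<Longrightarrow> P f \<Longrightarrow> P g \<Longrightarrow> P (f + g)"
    "\<And>c f. f \<in> fa_ideal k R \<Longrightarrow> P f \<Longrightarrow> P (fa_scale c f)"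
    "\<And>u v r. u \<in> lists {..<k} \<Longrightarrow> v \<in> lists {..<k} \<Longrightarrow> r \<in> R \<Longrightarrow> P (sandwich u r v)"
  shows "P f"
proof -
  have "f \<in> fa_ideal k R \<and> P f"
    using assms(1) unfolding fa_ideal_def
  proof (induction rule: fa.span_induct)
    case base
    have s: "fa.subspace (fa_ideal k R)" by (rule subspace_fa_ideal)
    show ?case
      unfolding fa_ideal_def[symmetric]
      by (rule fa.subspaceI)
        (use assms s in \<open>auto intro: fa.subspace_add fa.subspace_scale fa.subspace_0\<close>)
  next
    case (step x)
    then show ?case using assms(5) fa_ideal_base unfolding fa_ideal_def by blast
  qed
  thus ?thesis by simp
qed

lemma fa_ideal_in_fa:
  assumes "\<And>r. r \<in> R \<Longrightarrow> in_fa k r" "f \<in> fa_ideal k R"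
  shows "in_fa k f"
  using assms(2)
  by (induction rule: fa_ideal_induct)
    (use assms(1) in \<open>auto intro!: in_fa_add in_fa_scale in_fa_mult\<close>)

lemma fa_ideal_mult_left:
  assumes R: "\<And>r. r \<in> R \<Longrightarrow> in_fa k r" and "f \<in> fa_ideal k R" and w: "w \<in> lists {..<k}"
  shows "fa_mult (fa_mono w) f \<in> fa_ideal k R"
  using assms(2)
proof (induction rule: fa_ideal_induct)
  case (base u v r)
  have "fa_mult (fa_mono w) (sandwich u r v) = sandwich (w @ u) r v"
    using base w R by (simp add: fa_mult_assoc[of k, symmetric] in_fa_mult)
  then show ?case using base w by (auto intro!: fa_ideal_base)
qed (use subspace_fa_ideal in \<open>auto simp: fa_mult_add_right fa_mult_scale_right
   intro: fa.subspace_add fa.subspace_scale fa.subspace_0\<close>)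

text \<open>A sandwich of a homogeneous relation is homogeneous, so \<open>hcomp\<close> keeps it or
  kills it; the ideal is therefore graded.\<close>

lemma hcomp_fa_ideal:
  assumes R: "\<And>r. r \<in> R \<Longrightarrow> \<exists>n. homog_of k d n r" and "f \<in> fa_ideal k R"
  shows "hcomp d n f \<in> fa_ideal k R"
  using assms(2)
proof (induction rule: fa_ideal_induct)
  case (base u v r)
  then obtain l where "homog_of k d l r" using R by blast
  hence h: "homog_of k d (wdeg d u + l + wdeg d v) (sandwich u r v)"
    using base by (intro homog_of_mult) (auto simp: words_of_deg_def)
  show ?case unfolding hcomp_homog[OF h]
    using fa_ideal_base[OF base] fa.subspace_0[OF subspace_fa_ideal[of k R]] by simp
qed (use subspace_fa_ideal in \<open>auto simp: hcomp_add hcomp_scale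
   intro: fa.subspace_add fa.subspace_scale fa.subspace_0\<close>)

section \<open>Normal words and the Hilbert function\<close>

lemma finite_max_wrt:
  assumes "finite A" "A \<noteq> {}"
    and tot: "\<And>x y. x \<in> A \<Longrightarrow> y \<in> A \<Longrightarrow> x \<noteq> y \<Longrightarrow> R x y \<or> R y x"
    and tr: "\<And>x y z. R x y \<Longrightarrow> R y z \<Longrightarrow> R x z"
  shows "\<exists>m\<in>A. \<forall>x\<in>A. x \<noteq> m \<longrightarrow> R x m"
  using assms(1,2) tot
proof (induction A rule: finite_ne_induct)
  case (insert x F)
  then obtain m where m: "m \<in> F" "\<forall>y\<in>F. y \<noteq> m \<longrightarrow> R y m" by blast
  from insert.prems[of x m] insert.hyps m have "R x m \<or> R m x" by auto
  then show ?case using m tr by (metis insert_iff)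
qed simp

text \<open>J is a graded subspace so that one theory of normal words serves both
  \<open>fa_ideal\<close> itself and \<open>pres_kernel\<close> of an arbitrary generating
  family.\<close>

locale graded_subspace =
  fixes m :: nat and e r :: "nat \<Rightarrow> nat" and J :: "'k::field fa set"
  assumes e_pos: "\<And>i. i < m \<Longrightarrow> 0 < e i"
    and r_inj: "inj_on r {..<m}"
    and subspace_J: "fa.subspace J"
    and J_in_fa: "\<And>u. u \<in> J \<Longrightarrow> in_fa m u"
    and hcomp_J: "\<And>u n. u \<in> J \<Longrightarrow> hcomp e n u \<in> J"
begin

abbreviation less_word (infix \<open>\<prec>\<close> 50) where "u \<prec> v \<equiv> deglex_less e r u v"

abbreviation normal :: "nat list set" where "normal \<equiv> normal_words m e r J"

lemma normal_in_lists: "w \<in> normal \<Longrightarrow> w \<in> lists {..<m}"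
  by (simp add: normal_words_def)

lemma less_irrefl: "\<not> w \<prec> w"
  by (auto simp: deglex_less_def lexord_irreflexive)

lemma less_trans: "u \<prec> v \<Longrightarrow> v \<prec> w \<Longrightarrow> u \<prec> w"
  unfolding deglex_less_def
  using lexord_trans[of "map r u" "map r v" "{(a, b). a < b}" "map r w"]
  by (auto simp: trans_def)

lemma less_total:
  assumes "u \<in> lists {..<m}" "v \<in> lists {..<m}" "u \<noteq> v"
  shows "u \<prec> v \<or> v \<prec> u"
proof -
  have "inj_on r (set u \<union> set v)"
    using assms by (intro inj_on_subset[OF r_inj]) auto
  hence ne: "map r u \<noteq> map r v"
    using assms(3) inj_on_map_eq_map by blast
  have "(map r u, map r v) \<in> lexord {(a, b). a < b} \<or> map r u = map r v
     \<or> (map r v, map r u) \<in> lexord {(a, b). a < b}"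
    by (rule lexord_linear) auto
  thus ?thesis using ne unfolding deglex_less_def by (metis linorder_neqE_nat)
qed

lemma Cons_less_Cons_iff:
  assumes "x < m" "y < m" "wdeg e (x # u) = wdeg e (y # v)"
  shows "x # u \<prec> y # v \<longleftrightarrow> r x < r y \<or> x = y \<and> u \<prec> v"
proof -
  have "r x = r y \<longleftrightarrow> x = y" using inj_on_eq_iff[OF r_inj] assms by simp
  thus ?thesis unfolding deglex_less_def using assms(3) by auto
qed

lemma leading_exists:
  assumes "in_fa m u" "u \<noteq> 0"
  obtains w where "is_leading e r u w" "w \<in> lists {..<m}"
proof -
  have "fa_supp u \<noteq> {}" using assms(2) by (auto simp: fa_supp_def fun_eq_iff fa_apply)
  moreover have "finite (fa_supp u)" "fa_supp u \<subseteq> lists {..<m}" using assms by (auto simp: in_fa_def)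
  moreover from this have "x \<prec> y \<or> y \<prec> x" if "x \<in> fa_supp u" "y \<in> fa_supp u" "x \<noteq> y" for x y
    using that less_total by blast
  ultimately have "\<exists>w\<in>fa_supp u. \<forall>v\<in>fa_supp u. v \<noteq> w \<longrightarrow> v \<prec> w"
    by (intro finite_max_wrt) (auto intro: less_trans)
  then obtain w where "w \<in> fa_supp u" "\<forall>v\<in>fa_supp u. v \<noteq> w \<longrightarrow> v \<prec> w" by blast
  thus thesis using that[of w] \<open>fa_supp u \<subseteq> _\<close> by (auto simp: is_leading_def fa_supp_def)
qed

text \<open>Independence of normal words modulo J: the leading word of a nonzero u would be normal
  and not normal at once.\<close>

lemma normal_combination_in_J:
  assumes "u \<in> J" "fa_supp u \<subseteq> normal"
  shows "u = 0"
proof (rule ccontr)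
  assume "u \<noteq> 0"
  then obtain w where w: "is_leading e r u w"
    using leading_exists J_in_fa assms by metis
  hence "w \<in> normal" using assms by (auto simp: is_leading_def fa_supp_def)
  thus False using w assms by (auto simp: normal_words_def)
qed

text \<open>Reduction modulo J. It terminates because only finitely many words of the same degree
  lie below w, letters having positive degree. The bound by w is recorded because it later
  identifies leading words.\<close>

lemma mono_in_span_normal:
  assumes "w \<in> lists {..<m}"
  shows "fa_mono w \<in> fa.span (fa_mono ` {v \<in> normal. wdeg e v = wdeg e w \<and> (v = w \<or> v \<prec> w)} \<union> J)"
  using assms
proof (induction "card {v \<in> words_of_deg m e (wdeg e w). v \<prec> w}" arbitrary: w rule: less_induct)
  case less
  let ?S = "\<lambda>w. fa.span (fa_mono ` {v \<in> normal. wdeg e v = wdeg e w \<and> (v = w \<or> v \<prec> w)} \<union> J)"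
  show ?case
  proof (cases "w \<in> normal")
    case True
    then show ?thesis by (intro fa.span_base) auto
  next
    case False
    then obtain u where u: "u \<in> J" "is_leading e r u w"
      using less.prems by (auto simp: normal_words_def)
    \<comment> \<open>The component in the degree of w keeps the leading coefficient and contains
      otherwise only smaller words of that same degree.\<close>
    define g where "g = hcomp e (wdeg e w) u"
    have g: "g \<in> J" by (simp add: g_def hcomp_J u)
    have gw: "g w = u w" "u w \<noteq> 0" using u by (auto simp: g_def hcomp_def is_leading_def)
    have supp_g: "finite (fa_supp g)" "fa_supp g \<subseteq> lists {..<m}"
      using J_in_fa[OF g] by (auto simp: in_fa_def)
    have small: "v \<prec> w" "wdeg e v = wdeg e w" if "v \<in> fa_supp g - {w}" for v
      using that u by (auto simp: g_def fa_supp_def hcomp_def is_leading_def split: if_splits)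
    have "fa_mono v \<in> ?S w" if v: "v \<in> fa_supp g - {w}" for v
    proof -
      have lt: "v \<prec> w" "wdeg e v = wdeg e w" "v \<in> lists {..<m}" using small v supp_g by auto
      have "{x \<in> words_of_deg m e (wdeg e v). x \<prec> v} \<subset> {x \<in> words_of_deg m e (wdeg e w). x \<prec> w}"
      proof (rule psubsetI)
        show "{x \<in> words_of_deg m e (wdeg e v). x \<prec> v} \<subseteq> {x \<in> words_of_deg m e (wdeg e w). x \<prec> w}"
          using lt less_trans by (auto simp: words_of_deg_def)
        have "v \<in> {x \<in> words_of_deg m e (wdeg e w). x \<prec> w}" using lt by (simp add: words_of_deg_def)
        thus "{x \<in> words_of_deg m e (wdeg e v). x \<prec> v} \<noteq> {x \<in> words_of_deg m e (wdeg e w). x \<prec> w}"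
          using less_irrefl by blast
      qed
      hence "card {x \<in> words_of_deg m e (wdeg e v). x \<prec> v} < card {x \<in> words_of_deg m e (wdeg e w). x \<prec> w}"
        by (intro psubset_card_mono) (auto simp: finite_words_of_deg e_pos)
      from less.hyps[OF this lt(3)] have "fa_mono v \<in> ?S v" .
      moreover have "?S v \<subseteq> ?S w"
        using lt less_trans by (intro fa.span_mono Un_mono image_mono) auto
      ultimately show ?thesis by blast
    qed
    hence rest: "(\<Sum>v\<in>fa_supp g - {w}. fa_scale (g v) (fa_mono v)) \<in> ?S w"
      by (intro fa.span_sum fa.span_scale) auto
    have "g = (\<Sum>v\<in>fa_supp g. fa_scale (g v) (fa_mono v))"
      using supp_g by (intro fa_expand) auto
    also have "\<dots> = fa_scale (g w) (fa_mono w) + (\<Sum>v\<in>fa_supp g - {w}. fa_scale (g v) (fa_mono v))"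
      using supp_g gw by (intro sum.remove) (auto simp: fa_supp_def)
    finally have "fa_scale (g w) (fa_mono w) = g - (\<Sum>v\<in>fa_supp g - {w}. fa_scale (g v) (fa_mono v))"
      by (simp add: algebra_simps)
    moreover have "g - (\<Sum>v\<in>fa_supp g - {w}. fa_scale (g v) (fa_mono v)) \<in> ?S w"
      using g rest by (intro fa.span_diff) (auto intro: fa.span_base)
    ultimately have "fa_scale (g w) (fa_mono w) \<in> ?S w" by simp
    from fa.span_scale[OF this, of "inverse (g w)"] show ?thesis using gw by simp
  qed
qed

lemma normal_form_exists:
  assumes "w \<in> lists {..<m}"
  obtains g where "fa_supp g \<subseteq> normal" "fa_mono w - g \<in> J"
    "\<And>v. v \<in> fa_supp g \<Longrightarrow> wdeg e v = wdeg e w \<and> (v = w \<or> v \<prec> w)" "in_fa m g"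
proof -
  let ?X = "{v \<in> normal. wdeg e v = wdeg e w \<and> (v = w \<or> v \<prec> w)}"
  have "fa.span (fa_mono ` ?X \<union> J) = {a + b |a b. a \<in> fa.span (fa_mono ` ?X) \<and> b \<in> fa.span J}"
    by (rule fa.span_Un)
  moreover have "fa.span J = J" using subspace_J fa.span_eq_iff by blast
  ultimately obtain a b where ab: "fa_mono w = a + b" "a \<in> fa.span (fa_mono ` ?X)" "b \<in> J"
    using mono_in_span_normal[OF assms] by auto
  have "finite (fa_supp a)" "fa_supp a \<subseteq> ?X" using ab(2) by (auto simp: fa_span_mono_iff)
  thus thesis using ab by (intro that[of a]) (auto simp: in_fa_def dest!: normal_in_lists)
qed

end

section \<open>Evaluation in a generating family\<close>

lemma fa_eval_mono: "fa_eval f (fa_mono w) = fa_prod (map f w)"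
  by (simp add: fa_eval_def fa_mono_apply)

lemma fa_eval_superset:
  assumes "finite A" "fa_supp u \<subseteq> A"
  shows "fa_eval f u = (\<Sum>w\<in>A. fa_scale (u w) (fa_prod (map f w)))"
  unfolding fa_eval_def using assms by (intro sum.mono_neutral_left) (auto simp: fa_supp_def)

lemma fa_eval_add:
  assumes "in_fa m u" "in_fa m v"
  shows "fa_eval f (u + v) = fa_eval f u + fa_eval f v"
proof -
  let ?A = "fa_supp u \<union> fa_supp v"
  have A: "finite ?A" using assms by (auto simp: in_fa_def)
  have "fa_supp (u + v) \<subseteq> ?A" by (auto simp: fa_supp_def fa_apply)
  hence "fa_eval f (u + v) = (\<Sum>w\<in>?A. fa_scale ((u + v) w) (fa_prod (map f w)))"
    using A by (intro fa_eval_superset)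
  also have "\<dots> = (\<Sum>w\<in>?A. fa_scale (u w) (fa_prod (map f w))) + (\<Sum>w\<in>?A. fa_scale (v w) (fa_prod (map f w)))"
    by (simp add: fa_apply fa.scale_left_distrib sum.distrib)
  also have "\<dots> = fa_eval f u + fa_eval f v" using A by (simp add: fa_eval_superset[of ?A])
  finally show ?thesis .
qed

lemma fa_eval_scale: "in_fa m u \<Longrightarrow> fa_eval f (fa_scale c u) = fa_scale c (fa_eval f u)"
proof -
  assume "in_fa m u"
  hence A: "finite (fa_supp u)" by (simp add: in_fa_def)
  have "fa_supp (fa_scale c u) \<subseteq> fa_supp u" by (auto simp: fa_supp_def fa_apply)
  from fa_eval_superset[OF A this, of f] show ?thesis
    by (simp add: fa_eval_def fa.scale_sum_right fa_apply)
qed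

lemma fa_eval_0 [simp]: "fa_eval f 0 = 0"
  by (simp add: fa_eval_def fa_supp_def fa_apply)

lemma fa_eval_diff:
  assumes "in_fa m u" "in_fa m v"
  shows "fa_eval f (u - v) = fa_eval f u - fa_eval f v"
  using fa_eval_add[of m "u - v" v f] in_fa_diff[OF assms] assms by simp

lemma fa_eval_sum: "(\<And>i. i \<in> A \<Longrightarrow> in_fa m (F i)) \<Longrightarrow> fa_eval f (\<Sum>i\<in>A. F i) = (\<Sum>i\<in>A. fa_eval f (F i))"
  by (induction A rule: infinite_finite_induct) (auto simp: fa_eval_add[of m] in_fa_sum)

lemma homog_of_fa_prod:
  assumes "\<And>j. j < m \<Longrightarrow> homog_of k d (e j) (f j)" "w \<in> lists {..<m}"
  shows "homog_of k d (wdeg e w) (fa_prod (map f w))"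
  using assms(2)
proof (induction w)
  case Nil
  then show ?case by (simp add: fa_prod_def words_of_deg_def)
next
  case (Cons x w)
  then have "homog_of k d (e x + wdeg e w) (fa_mult (f x) (fa_prod (map f w)))"
    by (intro homog_of_mult assms) auto
  then show ?case by (simp add: fa_prod_def)
qed

lemma in_fa_eval:
  assumes "\<And>j. j < m \<Longrightarrow> homog_of k d (e j) (f j)" "in_fa m u"
  shows "in_fa k (fa_eval f u)"
  using assms(2)
  by (induction rule: in_fa_induct)
    (auto simp: fa_eval_add[of m] fa_eval_scale[of m] fa_eval_mono
      intro!: in_fa_add in_fa_scale homog_of_in_fa[OF homog_of_fa_prod[of m k d e f]] assms(1))

lemma in_fa_hcomp: "in_fa k f \<Longrightarrow> in_fa k (hcomp d n f)"
  using homog_of_hcomp homog_of_in_fa by blast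

lemma fa_eval_hcomp:
  assumes "\<And>j. j < m \<Longrightarrow> homog_of k d (e j) (f j)" "in_fa m u"
  shows "fa_eval f (hcomp e n u) = hcomp d n (fa_eval f u)"
  using assms(2)
proof (induction rule: in_fa_induct)
  case (mono w)
  have "hcomp e n (fa_mono w :: 'a fa) = (if wdeg e w = n then fa_mono w else 0)"
    using mono by (intro hcomp_homog[of m]) (simp add: words_of_deg_def)
  moreover have "hcomp d n (fa_prod (map f w)) = (if wdeg e w = n then fa_prod (map f w) else 0)"
    using mono assms(1) by (intro hcomp_homog[of k] homog_of_fa_prod[of m])
  ultimately show ?case by (simp add: fa_eval_mono)
qed (auto simp: hcomp_add hcomp_scale fa_eval_add[of m] fa_eval_scale[of m] in_fa_hcomp)

lemma finite_presentationD:
  assumes "finite_presentation k d R"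
  shows "\<And>i. i < k \<Longrightarrow> 0 < d i" "finite R" "\<And>r. r \<in> R \<Longrightarrow> in_fa k r" "\<And>r. r \<in> R \<Longrightarrow> \<exists>n. homog_of k d n r"
  using assms by (auto simp: finite_presentation_def homog_of_def)

text \<open>Evaluation commutes with homogeneous components because \<open>f j\<close> has degree
  \<open>e j\<close>, so the kernel is graded like the ideal.\<close>

lemma graded_subspace_pres_kernel:
  assumes R: "finite_presentation k d R"
    and f: "\<And>j. j < m \<Longrightarrow> 0 < e j \<and> homog_of k d (e j) (f j)" and r: "inj_on r {..<m}"
  shows "graded_subspace m e r (pres_kernel k R m f)"
proof
  show "fa.subspace (pres_kernel k R m f)"
    by (rule fa.subspaceI) (use subspace_fa_ideal[of k R] in \<open>auto simp: pres_kernel_def fa_eval_add[of m]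
      fa_eval_scale[of m] intro: in_fa_add in_fa_scale fa.subspace_add fa.subspace_scale fa.subspace_0\<close>)
next
  fix u n assume "u \<in> pres_kernel k R m f"
  thus "hcomp e n u \<in> pres_kernel k R m f"
    using f hcomp_fa_ideal[of R k d, OF finite_presentationD(4)[OF R]]
    by (auto simp: pres_kernel_def in_fa_hcomp fa_eval_hcomp[of m k d e f])
qed (use f r in \<open>auto simp: pres_kernel_def\<close>)

text \<open>For any homogeneous generators and any order of the letters, the normal words of degree
  n evaluate to a basis of the degree n component. A combination that lands in the ideal comes from
  an element of J and is trivial; reduction gives spanning.\<close>

theorem hilbert_fun_eq_card_normal_words:
  assumes R: "finite_presentation k d R"
    and f: "\<And>j. j < m \<Longrightarrow> 0 < e j \<and> homog_of k d (e j) (f j)" and r: "inj_on r {..<m}"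
    and gen: "\<And>g. in_fa k g \<Longrightarrow> \<exists>u. in_fa m u \<and> g - fa_eval f u \<in> fa_ideal k R"
  shows "hilbert_fun k d R n = card {w \<in> normal_words m e r (pres_kernel k R m f). wdeg e w = n}"
proof -
  define J where "J = pres_kernel k R m f"
  interpret graded_subspace m e r J
    unfolding J_def using assms by (intro graded_subspace_pres_kernel)
  define X where "X = {w \<in> normal. wdeg e w = n}"
  define V where "V = (graded_component k d n :: 'a fa set)"
  have sV: "fa.subspace V" by (simp add: V_def graded_component_eq_span)
  have f': "\<And>j. j < m \<Longrightarrow> homog_of k d (e j) (f j)" using f by blast
  have prod_homog: "homog_of k d (wdeg e w) (fa_prod (map f w))" if "w \<in> lists {..<m}" for w
    using homog_of_fa_prod[of m k d e f w] f' that by blast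
  have eval_hcomp: "fa_eval f (hcomp e n u) = hcomp d n (fa_eval f u)" if "in_fa m u" for u
    using fa_eval_hcomp[of m k d e f u n] f' that by blast
  have eval_in: "in_fa k (fa_eval f u)" if "in_fa m u" for u
    using in_fa_eval[of m k d e f u] f' that by blast
  have X_words: "X \<subseteq> words_of_deg m e n"
    using normal_in_lists by (auto simp: X_def words_of_deg_def)
  have X_normal: "X \<subseteq> normal" by (auto simp: X_def)
  have finX: "finite X"
    using X_words finite_words_of_deg[of m e] e_pos finite_subset by blast
  have X_mono: "in_fa m (fa_mono w :: 'a fa)" if "w \<in> X" for w
    using that X_words by (auto simp: words_of_deg_def)
  have comb: "(\<Sum>w\<in>X. fa_scale (c w) (fa_prod (map f w))) = fa_eval f (\<Sum>w\<in>X. fa_scale (c w) (fa_mono w))" for c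
    using X_mono by (subst fa_eval_sum[of _ m])
      (auto intro!: in_fa_scale sum.cong simp: fa_eval_scale[of m] fa_eval_mono simp del: in_fa_mono)
  have in_comb: "in_fa m (\<Sum>w\<in>X. fa_scale (c w) (fa_mono w))" for c :: "nat list \<Rightarrow> 'a"
    using X_mono by (intro in_fa_sum in_fa_scale)
  have "fa.dim V - fa.dim (fa_ideal k R \<inter> V) = card X"
  proof (rule fa.dim_diff_eq_card[where b = "\<lambda>w. fa_prod (map f w)"])
    show "finite (fa_mono ` words_of_deg k d n)"
      using finite_words_of_deg finite_presentationD[OF R] by blast
    show "V \<subseteq> fa.span (fa_mono ` words_of_deg k d n)" by (simp add: V_def graded_component_eq_span)
    show "fa.subspace V" by (rule sV)
    show "fa.subspace (fa_ideal k R \<inter> V)" using sV subspace_fa_ideal fa.subspace_inter by blast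
    show "(\<lambda>w. fa_prod (map f w)) ` X \<subseteq> V"
    proof (rule image_subsetI)
      fix w assume "w \<in> X"
      hence w: "w \<in> lists {..<m}" "wdeg e w = n" using X_words by (auto simp: words_of_deg_def)
      show "fa_prod (map f w) \<in> V"
        using prod_homog[OF w(1)] w(2) by (simp add: V_def graded_component_def)
    qed
  next
    fix c assume "(\<Sum>w\<in>X. fa_scale (c w) (fa_prod (map f w))) \<in> fa_ideal k R \<inter> V"
    hence uJ: "(\<Sum>w\<in>X. fa_scale (c w) (fa_mono w)) \<in> J"
      using in_comb by (auto simp: comb J_def pres_kernel_def)
    have val: "(\<Sum>w\<in>X. fa_scale (c w) (fa_mono w)) v = (if v \<in> X then c v else 0)" for v
      using finX by (simp add: sum_fun_apply fa_apply fa_mono_apply if_distrib[of "(*) _"] cong: if_cong)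
    have "(\<Sum>w\<in>X. fa_scale (c w) (fa_mono w)) = 0"
      by (rule normal_combination_in_J[OF uJ])
        (use X_normal in \<open>auto simp: fa_supp_def val split: if_splits\<close>)
    thus "\<forall>w\<in>X. c w = 0" using val by (metis zero_fun_apply)
  next
    show "V \<subseteq> fa.span ((\<lambda>w. fa_prod (map f w)) ` X \<union> (fa_ideal k R \<inter> V))"
    proof
      fix g assume g: "g \<in> V"
      hence gh: "homog_of k d n g" by (simp add: V_def graded_component_def)
      obtain u0 where u0: "in_fa m u0" "g - fa_eval f u0 \<in> fa_ideal k R"
        using gen homog_of_in_fa[OF gh] by blast
      \<comment> \<open>The preimage \<open>u0\<close> need not be homogeneous, but its degree n
        component still represents g, since evaluation respects degrees.\<close>
      define u where "u = hcomp e n u0"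
      have u: "homog_of m e n u" by (simp add: u_def homog_of_hcomp u0)
      have "hcomp d n (g - fa_eval f u0) \<in> fa_ideal k R"
        using hcomp_fa_ideal finite_presentationD[OF R] u0 by blast
      hence gu: "g - fa_eval f u \<in> fa_ideal k R"
        unfolding hcomp_diff u_def eval_hcomp[OF u0(1)] hcomp_homog[OF gh] by simp
      have evV: "fa_eval f v \<in> V" if "homog_of m e n v" for v
      proof -
        have "v = hcomp e n v" using hcomp_homog[OF that] by simp
        thus ?thesis
          using homog_of_hcomp[OF eval_in[OF homog_of_in_fa[OF that]], of d n]
            eval_hcomp[OF homog_of_in_fa[OF that]]
          by (simp add: V_def graded_component_def)
      qed
      let ?T = "fa.span ((\<lambda>w. fa_prod (map f w)) ` X \<union> (fa_ideal k R \<inter> V))"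
      have word: "fa_prod (map f w) \<in> ?T" if w: "w \<in> words_of_deg m e n" for w
      proof -
        have wm: "w \<in> lists {..<m}" "wdeg e w = n" using w by (auto simp: words_of_deg_def)
        obtain h where h: "fa_supp h \<subseteq> normal" "fa_mono w - h \<in> J"
            "\<And>v. v \<in> fa_supp h \<Longrightarrow> wdeg e v = wdeg e w \<and> (v = w \<or> v \<prec> w)" "in_fa m h"
          using normal_form_exists[OF wm(1)] by metis
        have hh: "homog_of m e n h" using h wm by (auto simp: homog_of_def)
        have "fa_eval f (fa_mono w - h) \<in> fa_ideal k R" using h(2) by (simp add: J_def pres_kernel_def)
        hence "fa_prod (map f w) - fa_eval f h \<in> fa_ideal k R"
          using wm(1) h(4) by (subst (asm) fa_eval_diff[of m]) (auto simp: fa_eval_mono)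
        moreover have "fa_prod (map f w) - fa_eval f h \<in> V"
          using evV[OF hh] prod_homog[OF wm(1)] wm(2) sV
          by (intro fa.subspace_diff) (auto simp: V_def graded_component_def)
        ultimately have "fa_prod (map f w) - fa_eval f h \<in> ?T" by (intro fa.span_base) auto
        moreover have "fa_eval f h \<in> ?T"
          unfolding fa_eval_def using h wm by (intro fa.span_sum fa.span_scale fa.span_base) (auto simp: X_def)
        ultimately show ?thesis using fa.span_add by fastforce
      qed
      have "fa_eval f u \<in> ?T"
        unfolding fa_eval_def using u
        by (intro fa.span_sum fa.span_scale word) (auto simp: homog_of_def in_fa_def words_of_deg_def)
      moreover have "g - fa_eval f u \<in> ?T"
        using gu fa.subspace_diff[OF sV g evV[OF u]] by (intro fa.span_base) auto
      ultimately show "g \<in> ?T" using fa.span_add by fastforce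
    qed
  qed (use finX in auto)
  thus ?thesis by (simp add: hilbert_fun_def V_def X_def J_def)
qed

text \<open>Splitting off the first letter expresses the number of words accepted from a state by
  numbers for successor states in smaller degrees. The vector of these numbers over the states thus
  obeys a deterministic recurrence, and boundedness leaves finitely many windows.\<close>

lemma rational_series_of_regular_lang:
  assumes reg: "regular_lang m L" and e: "\<And>i. i < m \<Longrightarrow> 0 < e i"
    and bnd: "\<And>n. card {w \<in> L. wdeg e w = n} \<le> C"
  shows "rational_series (\<lambda>n. card {w \<in> L. wdeg e w = n})"
proof -
  obtain Q :: "nat set" and q0 \<delta> F where Q: "finite Q" "q0 \<in> Q" "\<forall>q\<in>Q. \<forall>a<m. \<delta> q a \<in> Q" 
    and L: "L = {w \<in> lists {..<m}. foldl \<delta> q0 w \<in> F}"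
    using reg unfolding regular_lang_def by blast
  define W where "W q n = {w \<in> words_of_deg m e n. foldl \<delta> q w \<in> F}" for q n
  define a where "a q n = card (W q n)" for q n
  have finW: "finite (W q n)" for q n
    using finite_words_of_deg[of m e n] e by (simp add: W_def)
  have count: "card {w \<in> L. wdeg e w = n} = a q0 n" for n
    by (auto simp: a_def W_def L words_of_deg_def intro!: arg_cong[of _ _ card])
  \<comment> \<open>Only reachable states are considered: if u leads from \<open>q0\<close> to q,
    prefixing u embeds the words accepted from q into L, which bounds their number by C.\<close>
  define S where "S = (\<lambda>u. foldl \<delta> q0 u) ` lists {..<m}"
  have "foldl \<delta> q0 u \<in> Q" if "u \<in> lists {..<m}" for u
    using that by (induction u rule: rev_induct) (use Q in auto)
  hence finS: "finite S" using Q(1) finite_subset[of S Q] by (auto simp: S_def)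
  have S_step: "\<delta> q x \<in> S" if q: "q \<in> S" and "x < m" for q x
  proof -
    obtain u where "q = foldl \<delta> q0 u" "u \<in> lists {..<m}"
      using q unfolding S_def by blast
    hence "\<delta> q x = foldl \<delta> q0 (u @ [x])" "u @ [x] \<in> lists {..<m}" using that by auto
    thus ?thesis unfolding S_def by blast
  qed
  have a_le: "a q n \<le> C" if q: "q \<in> S" for q n
  proof -
    obtain u where u: "q = foldl \<delta> q0 u" "u \<in> lists {..<m}"
      using q unfolding S_def by blast
    have "a q n = card ((@) u ` W q n)" unfolding a_def by (simp add: card_image inj_on_def)
    also have "\<dots> \<le> card (W q0 (wdeg e u + n))"
      using u by (intro card_mono finW) (auto simp: W_def words_of_deg_def)
    also have "\<dots> \<le> C" using bnd[of "wdeg e u + n"] by (simp add: count a_def)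
    finally show ?thesis .
  qed
  \<comment> \<open>With l above every letter degree, removing the first letter of a word of degree
    n + l leaves a degree in the window from n to n + l - 1. As l is positive, such a word does have
    a first letter.\<close>
  define l where "l = Suc (\<Sum>i<m. e i)"
  have e_le: "e x < l" if "x < m" for x
    using that member_le_sum[of x "{..<m}" e] by (simp add: l_def)
  have a_rec: "a q (n + l) = (\<Sum>x<m. a (\<delta> q x) (n + (l - e x)))" for q n
  proof -
    have "W q (n + l) = (\<Union>x\<in>{..<m}. (#) x ` W (\<delta> q x) (n + (l - e x)))"
    proof (intro set_eqI iffI)
      fix w assume w: "w \<in> W q (n + l)"
      then obtain x v where xv: "w = x # v" by (cases w) (auto simp: W_def words_of_deg_def l_def)
      hence x: "x < m" using w by (auto simp: W_def words_of_deg_def)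
      hence "wdeg e v = n + (l - e x)" using w xv e_le[OF x] by (auto simp: W_def words_of_deg_def)
      hence "v \<in> W (\<delta> q x) (n + (l - e x))" using w xv by (auto simp: W_def words_of_deg_def)
      thus "w \<in> (\<Union>x\<in>{..<m}. (#) x ` W (\<delta> q x) (n + (l - e x)))" using x xv by blast
    next
      fix w assume "w \<in> (\<Union>x\<in>{..<m}. (#) x ` W (\<delta> q x) (n + (l - e x)))"
      then obtain x v where "x < m" "w = x # v" "v \<in> W (\<delta> q x) (n + (l - e x))" by blast
      thus "w \<in> W q (n + l)" using e_le[of x] by (auto simp: W_def words_of_deg_def)
    qed
    also have "card \<dots> = (\<Sum>x<m. card ((#) x ` W (\<delta> q x) (n + (l - e x))))"
      by (rule card_UN_disjoint) (auto simp: finW)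
    also have "\<dots> = (\<Sum>x<m. a (\<delta> q x) (n + (l - e x)))"
      unfolding a_def by (simp add: card_image inj_on_def)
    finally show ?thesis by (simp add: a_def)
  qed
  \<comment> \<open>The value 0 outside S puts all vectors into a finite set of functions.\<close>
  define V where "V n = (\<lambda>q. if q \<in> S then a q n else 0)" for n
  obtain P n1 where P: "0 < P" "\<forall>n\<ge>n1. V (n + P) = V n"
  proof (rule eventually_periodic_of_finite_window[of V 0 l])
    have "range V \<subseteq> {f. \<forall>q. (q \<in> S \<longrightarrow> f q \<in> {..C}) \<and> (q \<notin> S \<longrightarrow> f q = 0)}"
      using a_le by (auto simp: V_def)
    thus "finite (range V)"
      by (rule finite_subset) (intro finite_set_of_finite_funs finS finite_atMost)
  next
    fix n n' assume win: "\<forall>j<l. V (n + j) = V (n' + j)"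
    have "a (\<delta> q x) (n + (l - e x)) = a (\<delta> q x) (n' + (l - e x))" if "q \<in> S" "x < m" for q x
    proof -
      have "l - e x < l" using e[OF that(2)] by (simp add: l_def)
      hence "V (n + (l - e x)) (\<delta> q x) = V (n' + (l - e x)) (\<delta> q x)" using win by simp
      thus ?thesis using S_step[OF that] by (simp add: V_def)
    qed
    thus "V (n + l) = V (n' + l)" by (auto simp: V_def a_rec fun_eq_iff intro!: sum.cong)
  qed (use that in blast)
  have "q0 \<in> S" unfolding S_def by (rule image_eqI[of _ _ "[]"]) auto
  hence "\<forall>n\<ge>n1. a q0 (n + P) = a q0 n" using P(2) by (auto simp: V_def fun_eq_iff split: if_splits)
  thus ?thesis unfolding count using P(1) by (rule rational_series_of_eventually_periodic[rotated])
qed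

theorem rational_series_of_automaton_presentable:
  assumes R: "finite_presentation k d R" and lin: "linear_growth k d R" and aut: "automaton_presentable k d R"
  shows "rational_series (hilbert_fun k d R)"
proof -
  obtain m e f r where gen: "generating_family k d R m e f" and r: "inj_on r {..<m}"
    and reg: "regular_lang m (normal_words m e r (pres_kernel k R m f))"
    using aut unfolding automaton_presentable_def by blast
  have h: "hilbert_fun k d R = (\<lambda>n. card {w \<in> normal_words m e r (pres_kernel k R m f). wdeg e w = n})"
    using gen r by (intro ext hilbert_fun_eq_card_normal_words[OF R])
      (auto simp: generating_family_def)
  obtain C where "\<And>n. hilbert_fun k d R n \<le> C" using lin unfolding linear_growth_def by blast
  thus ?thesis unfolding h using gen
    by (intro rational_series_of_regular_lang[OF reg]) (auto simp: generating_family_def)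
qed

section \<open>Normal forms\<close>

lemma fa_supp_0 [simp]: "fa_supp (0 :: 'k::field fa) = {}"
  and fa_supp_add: "fa_supp f \<subseteq> A \<Longrightarrow> fa_supp g \<subseteq> A \<Longrightarrow> fa_supp (f + g) \<subseteq> A"
  and fa_supp_diff: "fa_supp f \<subseteq> A \<Longrightarrow> fa_supp g \<subseteq> A \<Longrightarrow> fa_supp (f - g) \<subseteq> A"
  and fa_supp_scale: "fa_supp f \<subseteq> A \<Longrightarrow> fa_supp (fa_scale c f) \<subseteq> A"
  by (fastforce simp: fa_supp_def fa_apply)+

context graded_subspace
begin

lemma J_0: "0 \<in> J" and J_add: "f \<in> J \<Longrightarrow> g \<in> J \<Longrightarrow> f + g \<in> J"
  and J_diff: "f \<in> J \<Longrightarrow> g \<in> J \<Longrightarrow> f - g \<in> J" and J_scale: "f \<in> J \<Longrightarrow> fa_scale c f \<in> J"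
  and J_sum: "(\<And>i. i \<in> A \<Longrightarrow> F i \<in> J) \<Longrightarrow> (\<Sum>i\<in>A. F i) \<in> J"
  using subspace_J by (auto intro: fa.subspace_0 fa.subspace_add fa.subspace_diff fa.subspace_scale fa.subspace_sum)

text \<open>Given by uniqueness and not by a reduction procedure, so that any representative
  supported on normal words, however found, is the normal form.\<close>

definition nf :: "'k fa \<Rightarrow> 'k fa" where
  "nf f = (THE g. in_fa m g \<and> fa_supp g \<subseteq> normal \<and> f - g \<in> J)"

lemma nf_exists: "in_fa m f \<Longrightarrow> \<exists>g. in_fa m g \<and> fa_supp g \<subseteq> normal \<and> f - g \<in> J"
proof (induction rule: in_fa_induct)
  case zero
  show ?case using J_0 by (intro exI[of _ 0]) simp
next
  case (add f g)
  then obtain a b where ab: "in_fa m a" "fa_supp a \<subseteq> normal" "f - a \<in> J"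
     "in_fa m b" "fa_supp b \<subseteq> normal" "g - b \<in> J" by blast
  have "(f + g) - (a + b) \<in> J" using J_add[OF ab(3,6)] by (simp add: algebra_simps)
  thus ?case using ab by (intro exI[of _ "a + b"]) (simp add: in_fa_add fa_supp_add)
next
  case (scale c f)
  then obtain a where a: "in_fa m a" "fa_supp a \<subseteq> normal" "f - a \<in> J" by blast
  have "fa_scale c f - fa_scale c a = fa_scale c (f - a)" by (simp add: fa.scale_right_diff_distrib)
  thus ?case using a by (intro exI[of _ "fa_scale c a"]) (simp add: in_fa_scale fa_supp_scale J_scale)
next
  case (mono w)
  then show ?case using normal_form_exists by metis
qed

lemma nf_unique:
  assumes "fa_supp g \<subseteq> normal" "f - g \<in> J" "fa_supp g' \<subseteq> normal" "f - g' \<in> J"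
  shows "g = g'"
proof -
  have "(f - g') - (f - g) \<in> J" by (rule J_diff) fact+
  hence "g - g' \<in> J" by simp
  hence "g - g' = 0" using assms by (intro normal_combination_in_J fa_supp_diff)
  thus ?thesis by simp
qed

lemma nf_props:
  assumes "in_fa m f"
  shows "in_fa m (nf f)" "fa_supp (nf f) \<subseteq> normal" "f - nf f \<in> J"
proof -
  have "\<exists>!g. in_fa m g \<and> fa_supp g \<subseteq> normal \<and> f - g \<in> J"
    using nf_exists[OF assms] nf_unique by blast
  from theI'[OF this] show "in_fa m (nf f)" "fa_supp (nf f) \<subseteq> normal" "f - nf f \<in> J"
    unfolding nf_def by auto
qed

lemma nf_eqI: "in_fa m f \<Longrightarrow> fa_supp g \<subseteq> normal \<Longrightarrow> f - g \<in> J \<Longrightarrow> nf f = g"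
  using nf_unique nf_props by blast

lemma nf_cong:
  assumes "in_fa m f" "in_fa m g" "f - g \<in> J"
  shows "nf f = nf g"
proof -
  have "(f - g) + (g - nf g) \<in> J" using assms(3) nf_props(3)[OF assms(2)] by (rule J_add)
  thus ?thesis using assms nf_props by (intro nf_eqI) auto
qed

lemma nf_add:
  assumes "in_fa m f" "in_fa m g"
  shows "nf (f + g) = nf f + nf g"
proof (rule nf_eqI)
  have "(f - nf f) + (g - nf g) \<in> J" using nf_props(3) assms by (intro J_add)
  thus "f + g - (nf f + nf g) \<in> J" by (simp add: algebra_simps)
qed (use assms in \<open>simp_all add: in_fa_add fa_supp_add nf_props\<close>)

lemma nf_scale:
  assumes "in_fa m f"
  shows "nf (fa_scale c f) = fa_scale c (nf f)"
proof (rule nf_eqI)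
  have "fa_scale c (f - nf f) \<in> J" using nf_props(3) assms by (intro J_scale)
  thus "fa_scale c f - fa_scale c (nf f) \<in> J" by (simp add: fa.scale_right_diff_distrib)
qed (use assms in \<open>simp_all add: in_fa_scale fa_supp_scale nf_props\<close>)

lemma nf_J: "f \<in> J \<Longrightarrow> nf f = 0"
  by (rule nf_eqI) (auto simp: J_in_fa)

lemma nf_normal: "w \<in> normal \<Longrightarrow> nf (fa_mono w) = fa_mono w"
  using normal_in_lists J_0 by (intro nf_eqI) auto

text \<open>The degree n component of the normal form is again a representative supported on normal
  words, so uniqueness applies.\<close>

lemma nf_homog:
  assumes "homog_of m e n f"
  shows "homog_of m e n (nf f)"
proof -
  have f: "in_fa m f" using assms by (rule homog_of_in_fa)
  have "hcomp e n (f - nf f) \<in> J" using nf_props[OF f] hcomp_J by blast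
  hence "f - hcomp e n (nf f) \<in> J" by (simp add: hcomp_diff hcomp_homog[OF assms])
  moreover have "fa_supp (hcomp e n (nf f)) \<subseteq> fa_supp (nf f)" by (auto simp: fa_supp_def hcomp_def)
  ultimately have "nf f = hcomp e n (nf f)" using nf_props[OF f] f by (intro nf_eqI) auto
  thus ?thesis using homog_of_hcomp[OF nf_props(1)[OF f]] by metis
qed

lemma nf_mono_supp:
  assumes "w \<in> lists {..<m}" "nf (fa_mono w) v \<noteq> 0"
  shows "v \<in> normal" "wdeg e v = wdeg e w" "v = w \<or> v \<prec> w"
proof -
  obtain g where g: "fa_supp g \<subseteq> normal" "fa_mono w - g \<in> J"
    "\<And>v. v \<in> fa_supp g \<Longrightarrow> wdeg e v = wdeg e w \<and> (v = w \<or> v \<prec> w)" "in_fa m g"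
    using normal_form_exists[OF assms(1)] by metis
  have "nf (fa_mono w) = g" using g assms(1) by (intro nf_eqI) auto
  hence "v \<in> fa_supp g" using assms(2) by (simp add: fa_supp_def)
  thus "v \<in> normal" "wdeg e v = wdeg e w" "v = w \<or> v \<prec> w" using g by blast+
qed

lemma not_normal_iff:
  assumes "w \<in> lists {..<m}"
  shows "w \<notin> normal \<longleftrightarrow> (\<exists>u\<in>J. is_leading e r u w)"
  using assms by (auto simp: normal_words_def)

end

lemma fa_mult_Cons_apply:
  "fa_mult (fa_mono [x]) f w = (case w of [] \<Rightarrow> 0 | y # v \<Rightarrow> if y = x then f v else 0)"
  by (cases w) (auto simp: fa_mult_mono_apply)

text \<open>The coefficient of x in the decomposition of f into its constant term and a sum of
  products of a letter with an element.\<close>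

definition left_quotient :: "nat \<Rightarrow> 'k fa \<Rightarrow> 'k fa" where
  "left_quotient x f = (\<lambda>w. f (x # w))"

lemma left_quotient_linear:
  "left_quotient x (f + g) = left_quotient x f + left_quotient x g"
  "left_quotient x (fa_scale c f) = fa_scale c (left_quotient x f)"
  "left_quotient x (0 :: 'k::field fa) = 0"
  by (auto simp: left_quotient_def fun_eq_iff fa_apply)

lemma left_quotient_Cons: "left_quotient x (fa_mult (fa_mono [y]) f) = (if x = y then f else 0)"
  by (auto simp: left_quotient_def fun_eq_iff fa_mult_Cons_apply fa_apply)

text \<open>When f has no constant term, every word of the product takes its first letter from
  f.\<close>

lemma left_quotient_mult:
  assumes "f [] = 0"
  shows "left_quotient x (fa_mult f g) = fa_mult (left_quotient x f) g"
  using assms by (auto simp: left_quotient_def fa_mult_def fun_eq_iff sum.atMost_Suc_shift simp del: sum.atMost_Suc)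

lemma in_fa_left_quotient:
  assumes "in_fa k f"
  shows "in_fa k (left_quotient x f)"
proof -
  have "(#) x ` fa_supp (left_quotient x f) \<subseteq> fa_supp f" by (auto simp: fa_supp_def left_quotient_def)
  moreover have "finite (fa_supp f)" "fa_supp f \<subseteq> lists {..<k}" using assms by (auto simp: in_fa_def)
  ultimately have "finite ((#) x ` fa_supp (left_quotient x f))" "(#) x ` fa_supp (left_quotient x f) \<subseteq> lists {..<k}"
    using finite_subset by blast+
  thus ?thesis unfolding in_fa_def by (auto simp: finite_image_iff)
qed

lemma homog_of_left_quotient:
  assumes "homog_of k d n f"
  shows "homog_of k d (n - d x) (left_quotient x f)"
  using in_fa_left_quotient[OF homog_of_in_fa[OF assms]] assms
  by (force simp: homog_of_def fa_supp_def left_quotient_def)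

lemma fa_eq_sum_left_quotients:
  assumes "in_fa k f" "f [] = 0"
  shows "f = (\<Sum>x<k. fa_mult (fa_mono [x]) (left_quotient x f))"
proof
  fix w
  show "f w = (\<Sum>x<k. fa_mult (fa_mono [x]) (left_quotient x f)) w"
  proof (cases w)
    case Nil
    then show ?thesis using assms by (simp add: sum_fun_apply fa_mult_Cons_apply)
  next
    case (Cons y v)
    have "(\<Sum>x<k. fa_mult (fa_mono [x]) (left_quotient x f)) w = (\<Sum>x<k. if x = y then f w else 0)"
      using Cons by (auto simp: sum_fun_apply fa_mult_Cons_apply left_quotient_def intro!: sum.cong)
    also have "\<dots> = f w"
      using assms(1) Cons by (auto simp: in_fa_def fa_supp_def)
    finally show ?thesis by simp
  qed
qed

lemma fa_ideal_mult_right_base: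
  assumes "r \<in> R" "in_fa k g"
  shows "fa_mult r g \<in> fa_ideal k R"
  using assms(2)
proof (induction rule: in_fa_induct)
  case (mono w)
  have "sandwich [] r w \<in> fa_ideal k R" using mono assms by (intro fa_ideal_base) auto
  then show ?case by simp
qed (use subspace_fa_ideal[of k R] in \<open>auto simp: fa_mult_add_right fa_mult_scale_right
   intro: fa.subspace_add fa.subspace_scale fa.subspace_0\<close>)

section \<open>Similar windows of homogeneous components\<close>

locale fp_algebra =
  fixes k :: nat and d :: "nat \<Rightarrow> nat" and R :: "'k::field fa set"
  assumes fp: "finite_presentation k d R"

text \<open>Here the letters themselves are the generators, ordered by index. Coincidences between
  letters are handled only when the automaton is built.\<close>

sublocale fp_algebra \<subseteq> graded_subspace k d "\<lambda>i. i" "fa_ideal k R"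
proof
  fix u n assume "u \<in> fa_ideal k R"
  thus "in_fa k u" "hcomp d n u \<in> fa_ideal k R"
    using fa_ideal_in_fa hcomp_fa_ideal finite_presentationD[OF fp] by blast+
qed (use finite_presentationD[OF fp] subspace_fa_ideal in auto)

context fp_algebra
begin

abbreviation I where "I \<equiv> fa_ideal k R"

abbreviation less_id (infix \<open>\<prec>\<close> 50) where "u \<prec> v \<equiv> deglex_less d (\<lambda>i. i) u v"

lemma I_mult_left: "f \<in> I \<Longrightarrow> w \<in> lists {..<k} \<Longrightarrow> fa_mult (fa_mono w) f \<in> I"
  using fa_ideal_mult_left finite_presentationD(3)[OF fp] by blast

text \<open>Left multiplication by x turns an element of the ideal with leading word w into one with
  leading word \<open>x # w\<close>.\<close>

lemma normal_Cons:
  assumes "x # w \<in> normal"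
  shows "x < k" "w \<in> normal"
proof -
  have xw: "x < k" "w \<in> lists {..<k}" using normal_in_lists[OF assms] by auto
  show "x < k" by fact
  show "w \<in> normal"
  proof (rule ccontr)
    assume "w \<notin> normal"
    then obtain u where u: "u \<in> I" "is_leading d (\<lambda>i. i) u w" using not_normal_iff xw by blast
    have "fa_mult (fa_mono [x]) u \<in> I" using u xw by (intro I_mult_left) auto
    moreover have "is_leading d (\<lambda>i. i) (fa_mult (fa_mono [x]) u) (x # w)"
      using u(2) by (auto simp: is_leading_def fa_mult_Cons_apply deglex_less_def split: list.splits if_splits)
    ultimately show False using assms by (auto simp: normal_words_def)
  qed
qed

definition NW :: "nat \<Rightarrow> nat \<Rightarrow> nat list set" where
  "NW n t = {w \<in> normal. n \<le> wdeg d w \<and> wdeg d w \<le> n + t}"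

lemma finite_NW: "finite (NW n t)"
proof (rule finite_subset)
  show "NW n t \<subseteq> (\<Union>i\<in>{n..n + t}. words_of_deg k d i)"
    using normal_in_lists by (auto simp: NW_def words_of_deg_def)
  show "finite (\<Union>i\<in>{n..n + t}. words_of_deg k d i)"
    using finite_words_of_deg e_pos by blast
qed

lemma NW_lists: "w \<in> NW n t \<Longrightarrow> w \<in> lists {..<k}"
  using normal_in_lists by (auto simp: NW_def)

text \<open>\<open>\<theta>\<close> identifies the degrees \<open>n, \<dots>, n + t\<close> of the algebra with the degrees
  \<open>n', \<dots>, n' + t\<close>, compatibly with left multiplication by letters and with the order.\<close>
definition sim :: "nat \<Rightarrow> nat \<Rightarrow> nat \<Rightarrow> (nat list \<Rightarrow> nat list) \<Rightarrow> bool" where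
  "sim n n' t \<theta> \<longleftrightarrow> bij_betw \<theta> (NW n t) (NW n' t) \<and>
     (\<forall>w\<in>NW n t. wdeg d (\<theta> w) + n = wdeg d w + n') \<and>
     (\<forall>v\<in>NW n t. \<forall>w\<in>NW n t. wdeg d v = wdeg d w \<longrightarrow> (v \<prec> w \<longleftrightarrow> \<theta> v \<prec> \<theta> w)) \<and>
     (\<forall>w\<in>NW n t. \<forall>x<k. wdeg d (x # w) \<le> n + t \<longrightarrow>
        (x # w \<in> normal \<longleftrightarrow> x # \<theta> w \<in> normal) \<and>
        (x # w \<in> normal \<longrightarrow> \<theta> (x # w) = x # \<theta> w) \<and>
        (\<forall>v\<in>NW n t. wdeg d v = wdeg d (x # w) \<longrightarrow>
           nf (fa_mono (x # w)) v = nf (fa_mono (x # \<theta> w)) (\<theta> v)))"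

text \<open>Facts about \<theta> that are proved in one direction yield their converses by passing
  to the inverse similarity.\<close>

lemma sim_sym:
  assumes "sim n n' t \<theta>"
  shows "sim n' n t (inv_into (NW n t) \<theta>)"
proof -
  let ?\<eta> = "inv_into (NW n t) \<theta>"
  have bij: "bij_betw \<theta> (NW n t) (NW n' t)"
    and deg: "\<And>w. w \<in> NW n t \<Longrightarrow> wdeg d (\<theta> w) + n = wdeg d w + n'"
    and ord: "\<And>v w. v \<in> NW n t \<Longrightarrow> w \<in> NW n t \<Longrightarrow> wdeg d v = wdeg d w \<Longrightarrow> v \<prec> w \<longleftrightarrow> \<theta> v \<prec> \<theta> w"
    and mul: "\<And>w x. w \<in> NW n t \<Longrightarrow> x < k \<Longrightarrow> wdeg d (x # w) \<le> n + t \<Longrightarrow>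
        (x # w \<in> normal \<longleftrightarrow> x # \<theta> w \<in> normal) \<and> (x # w \<in> normal \<longrightarrow> \<theta> (x # w) = x # \<theta> w) \<and>
        (\<forall>v\<in>NW n t. wdeg d v = wdeg d (x # w) \<longrightarrow> nf (fa_mono (x # w)) v = nf (fa_mono (x # \<theta> w)) (\<theta> v))"
    using assms unfolding sim_def by blast+
  have \<eta>: "?\<eta> w \<in> NW n t" "\<theta> (?\<eta> w) = w" if "w \<in> NW n' t" for w
    using that bij by (auto simp: bij_betw_def inv_into_into f_inv_into_f)
  have \<eta>\<theta>: "?\<eta> (\<theta> w) = w" if "w \<in> NW n t" for w
    using that bij by (simp add: bij_betw_def)
  have deg': "wdeg d (?\<eta> w) + n' = wdeg d w + n" if "w \<in> NW n' t" for w
    using deg[OF \<eta>(1)[OF that]] \<eta>(2)[OF that] by simp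
  show ?thesis unfolding sim_def
  proof (intro conjI ballI allI impI)
    show "bij_betw ?\<eta> (NW n' t) (NW n t)" using bij by (rule bij_betw_inv_into)
  next
    fix w assume "w \<in> NW n' t"
    thus "wdeg d (?\<eta> w) + n' = wdeg d w + n" by (rule deg')
  next
    fix v w assume vw: "v \<in> NW n' t" "w \<in> NW n' t" "wdeg d v = wdeg d w"
    have "wdeg d (?\<eta> v) = wdeg d (?\<eta> w)" using deg'[OF vw(1)] deg'[OF vw(2)] vw(3) by simp
    thus "v \<prec> w \<longleftrightarrow> ?\<eta> v \<prec> ?\<eta> w" using ord[OF \<eta>(1) \<eta>(1), OF vw(1,2)] \<eta>(2) vw by simp
  next
    fix w x assume w: "w \<in> NW n' t" "x < k" "wdeg d (x # w) \<le> n' + t"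
    have le: "wdeg d (x # ?\<eta> w) \<le> n + t" using deg'[OF w(1)] w(3) by simp
    note m = mul[OF \<eta>(1)[OF w(1)] w(2) le, unfolded \<eta>(2)[OF w(1)]]
    show nrm: "x # w \<in> normal \<longleftrightarrow> x # ?\<eta> w \<in> normal" using m by blast
    show "?\<eta> (x # w) = x # ?\<eta> w" if "x # w \<in> normal"
    proof -
      have "x # ?\<eta> w \<in> normal" "\<theta> (x # ?\<eta> w) = x # w" using m that by auto
      moreover have "x # ?\<eta> w \<in> NW n t" using calculation(1) le \<eta>(1)[OF w(1)] by (auto simp: NW_def)
      ultimately show ?thesis using \<eta>\<theta> by metis
    qed
    fix v assume v: "v \<in> NW n' t" "wdeg d v = wdeg d (x # w)"
    have "wdeg d (?\<eta> v) = wdeg d (x # ?\<eta> w)" using deg'[OF v(1)] deg'[OF w(1)] v(2) by simp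
    thus "nf (fa_mono (x # w)) v = nf (fa_mono (x # ?\<eta> w)) (?\<eta> v)"
      using m \<eta>[OF v(1)] by metis
  qed
qed

end

text \<open>The width t is at least the degree of every letter and every defining relation. In
  degree n + t + 1 a normal word therefore loses its first letter into the window, and for a product
  of a defining relation r with a word v, the word v lies in the window.\<close>

locale fp_algebra_sim = fp_algebra k d R for k d and R :: "'k::field fa set" +
  fixes n n' t :: nat and \<theta> :: "nat list \<Rightarrow> nat list"
  assumes sim: "sim n n' t \<theta>"
    and d_le: "\<And>x. x < k \<Longrightarrow> d x \<le> t"
    and R_le: "\<And>r. r \<in> R \<Longrightarrow> \<exists>l>0. l \<le> t \<and> homog_of k d l r"
begin

lemma bij: "bij_betw \<theta> (NW n t) (NW n' t)"
  and deg: "\<And>w. w \<in> NW n t \<Longrightarrow> wdeg d (\<theta> w) + n = wdeg d w + n'"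
  and ord: "\<And>v w. v \<in> NW n t \<Longrightarrow> w \<in> NW n t \<Longrightarrow> wdeg d v = wdeg d w \<Longrightarrow> v \<prec> w \<longleftrightarrow> \<theta> v \<prec> \<theta> w"
  and mul_normal: "\<And>w x. w \<in> NW n t \<Longrightarrow> x < k \<Longrightarrow> wdeg d (x # w) \<le> n + t \<Longrightarrow>
      x # w \<in> normal \<longleftrightarrow> x # \<theta> w \<in> normal"
  and mul_\<theta>: "\<And>w x. w \<in> NW n t \<Longrightarrow> x < k \<Longrightarrow> wdeg d (x # w) \<le> n + t \<Longrightarrow>
      x # w \<in> normal \<Longrightarrow> \<theta> (x # w) = x # \<theta> w"
  and mul_nf: "\<And>w x v. w \<in> NW n t \<Longrightarrow> x < k \<Longrightarrow> wdeg d (x # w) \<le> n + t \<Longrightarrow> v \<in> NW n t \<Longrightarrow>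
      wdeg d v = wdeg d (x # w) \<Longrightarrow> nf (fa_mono (x # w)) v = nf (fa_mono (x # \<theta> w)) (\<theta> v)"
  using sim unfolding sim_def by blast+

lemma \<theta>_NW: "w \<in> NW n t \<Longrightarrow> \<theta> w \<in> NW n' t"
  using bij by (auto simp: bij_betw_def)

text \<open>The linear map of the algebra induced by \<theta> on degrees n to n + t, lifted to the
  free algebra through normal forms; parts of f outside these degrees go to 0.\<close>

definition Th :: "'k fa \<Rightarrow> 'k fa" where
  "Th f = (\<Sum>w\<in>NW n t. fa_scale (nf f w) (fa_mono (\<theta> w)))"

lemma in_fa_Th: "in_fa k (Th f)"
  unfolding Th_def by (intro in_fa_sum in_fa_scale) (metis in_fa_mono \<theta>_NW NW_lists)

lemma Th_add: "in_fa k f \<Longrightarrow> in_fa k g \<Longrightarrow> Th (f + g) = Th f + Th g"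
  by (simp add: Th_def nf_add fa_apply fa.scale_left_distrib sum.distrib)

lemma Th_scale: "in_fa k f \<Longrightarrow> Th (fa_scale c f) = fa_scale c (Th f)"
  by (simp add: Th_def nf_scale fa_apply fa.scale_sum_right)

lemma Th_I: "f \<in> I \<Longrightarrow> Th f = 0"
  by (simp add: Th_def nf_J fa_apply)

lemma Th_0: "Th 0 = 0"
  using Th_I J_0 by blast

lemma Th_sum: "(\<And>i. i \<in> A \<Longrightarrow> in_fa k (F i)) \<Longrightarrow> Th (\<Sum>i\<in>A. F i) = (\<Sum>i\<in>A. Th (F i))"
  by (induction A rule: infinite_finite_induct) (auto simp: Th_add in_fa_sum Th_0)

lemma Th_cong: "in_fa k f \<Longrightarrow> in_fa k g \<Longrightarrow> f - g \<in> I \<Longrightarrow> Th f = Th g"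
  using nf_cong by (simp add: Th_def)

lemma Th_normal: "w \<in> NW n t \<Longrightarrow> Th (fa_mono w) = fa_mono (\<theta> w)"
proof -
  assume w: "w \<in> NW n t"
  have "Th (fa_mono w) = (\<Sum>v\<in>NW n t. if v = w then fa_mono (\<theta> v) else 0)"
    unfolding Th_def using w by (intro sum.cong) (auto simp: nf_normal NW_def fa_mono_apply)
  thus ?thesis using w finite_NW by simp
qed

text \<open>Both sides have the same structure constants: for words v of the right degree by
  \<open>mul_nf\<close>, for other degrees because both coefficients are 0.\<close>

lemma Th_Cons_normal:
  assumes w: "w \<in> NW n t" and x: "x < k" and le: "wdeg d (x # w) \<le> n + t"
  shows "Th (fa_mono (x # w)) - fa_mono (x # \<theta> w) \<in> I"
proof -
  have wl: "x # w \<in> lists {..<k}" "x # \<theta> w \<in> lists {..<k}"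
    using x NW_lists[OF w] NW_lists[OF \<theta>_NW[OF w]] by auto
  let ?g = "nf (fa_mono (x # \<theta> w))"
  have supp: "fa_supp ?g \<subseteq> NW n' t"
  proof
    fix v assume "v \<in> fa_supp ?g"
    hence v: "?g v \<noteq> 0" by (simp add: fa_supp_def)
    note nf_mono_supp[OF wl(2) v]
    thus "v \<in> NW n' t" using deg[OF w] le w by (auto simp: NW_def)
  qed
  have eq: "nf (fa_mono (x # w)) v = ?g (\<theta> v)" if "v \<in> NW n t" for v
  proof (cases "wdeg d v = wdeg d (x # w)")
    case True
    then show ?thesis using mul_nf[OF w x le that] by simp
  next
    case False
    hence "nf (fa_mono (x # w)) v = 0" using nf_mono_supp(2)[OF wl(1)] by metis
    moreover have "wdeg d (\<theta> v) \<noteq> wdeg d (x # \<theta> w)" using False deg[OF that] deg[OF w] by simp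
    hence "?g (\<theta> v) = 0" using nf_mono_supp(2)[OF wl(2)] by metis
    ultimately show ?thesis by simp
  qed
  have "Th (fa_mono (x # w)) = (\<Sum>v\<in>NW n t. fa_scale (?g (\<theta> v)) (fa_mono (\<theta> v)))"
    unfolding Th_def by (intro sum.cong) (auto simp: eq)
  also have "\<dots> = (\<Sum>v\<in>NW n' t. fa_scale (?g v) (fa_mono v))"
    by (rule sum.reindex_bij_betw[OF bij])
  also have "\<dots> = ?g" using fa_expand[OF finite_NW supp] by simp
  finally have "Th (fa_mono (x # w)) = ?g" .
  moreover have "fa_mono (x # \<theta> w) - ?g \<in> I" using nf_props(3) wl(2) in_fa_mono by blast
  ultimately show ?thesis using J_scale[of "fa_mono (x # \<theta> w) - ?g" "-1"] by simp
qed

text \<open>Replacing f by its normal form changes both sides only modulo the ideal, and for normal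
  words the claim is \<open>Th_Cons_normal\<close>.\<close>

lemma Th_Cons:
  assumes f: "homog_of k d (n + j) f" and x: "x < k" and le: "j + d x \<le> t"
  shows "Th (fa_mult (fa_mono [x]) f) - fa_mult (fa_mono [x]) (Th f) \<in> I"
proof -
  let ?g = "nf f"
  have f_in: "in_fa k f" and g_in: "in_fa k ?g" using f nf_props homog_of_in_fa by blast+
  have x_in: "in_fa k (fa_mono [x] :: 'k fa)" using x by simp
  have g: "homog_of k d (n + j) ?g" using f by (rule nf_homog)
  have S: "w \<in> NW n t" "wdeg d (x # w) \<le> n + t" if "w \<in> fa_supp ?g" for w
    using that g nf_props(2)[OF f_in] le by (auto simp: NW_def homog_of_def)
  have fin: "finite (fa_supp ?g)" using g_in by (simp add: in_fa_def)
  have exp: "?g = (\<Sum>w\<in>fa_supp ?g. fa_scale (?g w) (fa_mono w))" using fin by (intro fa_expand) auto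
  have mono_in: "in_fa k (fa_mono w :: 'k fa)" "in_fa k (fa_mono (x # w) :: 'k fa)" if "w \<in> fa_supp ?g" for w
    using NW_lists[OF S(1)[OF that]] x by auto
  have "fa_mult (fa_mono [x]) (f - ?g) \<in> I" using nf_props(3)[OF f_in] x by (intro I_mult_left) auto
  hence 1: "Th (fa_mult (fa_mono [x]) f) = Th (fa_mult (fa_mono [x]) ?g)"
    using f_in g_in x_in by (intro Th_cong in_fa_mult) (auto simp: fa_mult_diff_right)
  have "fa_mult (fa_mono [x]) ?g = (\<Sum>w\<in>fa_supp ?g. fa_scale (?g w) (fa_mono (x # w)))"
    by (subst exp) (simp add: fa_mult_sum_right fa_mult_scale_right)
  hence 2: "Th (fa_mult (fa_mono [x]) ?g) = (\<Sum>w\<in>fa_supp ?g. fa_scale (?g w) (Th (fa_mono (x # w))))"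
    using mono_in by (simp add: Th_sum Th_scale in_fa_scale del: in_fa_mono)
  have "Th f = Th ?g" using f_in g_in nf_props(3) by (intro Th_cong)
  also have "\<dots> = (\<Sum>w\<in>fa_supp ?g. fa_scale (?g w) (fa_mono (\<theta> w)))"
    by (subst exp) (use mono_in S in \<open>simp add: Th_sum Th_scale in_fa_scale Th_normal del: in_fa_mono\<close>)
  finally have 3: "fa_mult (fa_mono [x]) (Th f) = (\<Sum>w\<in>fa_supp ?g. fa_scale (?g w) (fa_mono (x # \<theta> w)))"
    by (simp add: fa_mult_sum_right fa_mult_scale_right)
  have "Th (fa_mult (fa_mono [x]) f) - fa_mult (fa_mono [x]) (Th f)
      = (\<Sum>w\<in>fa_supp ?g. fa_scale (?g w) (Th (fa_mono (x # w)) - fa_mono (x # \<theta> w)))"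
    unfolding 1 2 3 by (simp add: sum_subtractf fa.scale_right_diff_distrib)
  also have "\<dots> \<in> I" using S x by (intro J_sum J_scale Th_Cons_normal)
  finally show ?thesis .
qed

text \<open>Letters are applied one at a time; the bound on \<open>j + wdeg d u\<close> keeps every
  intermediate product inside the window.\<close>

lemma Th_word:
  assumes f: "homog_of k d (n + j) f" and "u \<in> lists {..<k}" and "j + wdeg d u \<le> t"
  shows "Th (fa_mult (fa_mono u) f) - fa_mult (fa_mono u) (Th f) \<in> I"
  using assms(2,3)
proof (induction u)
  case Nil
  then show ?case using J_0 by simp
next
  case (Cons x u)
  have x: "x < k" and u: "u \<in> lists {..<k}" using Cons by auto
  have ins: "in_fa k (fa_mono [x] :: 'k fa)" "in_fa k (fa_mono u :: 'k fa)" "in_fa k f"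
    using x u homog_of_in_fa[OF f] by auto
  have "homog_of k d (wdeg d u + (n + j)) (fa_mult (fa_mono u) f)"
    using u f by (intro homog_of_mult) (auto simp: words_of_deg_def)
  hence h: "homog_of k d (n + (j + wdeg d u)) (fa_mult (fa_mono u) f)" by (simp add: ac_simps)
  have split: "fa_mult (fa_mono (x # u)) g = fa_mult (fa_mono [x]) (fa_mult (fa_mono u) g)" if "in_fa k g" for g :: "'k fa"
    using fa_mult_assoc[OF ins(1,2) that] by simp
  have "Th (fa_mult (fa_mono [x]) (fa_mult (fa_mono u) f)) - fa_mult (fa_mono [x]) (Th (fa_mult (fa_mono u) f)) \<in> I"
    using h x Cons.prems by (intro Th_Cons) auto
  moreover have "fa_mult (fa_mono [x]) (Th (fa_mult (fa_mono u) f) - fa_mult (fa_mono u) (Th f)) \<in> I"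
    using Cons x by (intro I_mult_left) auto
  ultimately show ?case unfolding split[OF ins(3)] split[OF in_fa_Th]
    using J_add by (fastforce simp: fa_mult_diff_right)
qed

lemma Th_mult:
  assumes f: "homog_of k d (n + j) f" and g: "homog_of k d l g" and le: "j + l \<le> t"
  shows "Th (fa_mult g f) - fa_mult g (Th f) \<in> I"
proof -
  have fin: "finite (fa_supp g)" "fa_supp g \<subseteq> lists {..<k}" using g by (auto simp: homog_of_def in_fa_def)
  have exp: "g = (\<Sum>w\<in>fa_supp g. fa_scale (g w) (fa_mono w))" using fin by (intro fa_expand) auto
  have ins: "in_fa k (fa_mult (fa_mono w) f)" if "w \<in> fa_supp g" for w
    using that fin homog_of_in_fa[OF f] by (intro in_fa_mult) auto
  have "fa_mult g h = (\<Sum>w\<in>fa_supp g. fa_scale (g w) (fa_mult (fa_mono w) h))" for h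
    by (subst exp) (simp add: fa_mult_sum_left fa_mult_scale_left)
  hence "Th (fa_mult g f) - fa_mult g (Th f)
      = (\<Sum>w\<in>fa_supp g. fa_scale (g w) (Th (fa_mult (fa_mono w) f) - fa_mult (fa_mono w) (Th f)))"
    using ins by (simp add: Th_sum Th_scale in_fa_scale sum_subtractf fa.scale_right_diff_distrib)
  also have "\<dots> \<in> I"
    using g fin le by (intro J_sum J_scale Th_word[OF f]) (auto simp: homog_of_def)
  finally show ?thesis .
qed

text \<open>The extension of \<open>Th\<close> to degree \<open>n + t + 1\<close>. It maps relations to relations because every
  relation either starts with a letter or is a multiple of a defining relation, whose degree is at most \<open>t\<close>.\<close>
definition Psi :: "'k fa \<Rightarrow> 'k fa" where
  "Psi f = (\<Sum>x<k. fa_mult (fa_mono [x]) (Th (left_quotient x f)))"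

lemma Psi_add: "in_fa k f \<Longrightarrow> in_fa k g \<Longrightarrow> Psi (f + g) = Psi f + Psi g"
  by (simp add: Psi_def left_quotient_linear Th_add in_fa_left_quotient fa_mult_add_right sum.distrib)

lemma Psi_scale: "in_fa k f \<Longrightarrow> Psi (fa_scale c f) = fa_scale c (Psi f)"
  by (simp add: Psi_def left_quotient_linear Th_scale in_fa_left_quotient fa_mult_scale_right fa.scale_sum_right)

lemma Psi_0: "Psi 0 = 0"
  by (simp add: Psi_def left_quotient_linear Th_0)

lemma Psi_sum: "(\<And>i. i \<in> A \<Longrightarrow> in_fa k (F i)) \<Longrightarrow> Psi (\<Sum>i\<in>A. F i) = (\<Sum>i\<in>A. Psi (F i))"
  by (induction A rule: infinite_finite_induct) (auto simp: Psi_add in_fa_sum Psi_0)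

lemma Psi_diff: "in_fa k f \<Longrightarrow> in_fa k g \<Longrightarrow> Psi (f - g) = Psi f - Psi g"
  using Psi_add[of "f - g" g] in_fa_diff[of k f g] by simp

lemma Psi_Cons:
  assumes "x < k"
  shows "Psi (fa_mult (fa_mono [x]) f) = fa_mult (fa_mono [x]) (Th f)"
proof -
  have "Psi (fa_mult (fa_mono [x]) f) = (\<Sum>y<k. if y = x then fa_mult (fa_mono [x]) (Th f) else 0)"
    unfolding Psi_def left_quotient_Cons by (intro sum.cong) (auto simp: Th_0)
  thus ?thesis using assms by simp
qed

lemma Psi_hcomp_I:
  assumes "f \<in> I"
  shows "Psi (hcomp d (n + t + 1) f) \<in> I"
  using assms
proof (induction rule: fa_ideal_induct)
  case zero
  then show ?case using J_0 by (simp add: Psi_0)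
next
  case (add f g)
  then show ?case using J_in_fa J_add by (simp add: hcomp_add Psi_add in_fa_hcomp)
next
  case (scale c f)
  then show ?case using J_in_fa J_scale by (simp add: hcomp_scale Psi_scale in_fa_hcomp)
next
  case (base u v r)
  obtain l where l: "l > 0" "l \<le> t" "homog_of k d l r" using R_le base by blast
  have r_in: "in_fa k r" using l homog_of_in_fa by blast
  have h: "homog_of k d (wdeg d u + l + wdeg d v) (sandwich u r v)"
    using base l by (intro homog_of_mult) (auto simp: words_of_deg_def)
  show ?case
  proof (cases "wdeg d u + l + wdeg d v = n + t + 1")
    case False
    then show ?thesis using J_0 by (simp add: hcomp_homog[OF h] Psi_0)
  next
    case True
    hence hc: "hcomp d (n + t + 1) (sandwich u r v) = sandwich u r v" by (simp add: hcomp_homog[OF h])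
    show ?thesis
    proof (cases u)
      case (Cons y u')
      have y: "y < k" and u': "u' \<in> lists {..<k}" using base Cons by auto
      have ins: "in_fa k (fa_mono [y] :: 'k fa)" "in_fa k (fa_mono u' :: 'k fa)" "in_fa k (fa_mono v :: 'k fa)"
        using y u' base by auto
      have eq: "sandwich u r v = fa_mult (fa_mono [y]) (sandwich u' r v)"
        using ins r_in Cons by (simp add: fa_mult_assoc[of k, symmetric] in_fa_mult del: in_fa_mono)
      have "sandwich u' r v \<in> I" using u' base by (intro fa_ideal_base)
      thus ?thesis unfolding hc unfolding eq using y J_0 by (simp add: Psi_Cons Th_I)
    next
      case Nil
      have r0: "r [] = 0" using l by (auto simp: homog_of_def fa_supp_def)
      have v: "wdeg d v = n + (t + 1 - l)" using True Nil l by simp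
      have vh: "homog_of k d (n + (t + 1 - l)) (fa_mono v :: 'k fa)" using base v by (simp add: words_of_deg_def)
      \<comment> \<open>Since x has positive degree, \<open>left_quotient x r\<close> has degree at
        most l - 1, so the product with v has degree at most n + t and \<open>Th\<close> commutes
        with the multiplication. Summing over x turns \<open>Psi\<close> of r v into r times
        \<open>Th\<close> of v, modulo the ideal.\<close>
      have part: "Th (fa_mult (left_quotient x r) (fa_mono v)) - fa_mult (left_quotient x r) (Th (fa_mono v)) \<in> I"
        if "x < k" for x
        using l e_pos[OF that] by (intro Th_mult[OF vh homog_of_left_quotient[OF l(3)]]) auto
      have "Psi (fa_mult r (fa_mono v))
          = (\<Sum>x<k. fa_mult (fa_mono [x]) (Th (fa_mult (left_quotient x r) (fa_mono v))))"
        unfolding Psi_def left_quotient_mult[of r, OF r0] ..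
      also have "\<dots> = (\<Sum>x<k. fa_mult (fa_mono [x]) (Th (fa_mult (left_quotient x r) (fa_mono v))
            - fa_mult (left_quotient x r) (Th (fa_mono v))))
          + (\<Sum>x<k. fa_mult (fa_mono [x]) (fa_mult (left_quotient x r) (Th (fa_mono v))))"
        by (simp add: fa_mult_diff_right sum_subtractf)
      also have "(\<Sum>x<k. fa_mult (fa_mono [x]) (fa_mult (left_quotient x r) (Th (fa_mono v))))
          = (\<Sum>x<k. fa_mult (fa_mult (fa_mono [x]) (left_quotient x r)) (Th (fa_mono v)))"
        by (intro sum.cong refl fa_mult_assoc[of k, symmetric] in_fa_left_quotient r_in in_fa_Th) auto
      also have "\<dots> = fa_mult r (Th (fa_mono v))"
        using fa_eq_sum_left_quotients[OF r_in r0] by (simp add: fa_mult_sum_left[symmetric])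
      finally have "Psi (fa_mult r (fa_mono v)) = (\<Sum>x<k. fa_mult (fa_mono [x]) (Th (fa_mult (left_quotient x r) (fa_mono v))
            - fa_mult (left_quotient x r) (Th (fa_mono v)))) + fa_mult r (Th (fa_mono v))" .
      moreover have "fa_mult r (Th (fa_mono v)) \<in> I" using base in_fa_Th by (intro fa_ideal_mult_right_base)
      moreover have "(\<Sum>x<k. fa_mult (fa_mono [x]) (Th (fa_mult (left_quotient x r) (fa_mono v))
            - fa_mult (left_quotient x r) (Th (fa_mono v)))) \<in> I"
        using part by (intro J_sum I_mult_left) auto
      ultimately show ?thesis using hc Nil J_add by simp
    qed
  qed
qed

end

section \<open>Extending a similarity by one degree\<close>

context fp_algebra_sim
begin

lemma normal_top:
  assumes "v \<in> normal" "wdeg d v = n + t + 1"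
  obtains x w where "v = x # w" "x < k" "w \<in> NW n t"
proof -
  obtain x w where v: "v = x # w" using assms(2) by (cases v) auto
  have x: "x < k" and w: "w \<in> normal" using normal_Cons assms(1) v by blast+
  have "n \<le> wdeg d w" "wdeg d w \<le> n + t" using assms(2) v d_le[OF x] e_pos[OF x] by auto
  thus thesis using that[of x w] v x w by (auto simp: NW_def)
qed

lemma Cons_deg: "w \<in> NW n t \<Longrightarrow> wdeg d (x # w) = n + t + 1 \<longleftrightarrow> wdeg d (x # \<theta> w) = n' + t + 1"
  using deg[of w] by auto

text \<open>Words of equal degree compare by first letter and then by tail; the tails lie in the
  window, where \<theta> preserves the order.\<close>

lemma top_less:
  assumes "w \<in> NW n t" "x < k" "v \<in> NW n t" "y < k"
    "wdeg d (x # w) = n + t + 1" "wdeg d (y # v) = n + t + 1"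
  shows "y # v \<prec> x # w \<longleftrightarrow> y # \<theta> v \<prec> x # \<theta> w"
proof -
  have "wdeg d (y # \<theta> v) = wdeg d (x # \<theta> w)" using assms Cons_deg by metis
  hence "y # \<theta> v \<prec> x # \<theta> w \<longleftrightarrow> y < x \<or> y = x \<and> \<theta> v \<prec> \<theta> w"
    using assms by (intro Cons_less_Cons_iff) auto
  moreover have "y # v \<prec> x # w \<longleftrightarrow> y < x \<or> y = x \<and> v \<prec> w"
    using assms by (intro Cons_less_Cons_iff) auto
  moreover have "v \<prec> w \<longleftrightarrow> \<theta> v \<prec> \<theta> w" if "y = x" using assms that by (intro ord) auto
  ultimately show ?thesis by blast
qed

definition \<theta>_top :: "nat list \<Rightarrow> nat list" where
  "\<theta>_top v = hd v # \<theta> (tl v)"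

lemma Psi_normal:
  assumes "x < k" "w \<in> NW n t"
  shows "Psi (fa_mono (x # w)) = fa_mono (x # \<theta> w)"
  using Psi_Cons[OF assms(1), of "fa_mono w"] by (simp add: Th_normal assms)

text \<open>\<open>Psi\<close> is applied to the relation between \<open>x # w\<close> and its
  normal form. On the normal words of the top degree it only relabels by
  \<open>\<theta>_top\<close>, so the image is a relation of the same shape.\<close>

lemma Psi_nf:
  assumes "w \<in> NW n t" "x < k" "wdeg d (x # w) = n + t + 1"
  defines "g \<equiv> nf (fa_mono (x # w))"
  shows "fa_mono (x # \<theta> w) - (\<Sum>v\<in>fa_supp g. fa_scale (g v) (fa_mono (\<theta>_top v))) \<in> I"
proof -
  have xw: "x # w \<in> lists {..<k}" using assms NW_lists by auto
  hence ins: "in_fa k (fa_mono (x # w) :: 'k fa)" by simp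
  have g: "in_fa k g" "fa_mono (x # w) - g \<in> I" "finite (fa_supp g)"
    unfolding g_def using nf_props[OF ins] by (auto simp: in_fa_def)
  have exp: "g = (\<Sum>v\<in>fa_supp g. fa_scale (g v) (fa_mono v))" using g by (intro fa_expand) auto
  have "homog_of k d (n + t + 1) (fa_mono (x # w) :: 'k fa)" using xw assms by (simp add: words_of_deg_def)
  hence "homog_of k d (n + t + 1) g" "homog_of k d (n + t + 1) (fa_mono (x # w) :: 'k fa)"
    unfolding g_def using nf_homog by blast+
  hence "hcomp d (n + t + 1) (fa_mono (x # w) - g) = fa_mono (x # w) - g"
    by (simp add: hcomp_diff hcomp_homog[of k d "n + t + 1"])
  hence "Psi (fa_mono (x # w) - g) \<in> I" using Psi_hcomp_I[OF g(2)] by simp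
  moreover have "Psi g = (\<Sum>v\<in>fa_supp g. fa_scale (g v) (fa_mono (\<theta>_top v)))"
  proof -
    have v: "v \<in> lists {..<k}" "Psi (fa_mono v) = fa_mono (\<theta>_top v)" if "v \<in> fa_supp g" for v
    proof -
      have "g v \<noteq> 0" using that by (simp add: fa_supp_def)
      note * = nf_mono_supp[OF xw this[unfolded g_def]]
      show "v \<in> lists {..<k}" using * normal_in_lists by blast
      obtain y v' where "v = y # v'" "y < k" "v' \<in> NW n t"
        using normal_top[of v] * assms(3) by metis
      thus "Psi (fa_mono v) = fa_mono (\<theta>_top v)" by (simp add: Psi_normal \<theta>_top_def)
    qed
    have "Psi g = (\<Sum>v\<in>fa_supp g. Psi (fa_scale (g v) (fa_mono v)))"
      by (subst exp, rule Psi_sum) (use v in \<open>auto intro!: in_fa_scale simp del: in_fa_mono simp: in_fa_mono[THEN iffD2]\<close>)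
    also have "\<dots> = (\<Sum>v\<in>fa_supp g. fa_scale (g v) (fa_mono (\<theta>_top v)))"
      by (intro sum.cong refl) (simp add: Psi_scale[OF in_fa_mono[THEN iffD2, OF v(1)]] v(2))
    finally show ?thesis .
  qed
  ultimately show ?thesis using Psi_diff[OF ins g(1)] assms by (simp add: Psi_normal)
qed

text \<open>A reduction of \<open>x # w\<close> is carried by \<open>Psi_nf\<close> to a relation
  with leading word \<open>x # \<theta> w\<close>, because \<open>\<theta>_top\<close> keeps the
  other words below it.\<close>

lemma not_normal_top:
  assumes w: "w \<in> NW n t" and x: "x < k" and N: "wdeg d (x # w) = n + t + 1" and "x # w \<notin> normal"
  shows "x # \<theta> w \<notin> normal"
proof -
  define g where "g = nf (fa_mono (x # w) :: 'k fa)"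
  define f where "f = fa_mono (x # \<theta> w) - (\<Sum>v\<in>fa_supp g. fa_scale (g v) (fa_mono (\<theta>_top v)))"
  have xw: "x # w \<in> lists {..<k}" "x # \<theta> w \<in> lists {..<k}"
    using x NW_lists[OF w] NW_lists[OF \<theta>_NW[OF w]] by auto
  have "f \<in> I" unfolding f_def g_def by (rule Psi_nf[OF w x N])
  have small: "\<theta>_top v \<prec> x # \<theta> w" if "v \<in> fa_supp g" for v
  proof -
    have "g v \<noteq> 0" using that by (simp add: fa_supp_def)
    note * = nf_mono_supp[OF xw(1) this[unfolded g_def]]
    obtain y v' where v: "v = y # v'" "y < k" "v' \<in> NW n t"
      using normal_top[of v] * N by metis
    have "v \<prec> x # w" using * assms(4) by metis
    thus ?thesis using top_less[OF w x v(3,2) N] v * N by (simp add: \<theta>_top_def)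
  qed
  have val: "f y = (if y = x # \<theta> w then 1 else 0) - (\<Sum>v\<in>fa_supp g. if y = \<theta>_top v then g v else 0)" for y
    by (auto simp: f_def fa_apply fa_mono_apply sum_fun_apply intro!: sum.cong)
  have "f (x # \<theta> w) = 1"
  proof -
    have "x # \<theta> w \<noteq> \<theta>_top v" if "v \<in> fa_supp g" for v
      using small[OF that] less_irrefl by metis
    hence "(\<Sum>v\<in>fa_supp g. if x # \<theta> w = \<theta>_top v then g v else 0) = 0"
      by (intro sum.neutral) auto
    thus ?thesis by (simp add: val)
  qed
  moreover have "y \<prec> x # \<theta> w" if "f y \<noteq> 0" "y \<noteq> x # \<theta> w" for y
  proof -
    have "(\<Sum>v\<in>fa_supp g. if y = \<theta>_top v then g v else 0) \<noteq> 0" using that val by simp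
    then obtain v where v: "v \<in> fa_supp g" "(if y = \<theta>_top v then g v else 0) \<noteq> 0"
      by (rule sum.not_neutral_contains_not_neutral)
    hence "y = \<theta>_top v" by (auto split: if_splits)
    thus ?thesis using small v by simp
  qed
  ultimately have "is_leading d (\<lambda>i. i) f (x # \<theta> w)" by (auto simp: is_leading_def)
  thus ?thesis using \<open>f \<in> I\<close> not_normal_iff[OF xw(2)] by blast
qed

lemma normal_top_iff:
  assumes w: "w \<in> NW n t" and x: "x < k" and N: "wdeg d (x # w) = n + t + 1"
  shows "x # w \<in> normal \<longleftrightarrow> x # \<theta> w \<in> normal"
proof -
  \<comment> \<open>The converse implication is \<open>not_normal_top\<close> for the inverse
    similarity.\<close>
  interpret inv: fp_algebra_sim k d R n' n t "inv_into (NW n t) \<theta>"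
    by unfold_locales (use sim_sym[OF sim] d_le R_le in auto)
  have "inv_into (NW n t) \<theta> (\<theta> w) = w" using bij w by (simp add: bij_betw_def)
  thus ?thesis
    using not_normal_top[OF assms] inv.not_normal_top[OF \<theta>_NW[OF w] x] Cons_deg[OF w] N by auto
qed

definition \<theta>_ext :: "nat list \<Rightarrow> nat list" where
  "\<theta>_ext v = (if wdeg d v = n + t + 1 then \<theta>_top v else \<theta> v)"

lemma \<theta>_ext_NW: "w \<in> NW n t \<Longrightarrow> \<theta>_ext w = \<theta> w"
  by (auto simp: \<theta>_ext_def NW_def)

text \<open>Iterated, this says that a window determines all higher degrees. Only products that land
  in degree n + t + 1 are new; the rest is inherited from \<theta>.\<close>

lemma sim_ext: "sim n n' (t + 1) \<theta>_ext"
proof -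
  define T where "T = {v \<in> normal. wdeg d v = n + t + 1}"
  define T' where "T' = {v \<in> normal. wdeg d v = n' + t + 1}"
  have NW1: "NW n (t + 1) = NW n t \<union> T" by (auto simp: NW_def T_def)
  have NW1': "NW n' (t + 1) = NW n' t \<union> T'" by (auto simp: NW_def T'_def)
  have T_cases: "\<exists>x w. v = x # w \<and> x < k \<and> w \<in> NW n t \<and> \<theta>_top v = x # \<theta> w \<and> x # \<theta> w \<in> T'" if "v \<in> T" for v
  proof -
    have v: "v \<in> normal" "wdeg d v = n + t + 1" using that by (auto simp: T_def)
    obtain x w where xw: "v = x # w" "x < k" "w \<in> NW n t" using normal_top[OF v] by metis
    moreover have "x # \<theta> w \<in> normal" using normal_top_iff[OF xw(3,2)] v xw by simp
    moreover have "wdeg d (x # \<theta> w) = n' + t + 1" using Cons_deg[OF xw(3)] v xw by simp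
    ultimately show ?thesis by (auto simp: \<theta>_top_def T'_def)
  qed
  have \<theta>_inj: "v = w" if "v \<in> NW n t" "w \<in> NW n t" "\<theta> v = \<theta> w" for v w
    using that bij by (auto simp: bij_betw_def dest: inj_onD)
  interpret inv: fp_algebra_sim k d R n' n t "inv_into (NW n t) \<theta>"
    by unfold_locales (use sim_sym[OF sim] d_le R_le in auto)
  have bijT: "bij_betw \<theta>_top T T'"
    unfolding bij_betw_def
  proof
    show "inj_on \<theta>_top T"
    proof (rule inj_onI)
      fix u v assume "u \<in> T" "v \<in> T" "\<theta>_top u = \<theta>_top v"
      thus "u = v" using T_cases[of u] T_cases[of v] \<theta>_inj by (metis list.inject)
    qed
    show "\<theta>_top ` T = T'"
    proof
      show "\<theta>_top ` T \<subseteq> T'" using T_cases by fastforce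
      show "T' \<subseteq> \<theta>_top ` T"
      proof
        fix v assume "v \<in> T'"
        hence v: "v \<in> normal" "wdeg d v = n' + t + 1" by (auto simp: T'_def)
        then obtain x w where xw: "v = x # w" "x < k" "w \<in> NW n' t" using inv.normal_top by metis
        obtain w' where w': "w' \<in> NW n t" "w = \<theta> w'" using xw(3) bij by (auto simp: bij_betw_def)
        have N: "wdeg d (x # w') = n + t + 1" using Cons_deg[OF w'(1)] v xw w' by simp
        hence "x # w' \<in> T" using normal_top_iff[OF w'(1) xw(2) N] v xw w' by (simp add: T_def)
        moreover have "v = \<theta>_top (x # w')" using xw w' by (simp add: \<theta>_top_def)
        ultimately show "v \<in> \<theta>_top ` T" by blast
      qed
    qed
  qed
  have ext_T: "\<theta>_ext v = \<theta>_top v" if "v \<in> T" for v using that by (simp add: \<theta>_ext_def T_def)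
  have deg_ext: "wdeg d (\<theta>_ext w) + n = wdeg d w + n'" if w: "w \<in> NW n (t + 1)" for w
  proof (cases "w \<in> T")
    case True
    then show ?thesis using T_cases[OF True] ext_T[OF True] by (auto simp: T_def T'_def)
  next
    case False
    then show ?thesis using w deg \<theta>_ext_NW NW1 by auto
  qed
  show ?thesis
    unfolding sim_def
  proof (intro conjI ballI allI impI)
    have "bij_betw \<theta>_ext (NW n t) (NW n' t)"
      using bij by (rule bij_betw_cong[THEN iffD1, rotated]) (simp add: \<theta>_ext_NW)
    moreover have "bij_betw \<theta>_ext T T'"
      using bijT by (rule bij_betw_cong[THEN iffD1, rotated]) (simp add: ext_T)
    moreover have "NW n' t \<inter> T' = {}" by (auto simp: NW_def T'_def)
    ultimately show "bij_betw \<theta>_ext (NW n (t + 1)) (NW n' (t + 1))"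
      unfolding NW1 NW1' by (rule bij_betw_combine)
  next
    fix w assume "w \<in> NW n (t + 1)"
    thus "wdeg d (\<theta>_ext w) + n = wdeg d w + n'" by (rule deg_ext)
  next
    fix v w assume vw: "v \<in> NW n (t + 1)" "w \<in> NW n (t + 1)" "wdeg d v = wdeg d w"
    show "v \<prec> w \<longleftrightarrow> \<theta>_ext v \<prec> \<theta>_ext w"
    proof (cases "v \<in> T")
      case True
      hence T: "v \<in> T" "w \<in> T" using vw by (auto simp: NW1 T_def NW_def)
      from T_cases[OF T(1)] obtain y v' where v': "v = y # v'" "y < k" "v' \<in> NW n t" "\<theta>_top v = y # \<theta> v'" by blast
      from T_cases[OF T(2)] obtain x w' where w': "w = x # w'" "x < k" "w' \<in> NW n t" "\<theta>_top w = x # \<theta> w'" by blast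
      show ?thesis using top_less[OF w'(3,2) v'(3,2)] T v' w' by (simp add: ext_T T_def)
    next
      case False
      hence "v \<in> NW n t" "w \<in> NW n t" using vw by (auto simp: NW1 T_def NW_def)
      thus ?thesis using ord vw by (simp add: \<theta>_ext_NW)
    qed
  next
    fix w x assume w1: "w \<in> NW n (t + 1)" and x: "x < k" and le: "wdeg d (x # w) \<le> n + (t + 1)"
    have w: "w \<in> NW n t" using w1 le e_pos[OF x] by (auto simp: NW_def)
    have ew: "\<theta>_ext w = \<theta> w" by (rule \<theta>_ext_NW[OF w])
    have iff: "x # w \<in> normal \<longleftrightarrow> x # \<theta> w \<in> normal"
    proof (cases "wdeg d (x # w) = n + t + 1")
      case True
      then show ?thesis by (rule normal_top_iff[OF w x])
    next
      case False
      then show ?thesis using le by (intro mul_normal[OF w x]) simp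
    qed
    thus "x # w \<in> normal \<longleftrightarrow> x # \<theta>_ext w \<in> normal" by (simp add: ew)
    show "\<theta>_ext (x # w) = x # \<theta>_ext w" if "x # w \<in> normal"
    proof (cases "wdeg d (x # w) = n + t + 1")
      case True
      then show ?thesis by (simp add: \<theta>_ext_def[of "x # w"] \<theta>_top_def ew)
    next
      case False
      then show ?thesis using mul_\<theta>[OF w x _ that] le by (simp add: \<theta>_ext_def[of "x # w"] ew)
    qed
    fix v assume v1: "v \<in> NW n (t + 1)" and vdeg: "wdeg d v = wdeg d (x # w)"
    show "nf (fa_mono (x # w)) v = nf (fa_mono (x # \<theta>_ext w)) (\<theta>_ext v)"
    proof (cases "wdeg d (x # w) = n + t + 1")
      case False
      hence "v \<in> NW n t" using v1 vdeg le by (auto simp: NW_def)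
      thus ?thesis using mul_nf[OF w x _ _ vdeg] le False by (simp add: ew \<theta>_ext_NW)
    next
      case True
      define g where "g = nf (fa_mono (x # w) :: 'k fa)"
      have xw: "x # w \<in> lists {..<k}" "x # \<theta> w \<in> lists {..<k}"
        using x NW_lists[OF w] NW_lists[OF \<theta>_NW[OF w]] by auto
      have supp: "fa_supp g \<subseteq> T"
      proof
        fix u assume "u \<in> fa_supp g"
        hence "g u \<noteq> 0" by (simp add: fa_supp_def)
        from nf_mono_supp[OF xw(1) this[unfolded g_def]] show "u \<in> T" using True by (simp add: T_def)
      qed
      let ?g' = "\<Sum>v\<in>fa_supp g. fa_scale (g v) (fa_mono (\<theta>_top v))"
      have gin: "finite (fa_supp g)" using nf_props(1)[of "fa_mono (x # w)"] xw by (auto simp: g_def in_fa_def)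
      \<comment> \<open>The transported reduction is supported on normal words, hence it is the
        normal form of \<open>x # \<theta> w\<close>. This gives equality of the structure constants
        in the new degree.\<close>
      have "?g' \<in> fa.span (fa_mono ` normal)"
      proof (intro fa.span_sum fa.span_scale fa.span_base imageI)
        fix u assume "u \<in> fa_supp g"
        hence "\<theta>_top u \<in> T'" using supp T_cases by fastforce
        thus "\<theta>_top u \<in> normal" by (simp add: T'_def)
      qed
      hence "fa_supp ?g' \<subseteq> normal" by (simp add: fa_span_mono_iff)
      hence nf': "nf (fa_mono (x # \<theta> w)) = ?g'"
        using Psi_nf[OF w x True] xw(2) by (intro nf_eqI) (auto simp: g_def)
      have vT: "v \<in> T" using v1 vdeg True by (auto simp: NW1 NW_def T_def)
      have "?g' (\<theta>_top v) = (\<Sum>u\<in>fa_supp g. if u = v then g u else 0)"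
        unfolding sum_fun_apply fa_apply
      proof (intro sum.cong refl)
        fix u assume "u \<in> fa_supp g"
        hence "u \<in> T" using supp by blast
        hence "\<theta>_top v = \<theta>_top u \<longleftrightarrow> u = v" using vT bijT by (auto simp: bij_betw_def dest: inj_onD)
        thus "g u * fa_mono (\<theta>_top u) (\<theta>_top v) = (if u = v then g u else 0)" by (simp add: fa_mono_apply)
      qed
      also have "\<dots> = g v" using gin by (auto simp: fa_supp_def)
      finally show ?thesis by (simp add: nf' g_def[symmetric] ew ext_T[OF vT])
    qed
  qed
qed

end

section \<open>Finitely many types of windows\<close>

lemma finite_image_factor:
  assumes "finite (key ` A)" "\<And>x y. x \<in> A \<Longrightarrow> y \<in> A \<Longrightarrow> key x = key y \<Longrightarrow> f x = f y"
  shows "finite (f ` A)"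
proof (rule finite_subset)
  show "f ` A \<subseteq> (\<lambda>c. f (SOME x. x \<in> A \<and> key x = c)) ` key ` A"
  proof
    fix y assume "y \<in> f ` A"
    then obtain x where x: "x \<in> A" "y = f x" by blast
    have "(SOME x'. x' \<in> A \<and> key x' = key x) \<in> A \<and> key (SOME x'. x' \<in> A \<and> key x' = key x) = key x"
      by (rule someI[of _ x]) (use x in simp)
    hence "y = f (SOME x'. x' \<in> A \<and> key x' = key x)" using x assms(2) by metis
    thus "y \<in> (\<lambda>c. f (SOME x. x \<in> A \<and> key x = c)) ` key ` A" using x by blast
  qed
qed (use assms in simp)

text \<open>Provides the ranks by which basis words of different degrees are matched; compatibility
  with the order becomes comparison of indices.\<close>

lemma finite_order_enumeration:
  assumes "finite A" and tot: "\<And>x y. x \<in> A \<Longrightarrow> y \<in> A \<Longrightarrow> x \<noteq> y \<Longrightarrow> R x y \<or> R y x"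
    and tr: "\<And>x y z. R x y \<Longrightarrow> R y z \<Longrightarrow> R x z"
  shows "\<exists>\<omega>. bij_betw \<omega> {..<card A} A \<and> (\<forall>i j. i < j \<and> j < card A \<longrightarrow> R (\<omega> i) (\<omega> j))"
  using assms(1) tot
proof (induction "card A" arbitrary: A)
  case 0
  then show ?case by (simp add: bij_betw_def)
next
  case (Suc n)
  have ne: "A \<noteq> {}" using Suc.hyps(2) by auto
  have "\<exists>z\<in>A. \<forall>x\<in>A. x \<noteq> z \<longrightarrow> R x z"
    using finite_max_wrt[OF Suc.prems(1) ne] Suc.prems(2) tr by metis
  then obtain z where z: "z \<in> A" "\<forall>x\<in>A. x \<noteq> z \<longrightarrow> R x z" by blast
  have card: "card (A - {z}) = n" using Suc.hyps(2) z Suc.prems(1) by simp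
  obtain \<omega> where \<omega>: "bij_betw \<omega> {..<n} (A - {z})" "\<forall>i j. i < j \<and> j < n \<longrightarrow> R (\<omega> i) (\<omega> j)"
    using Suc.hyps(1)[of "A - {z}"] card Suc.prems by auto
  let ?\<omega> = "\<omega>(n := z)"
  have "bij_betw ?\<omega> {..<n} (A - {z})"
    using \<omega>(1) by (rule bij_betw_cong[THEN iffD1, rotated]) simp
  moreover have "bij_betw ?\<omega> {n} {z}" by (simp add: bij_betw_def)
  ultimately have "bij_betw ?\<omega> ({..<n} \<union> {n}) ((A - {z}) \<union> {z})" by (rule bij_betw_combine) simp
  moreover have "{..<n} \<union> {n} = {..<card A}" "(A - {z}) \<union> {z} = A" using Suc.hyps(2) z by auto
  ultimately have "bij_betw ?\<omega> {..<card A} A" by simp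
  moreover have "R (?\<omega> i) (?\<omega> j)" if ij: "i < j" "j < card A" for i j
  proof (cases "j = n")
    case True
    have "\<omega> i \<in> A - {z}" using \<omega>(1) ij True by (auto simp: bij_betw_def)
    then show ?thesis using z ij True by auto
  next
    case False
    then show ?thesis using \<omega>(2) ij Suc.hyps(2) by auto
  qed
  ultimately show ?case by blast
qed

context fp_algebra
begin

lemma sim_extends:
  assumes "sim n n' t \<theta>" "\<And>x. x < k \<Longrightarrow> d x \<le> t" "\<And>r. r \<in> R \<Longrightarrow> \<exists>l>0. l \<le> t \<and> homog_of k d l r"
  shows "\<exists>\<theta>'. sim n n' (t + s) \<theta>' \<and> (\<forall>w\<in>NW n t. \<theta>' w = \<theta> w)"
proof (induction s)
  case 0
  then show ?case using assms by auto
next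
  case (Suc s)
  then obtain \<theta>' where \<theta>': "sim n n' (t + s) \<theta>'" "\<forall>w\<in>NW n t. \<theta>' w = \<theta> w" by blast
  interpret fp_algebra_sim k d R n n' "t + s" \<theta>'
    by unfold_locales (use \<theta>' assms trans_le_add1 in blast)+
  have "\<forall>w\<in>NW n t. \<theta>_ext w = \<theta> w"
  proof
    fix w assume w: "w \<in> NW n t"
    hence "w \<in> NW n (t + s)" by (auto simp: NW_def)
    thus "\<theta>_ext w = \<theta> w" using \<theta>_ext_NW \<theta>'(2) w by auto
  qed
  then show ?case using sim_ext by (intro exI[of _ \<theta>_ext]) simp
qed

text \<open>Equal windows have equal futures. The window is first lengthened by the degree of u, so
  that every product of a suffix of u with w stays in it; then the letters are prefixed one by
  one.\<close>

lemma sim_append: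
  assumes sim: "sim n n' t \<theta>" and b: "\<And>x. x < k \<Longrightarrow> d x \<le> t" "\<And>r. r \<in> R \<Longrightarrow> \<exists>l>0. l \<le> t \<and> homog_of k d l r"
    and w: "w \<in> normal" "wdeg d w = n" and u: "u \<in> lists {..<k}"
  shows "u @ w \<in> normal \<longleftrightarrow> u @ \<theta> w \<in> normal"
proof -
  obtain \<theta>' where \<theta>': "sim n n' (t + wdeg d u) \<theta>'" "\<forall>w\<in>NW n t. \<theta>' w = \<theta> w"
    using sim_extends[OF sim b] by blast
  interpret fp_algebra_sim k d R n n' "t + wdeg d u" \<theta>'
    by unfold_locales (use \<theta>' b trans_le_add1 in blast)+
  have w0: "w \<in> NW n t" using w by (simp add: NW_def)
  have wN: "w \<in> NW n (t + wdeg d u)" using w by (simp add: NW_def)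
  have "(v @ w \<in> normal \<longleftrightarrow> v @ \<theta>' w \<in> normal) \<and> (v @ w \<in> normal \<longrightarrow> \<theta>' (v @ w) = v @ \<theta>' w)"
    if "v \<in> lists {..<k}" "wdeg d v \<le> wdeg d u" for v
    using that
  proof (induction v)
    case Nil
    have "\<theta>' w \<in> normal" using \<theta>_NW[OF wN] by (simp add: NW_def)
    then show ?case using w by simp
  next
    case (Cons x v)
    have x: "x < k" using Cons by auto
    have IH: "v @ w \<in> normal \<longleftrightarrow> v @ \<theta>' w \<in> normal" "v @ w \<in> normal \<longrightarrow> \<theta>' (v @ w) = v @ \<theta>' w"
      using Cons by auto
    show ?case
    proof (cases "v @ w \<in> normal")
      case False
      then show ?thesis using IH normal_Cons by (metis append_Cons)
    next
      case True
      hence "v @ w \<in> NW n (t + wdeg d u)" using w Cons.prems by (simp add: NW_def)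
      moreover have "wdeg d (x # v @ w) \<le> n + (t + wdeg d u)" using w Cons.prems by simp
      ultimately show ?thesis using mul_normal[of "v @ w" x] mul_\<theta>[of "v @ w" x] x IH True by simp
    qed
  qed
  from this[OF u] show ?thesis using \<theta>'(2) w0 by simp
qed

lemma append_normal: "u @ w \<in> normal \<Longrightarrow> w \<in> normal"
  by (induction u) (use normal_Cons in auto)

lemma degree_bound:
  obtains D where "\<And>x. x < k \<Longrightarrow> d x \<le> D" "\<And>r. r \<in> R \<Longrightarrow> \<exists>l>0. l \<le> D \<and> homog_of k d l r"
proof -
  have "\<forall>r\<in>R. \<exists>l>0. homog_of k d l r" using fp by (auto simp: finite_presentation_def)
  then obtain l where l: "\<forall>r\<in>R. l r > 0 \<and> homog_of k d (l r) r" by metis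
  have fin: "finite (d ` {..<k} \<union> l ` R)" using finite_presentationD(2)[OF fp] by simp
  show thesis
  proof (rule that[of "Max (d ` {..<k} \<union> l ` R)"])
    show "d x \<le> Max (d ` {..<k} \<union> l ` R)" if "x < k" for x
      using that fin by (intro Max_ge) auto
    show "\<exists>l'>0. l' \<le> Max (d ` {..<k} \<union> l ` R) \<and> homog_of k d l' r" if "r \<in> R" for r
      using that fin l by (intro exI[of _ "l r"] conjI Max_ge) auto
  qed
qed

text \<open>The left quotient of a normal word depends only on its \<open>key\<close>: the sizes of
  the D + 1 components starting at its degree, their left multiplications written in ranks, and the
  rank of the word. The bound C limits sizes and ranks, and \<open>K0\<close> limits the
  coefficients.\<close>

theorem finite_left_quotients:
  assumes C: "\<And>n. card {w \<in> normal. wdeg d w = n} \<le> C"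
    and K0: "finite K0" "\<And>w v. w \<in> lists {..<k} \<Longrightarrow> nf (fa_mono w) v \<in> K0"
  shows "finite ((\<lambda>w. {u \<in> lists {..<k}. u @ w \<in> normal}) ` lists {..<k})"
proof -
  obtain D where D: "\<And>x. x < k \<Longrightarrow> d x \<le> D" "\<And>r. r \<in> R \<Longrightarrow> \<exists>l>0. l \<le> D \<and> homog_of k d l r"
    using degree_bound by blast
  define A where "A n = {w \<in> normal. wdeg d w = n}" for n
  define h where "h n = card (A n)" for n
  have finA: "finite (A n)" for n
    using finite_words_of_deg[of k d n] e_pos normal_in_lists
    by (rule_tac finite_subset[of _ "words_of_deg k d n"]) (auto simp: A_def words_of_deg_def)
  have h_le: "h n \<le> C" for n using C by (simp add: h_def A_def)
  have "\<exists>\<omega>. bij_betw \<omega> {..<h n} (A n) \<and> (\<forall>i j. i < j \<and> j < h n \<longrightarrow> \<omega> i \<prec> \<omega> j)" for n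
    unfolding h_def
  proof (rule finite_order_enumeration[OF finA])
    fix v w assume "v \<in> A n" "w \<in> A n" "v \<noteq> w"
    thus "v \<prec> w \<or> w \<prec> v" using normal_in_lists by (intro less_total) (auto simp: A_def)
  qed (rule less_trans)
  then obtain \<omega> where \<omega>: "\<And>n. bij_betw (\<omega> n) {..<h n} (A n)"
      "\<And>n i j. i < j \<Longrightarrow> j < h n \<Longrightarrow> \<omega> n i \<prec> \<omega> n j" by metis
  have \<omega>_in: "\<omega> n i \<in> normal" "wdeg d (\<omega> n i) = n" if "i < h n" for n i
    using \<omega>(1)[of n] that by (auto simp: bij_betw_def A_def)
  have \<omega>_inj: "i = j" if "\<omega> n i = \<omega> n j" "i < h n" "j < h n" for n i j
    using \<omega>(1)[of n] that by (auto simp: bij_betw_def dest: inj_onD)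
  have \<omega>_less: "\<omega> n i \<prec> \<omega> n j \<longleftrightarrow> i < j" if "i < h n" "j < h n" for n i j
    using \<omega>(2) that less_irrefl less_trans by (metis linorder_neqE_nat)
  define rk where "rk v = inv_into {..<h (wdeg d v)} (\<omega> (wdeg d v)) v" for v
  have rk: "rk v < h (wdeg d v)" "\<omega> (wdeg d v) (rk v) = v" if "v \<in> normal" for v
  proof -
    have "v \<in> \<omega> (wdeg d v) ` {..<h (wdeg d v)}" using \<omega>(1)[of "wdeg d v"] that by (auto simp: bij_betw_def A_def)
    from inv_into_into[OF this] f_inv_into_f[OF this] show "rk v < h (wdeg d v)" "\<omega> (wdeg d v) (rk v) = v"
      by (auto simp: rk_def)
  qed
  have rk_\<omega>: "rk (\<omega> n i) = i" if "i < h n" for n i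
    using \<omega>_inj rk[of "\<omega> n i"] \<omega>_in[OF that] that by metis
  define hs where "hs n = map (\<lambda>j. h (n + j)) [0..<Suc D]" for n
  \<comment> \<open>Indexed by ranks, an entry holds the coefficient of the i'-th basis word in x
    times the i-th, and whether the two words are equal. Equality is recorded to recover normality
    of \<open>x # w\<close> and the value of \<theta> there. The default outside the range keeps
    these functions in a finite set.\<close>
  define data where "data n = (\<lambda>(j, x, i, i'). 
     if j \<le> D \<and> x < k \<and> j + d x \<le> D \<and> i < h (n + j) \<and> i' < h (n + j + d x)
     then (nf (fa_mono (x # \<omega> (n + j) i)) (\<omega> (n + j + d x) i'), x # \<omega> (n + j) i = \<omega> (n + j + d x) i')
     else (0, False))" for n
  define key where "key w = (hs (wdeg d w), data (wdeg d w), rk w)" for w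
  have "finite (key ` normal)"
  proof -
    let ?Box = "{..D} \<times> {..<k} \<times> {..<C} \<times> {..<C}"
    let ?F = "{f. \<forall>p. (p \<in> ?Box \<longrightarrow> f p \<in> insert 0 K0 \<times> UNIV) \<and> (p \<notin> ?Box \<longrightarrow> f p = (0, False))}"
    have "finite ?F"
      using K0(1) by (intro finite_set_of_finite_funs finite_cartesian_product) auto
    moreover have "data n \<in> ?F" for n
    proof -
      have "data n (j, x, i, i') \<in> insert 0 K0 \<times> UNIV" for j x i i'
        using K0(2)[of "x # \<omega> (n + j) i"] normal_in_lists[OF \<omega>_in(1)[of i "n + j"]]
        by (auto simp: data_def simp del: in_lists_conv_set)
      moreover have "data n (j, x, i, i') = (0, False)" if "(j, x, i, i') \<notin> ?Box" for j x i i'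
        using that h_le[of "n + j"] h_le[of "n + j + d x"] by (auto simp: data_def)
      ultimately show ?thesis by auto
    qed
    moreover have "hs n \<in> {xs. set xs \<subseteq> {..C} \<and> length xs = Suc D}" for n
      using h_le by (auto simp: hs_def)
    moreover have "rk w \<in> {..<C}" if "w \<in> normal" for w
      using rk(1)[OF that] h_le[of "wdeg d w"] by simp
    ultimately have "key ` normal \<subseteq> {xs. set xs \<subseteq> {..C} \<and> length xs = Suc D} \<times> ?F \<times> {..<C}"
      unfolding key_def by blast
    moreover have "finite ({xs. set xs \<subseteq> {..C} \<and> length xs = Suc D} \<times> ?F \<times> {..<C})"
      using \<open>finite ?F\<close> finite_lists_length_eq[of "{..C}" "Suc D"] by (intro finite_cartesian_product) auto
    ultimately show ?thesis by (rule finite_subset)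
  qed
  moreover have "{u \<in> lists {..<k}. u @ w \<in> normal} = {u \<in> lists {..<k}. u @ w' \<in> normal}"
    if w: "w \<in> normal" and w': "w' \<in> normal" and key: "key w = key w'" for w w'
  proof -
    define n where "n = wdeg d w"
    define n' where "n' = wdeg d w'"
    \<comment> \<open>Words of equal rank in corresponding degrees are matched.\<close>
    define \<theta> where "\<theta> v = \<omega> (n' + (wdeg d v - n)) (rk v)" for v
    have hs: "h (n + j) = h (n' + j)" if "j \<le> D" for j
    proof -
      have "hs n ! j = hs n' ! j" using key by (simp add: key_def n_def n'_def)
      thus ?thesis using that unfolding hs_def by (simp del: upt_Suc)
    qed
    have dat: "nf (fa_mono (x # \<omega> (n + j) i)) (\<omega> (n + j + d x) i') = nf (fa_mono (x # \<omega> (n' + j) i)) (\<omega> (n' + j + d x) i')"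
       "x # \<omega> (n + j) i = \<omega> (n + j + d x) i' \<longleftrightarrow> x # \<omega> (n' + j) i = \<omega> (n' + j + d x) i'"
      if "x < k" "j + d x \<le> D" "i < h (n + j)" "i' < h (n + j + d x)" for x j i i'
    proof -
      have "data n (j, x, i, i') = data n' (j, x, i, i')" using key by (simp add: key_def n_def n'_def)
      moreover have "i < h (n' + j)" "i' < h (n' + j + d x)"
        using that hs[of j] hs[of "j + d x"] by (auto simp: ac_simps)
      ultimately show "nf (fa_mono (x # \<omega> (n + j) i)) (\<omega> (n + j + d x) i') = nf (fa_mono (x # \<omega> (n' + j) i)) (\<omega> (n' + j + d x) i')"
       "x # \<omega> (n + j) i = \<omega> (n + j + d x) i' \<longleftrightarrow> x # \<omega> (n' + j) i = \<omega> (n' + j + d x) i'"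
        using that by (auto simp: data_def)
    qed
    have cases: "\<exists>j i. j \<le> D \<and> i < h (n + j) \<and> v = \<omega> (n + j) i \<and> wdeg d v = n + j" if "v \<in> NW n D" for v
    proof -
      have v: "v \<in> normal" "n \<le> wdeg d v" "wdeg d v \<le> n + D" using that by (auto simp: NW_def)
      thus ?thesis using rk[OF v(1)] by (intro exI[of _ "wdeg d v - n"] exI[of _ "rk v"]) auto
    qed
    have \<theta>_\<omega>: "\<theta> (\<omega> (n + j) i) = \<omega> (n' + j) i" if "i < h (n + j)" for j i
      using rk_\<omega>[OF that] \<omega>_in[OF that] by (simp add: \<theta>_def)
    have in_NW: "\<omega> (n + j) i \<in> NW n D" if "j \<le> D" "i < h (n + j)" for j i
      using \<omega>_in[OF that(2)] that by (simp add: NW_def)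
    have in_NW': "\<omega> (n' + j) i \<in> NW n' D" if "j \<le> D" "i < h (n' + j)" for j i
      using \<omega>_in[OF that(2)] that by (simp add: NW_def)
    have "sim n n' D \<theta>"
      unfolding sim_def
    proof (intro conjI ballI allI impI)
      show "bij_betw \<theta> (NW n D) (NW n' D)"
        unfolding bij_betw_def
      proof
        show "inj_on \<theta> (NW n D)"
        proof (rule inj_onI)
          fix u v assume uv: "u \<in> NW n D" "v \<in> NW n D" "\<theta> u = \<theta> v"
          obtain j i where u: "j \<le> D" "i < h (n + j)" "u = \<omega> (n + j) i" using cases[OF uv(1)] by blast
          obtain l m where v: "l \<le> D" "m < h (n + l)" "v = \<omega> (n + l) m" using cases[OF uv(2)] by blast
          have eq: "\<omega> (n' + j) i = \<omega> (n' + l) m" using uv(3) u v \<theta>_\<omega> by simp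
          moreover have im: "i < h (n' + j)" "m < h (n' + l)" using u v hs by auto
          ultimately have "n' + j = n' + l" using \<omega>_in(2) by metis
          hence "j = l" by simp
          moreover have "i = m" using eq im \<open>j = l\<close> \<omega>_inj by metis
          ultimately show "u = v" using u v by simp
        qed
        show "\<theta> ` NW n D = NW n' D"
        proof
          show "\<theta> ` NW n D \<subseteq> NW n' D"
          proof
            fix y assume "y \<in> \<theta> ` NW n D"
            then obtain v where "v \<in> NW n D" "y = \<theta> v" by blast
            thus "y \<in> NW n' D" using cases[of v] \<theta>_\<omega> in_NW' hs by force
          qed
          show "NW n' D \<subseteq> \<theta> ` NW n D"
          proof
            fix v assume "v \<in> NW n' D"
            hence v: "v \<in> normal" "n' \<le> wdeg d v" "wdeg d v \<le> n' + D" by (auto simp: NW_def)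
            define j where "j = wdeg d v - n'"
            have j: "j \<le> D" "wdeg d v = n' + j" using v by (auto simp: j_def)
            hence i: "rk v < h (n + j)" using rk(1)[OF v(1)] hs[of j] by simp
            have "\<theta> (\<omega> (n + j) (rk v)) = v" using \<theta>_\<omega>[OF i] rk(2)[OF v(1)] j by simp
            thus "v \<in> \<theta> ` NW n D" using in_NW[OF j(1) i] by force
          qed
        qed
      qed
    next
      fix v assume "v \<in> NW n D"
      then obtain j i where v: "j \<le> D" "i < h (n + j)" "v = \<omega> (n + j) i" using cases by blast
      thus "wdeg d (\<theta> v) + n = wdeg d v + n'"
        using \<theta>_\<omega>[OF v(2)] \<omega>_in(2)[OF v(2)] \<omega>_in(2)[of i "n' + j"] hs by simp
    next
      fix u v assume uv: "u \<in> NW n D" "v \<in> NW n D" "wdeg d u = wdeg d v"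
      obtain j i where u: "j \<le> D" "i < h (n + j)" "u = \<omega> (n + j) i" "wdeg d u = n + j" using cases[OF uv(1)] by blast
      obtain l m where v: "l \<le> D" "m < h (n + l)" "v = \<omega> (n + l) m" "wdeg d v = n + l" using cases[OF uv(2)] by blast
      have "j = l" using u v uv by simp
      thus "u \<prec> v \<longleftrightarrow> \<theta> u \<prec> \<theta> v" using u v \<theta>_\<omega> hs[of j] by (simp add: \<omega>_less)
    next
      fix v x assume v0: "v \<in> NW n D" and x: "x < k" and le: "wdeg d (x # v) \<le> n + D"
      obtain j i where v: "j \<le> D" "i < h (n + j)" "v = \<omega> (n + j) i" "wdeg d v = n + j" using cases[OF v0] by blast
      have jx: "j + d x \<le> D" using le v by simp
      have \<theta>v: "\<theta> v = \<omega> (n' + j) i" using v \<theta>_\<omega> by simp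
      have hjx: "h (n + j + d x) = h (n' + j + d x)" using hs[OF jx] by (simp add: ac_simps)
      have i': "i < h (n' + j)" using v hs by simp
      have norm: "x # v \<in> normal \<longleftrightarrow> (\<exists>i'<h (n + j + d x). x # \<omega> (n + j) i = \<omega> (n + j + d x) i')"
        using rk[of "x # v"] \<omega>_in(1) v by (auto simp: ac_simps)
      have norm': "x # \<theta> v \<in> normal \<longleftrightarrow> (\<exists>i'<h (n + j + d x). x # \<omega> (n' + j) i = \<omega> (n' + j + d x) i')"
        using rk[of "x # \<theta> v"] \<omega>_in(1)[of _ "n' + j + d x"] \<omega>_in(2)[OF i'] hjx unfolding \<theta>v by (auto simp: ac_simps)
      show "x # v \<in> normal \<longleftrightarrow> x # \<theta> v \<in> normal"
        unfolding norm norm' using dat(2)[OF x jx v(2)] by blast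
      show "\<theta> (x # v) = x # \<theta> v" if nrm: "x # v \<in> normal"
      proof -
        obtain i' where i': "i' < h (n + j + d x)" "x # \<omega> (n + j) i = \<omega> (n + j + d x) i'" using nrm norm by blast
        hence "x # \<omega> (n' + j) i = \<omega> (n' + j + d x) i'" using dat(2)[OF x jx v(2)] by blast
        thus ?thesis using \<theta>_\<omega>[of i' "j + d x"] i' v \<theta>v by (simp add: ac_simps)
      qed
      fix u assume u0: "u \<in> NW n D" and udeg: "wdeg d u = wdeg d (x # v)"
      obtain l m where u: "l \<le> D" "m < h (n + l)" "u = \<omega> (n + l) m" "wdeg d u = n + l" using cases[OF u0] by blast
      have "l = j + d x" using udeg u v by simp
      thus "nf (fa_mono (x # v)) u = nf (fa_mono (x # \<theta> v)) (\<theta> u)"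
        using dat(1)[OF x jx v(2), of m] u v \<theta>v \<theta>_\<omega> by (simp add: add.assoc)
    qed
    moreover have "\<theta> w = w'"
    proof -
      have "rk w = rk w'" using key by (simp add: key_def)
      thus ?thesis using rk(2)[OF w'] by (simp add: \<theta>_def n_def n'_def)
    qed
    ultimately have "u @ w \<in> normal \<longleftrightarrow> u @ w' \<in> normal" if "u \<in> lists {..<k}" for u
      using sim_append[OF _ D w n_def[symmetric] that] by blast
    thus ?thesis by blast
  qed
  ultimately have "finite ((\<lambda>w. {u \<in> lists {..<k}. u @ w \<in> normal}) ` normal)"
    by (rule finite_image_factor)
  \<comment> \<open>A word that is not normal has an empty left quotient, so it adds at most one
    set.\<close>
  moreover have "(\<lambda>w. {u \<in> lists {..<k}. u @ w \<in> normal}) ` lists {..<k}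
      \<subseteq> insert {} ((\<lambda>w. {u \<in> lists {..<k}. u @ w \<in> normal}) ` normal)"
  proof (rule image_subsetI)
    fix w
    show "{u \<in> lists {..<k}. u @ w \<in> normal} \<in> insert {} ((\<lambda>w. {u \<in> lists {..<k}. u @ w \<in> normal}) ` normal)"
      by (cases "w \<in> normal") (use append_normal in auto)
  qed
  ultimately show ?thesis by (meson finite.insertI finite_subset)
qed

end

section \<open>Frobenius and algebraic extensions of the prime field\<close>

lemma of_nat_power_CHAR:
  assumes "prime CHAR('k::field)"
  shows "(of_nat n :: 'k) ^ CHAR('k) = of_nat n"
proof (induction n)
  case 0
  then show ?case using assms by (simp add: power_0_left prime_gt_0_nat)
next
  case (Suc n)
  then show ?case using freshmans_dream[OF assms refl, of 1 "of_nat n"] by simp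
qed

lemma Ints_eq_of_nat_image:
  assumes "CHAR('k::field) > 0"
  shows "(\<int> :: 'k set) = of_nat ` {..<CHAR('k)}"
proof
  show "\<int> \<subseteq> (of_nat ` {..<CHAR('k)} :: 'k set)"
  proof
    fix a :: 'k assume "a \<in> \<int>"
    then obtain z where z: "a = of_int z" by (auto elim: Ints_cases)
    define i where "i = nat (z mod int CHAR('k))"
    have i: "int i = z mod int CHAR('k)" using assms by (simp add: i_def)
    have "(of_int z :: 'k) = of_int (z mod int CHAR('k) + int CHAR('k) * (z div int CHAR('k)))"
      by simp
    also have "\<dots> = of_int (int i)" unfolding of_int_add of_int_mult by (simp add: i)
    finally have "a = of_nat i" using z by simp
    moreover have "i < CHAR('k)" using assms by (simp add: i_def nat_less_iff)
    ultimately show "a \<in> of_nat ` {..<CHAR('k)}" by blast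
  qed
qed auto

text \<open>By Fermat c^p = c, so c^(p - 2) is the inverse of c.\<close>

lemma inverse_in_Ints_CHAR:
  assumes "CHAR('k::field) > 0" "c \<in> \<int>" "(c :: 'k) \<noteq> 0"
  shows "inverse c \<in> \<int>"
proof -
  have p: "prime CHAR('k)" using assms(1) by (rule prime_CHAR_semidom)
  obtain n where "c = of_nat n" using assms Ints_eq_of_nat_image by blast
  hence "c ^ CHAR('k) = c" using of_nat_power_CHAR[OF p] by simp
  moreover have "c ^ CHAR('k) = c * (c * c ^ (CHAR('k) - 2))"
    using prime_ge_2_nat[OF p] by (metis power_Suc Suc_diff_le diff_Suc_Suc numeral_2_eq_2 diff_zero power_Suc0_right le_add_diff_inverse add_2_eq_Suc)
  ultimately have "c * c ^ (CHAR('k) - 2) = 1" using assms(3) by (metis mult_cancel_left mult.right_neutral)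
  hence "inverse c = c ^ (CHAR('k) - 2)" by (metis inverse_unique)
  thus ?thesis using assms(2) by simp
qed

lemma power_CHAR_power_inj:
  assumes p: "prime CHAR('k::field)" and "(a :: 'k) ^ CHAR('k) ^ s = b ^ CHAR('k) ^ s"
  shows "a = b"
proof -
  have "a ^ CHAR('k) ^ s = ((a - b) + b) ^ CHAR('k) ^ s" by simp
  also have "\<dots> = (a - b) ^ CHAR('k) ^ s + b ^ CHAR('k) ^ s"
    by (rule freshmans_dream'[OF p refl])
  finally have "(a - b) ^ CHAR('k) ^ s = 0" using assms(2) by simp
  thus ?thesis by simp
qed

text \<open>All powers of a lie in the finite set T of combinations of 1, ..., a^(n - 1) over the
  prime field. Hence two Frobenius iterates of a coincide, and injectivity of Frobenius cancels the
  shorter one.\<close>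

lemma algebraic_prime_frobenius_fixed:
  assumes char: "CHAR('k::field) > 0" and alg: "algebraic_prime (a :: 'k)"
  shows "\<exists>s>0. a ^ CHAR('k) ^ s = a"
proof -
  let ?p = "CHAR('k)"
  have p: "prime ?p" using char by (rule prime_CHAR_semidom)
  obtain q where q: "q \<noteq> 0" "\<forall>i. coeff q i \<in> \<int>" "poly q a = 0"
    using alg unfolding algebraic_prime_def by blast
  define n where "n = degree q"
  define T where "T = (\<lambda>c. \<Sum>i<n. c i * a ^ i) ` ({..<n} \<rightarrow>\<^sub>E (\<int> :: 'k set))"
  have finT: "finite T"
    unfolding T_def Ints_eq_of_nat_image[OF char] by (intro finite_imageI finite_PiE) auto
  have T_I: "(\<Sum>i<n. c i * a ^ i) \<in> T" if "\<And>i. i < n \<Longrightarrow> c i \<in> \<int>" for c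
  proof -
    have "(\<Sum>i<n. c i * a ^ i) = (\<Sum>i<n. restrict c {..<n} i * a ^ i)" by (intro sum.cong) auto
    thus ?thesis unfolding T_def using that by (intro image_eqI[of _ _ "restrict c {..<n}"]) auto
  qed
  have n: "n > 0"
  proof (rule ccontr)
    assume "\<not> n > 0"
    then obtain c where "q = [:c:]" using degree_0_id[of q] unfolding n_def by (metis gr0I)
    thus False using q by simp
  qed
  \<comment> \<open>Division by the leading coefficient, which stays in the prime field, expresses
    a^n by lower powers.\<close>
  define b where "b i = - (inverse (coeff q n) * coeff q i)" for i
  have lc: "coeff q n \<noteq> 0" using q by (simp add: n_def)
  have b_Z: "b i \<in> \<int>" for i
    unfolding b_def using q(2) inverse_in_Ints_CHAR[OF char _ lc] by (intro Ints_minus Ints_mult) auto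
  have an: "a ^ n = (\<Sum>i<n. b i * a ^ i)"
  proof -
    have "0 = (\<Sum>i\<le>n. coeff q i * a ^ i)" using q(3) by (simp add: poly_altdef n_def)
    also have "\<dots> = coeff q n * a ^ n + (\<Sum>i<n. coeff q i * a ^ i)"
      by (simp add: lessThan_Suc_atMost[symmetric])
    finally have "coeff q n * a ^ n = - (\<Sum>i<n. coeff q i * a ^ i)" by (simp add: eq_neg_iff_add_eq_0)
    hence "a ^ n = - (inverse (coeff q n) * (\<Sum>i<n. coeff q i * a ^ i))"
      using lc by (simp add: field_simps)
    thus ?thesis by (simp add: b_def sum_distrib_left sum_negf mult.assoc)
  qed
  have "a ^ j \<in> T" for j
  proof (induction j)
    case 0
    have "(\<Sum>i<n. (if i = 0 then 1 else 0) * a ^ i) \<in> T" by (rule T_I) auto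
    moreover have "(\<Sum>i<n. (if i = 0 then 1 else 0) * a ^ i) = 1"
    proof -
      have "(\<Sum>i<n. (if i = 0 then 1 else 0) * a ^ i) = (\<Sum>i<n. if i = 0 then 1 else 0)"
        by (intro sum.cong) auto
      thus ?thesis using n by simp
    qed
    ultimately show ?case by simp
  next
    case (Suc j)
    then obtain c where c: "c \<in> {..<n} \<rightarrow>\<^sub>E \<int>" "a ^ j = (\<Sum>i<n. c i * a ^ i)" by (auto simp: T_def)
    obtain n1 where n1: "n = Suc n1" using n by (cases n) auto
    have "a ^ Suc j = (\<Sum>i<n. c i * a ^ Suc i)" by (simp add: c sum_distrib_left mult_ac)
    also have "\<dots> = (\<Sum>i<n1. c i * a ^ Suc i) + c n1 * a ^ n" by (simp add: n1)
    also have "(\<Sum>i<n1. c i * a ^ Suc i) = (\<Sum>i<n. (if i = 0 then 0 else c (i - 1)) * a ^ i)"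
      unfolding n1 sum.lessThan_Suc_shift by simp
    also have "c n1 * a ^ n = (\<Sum>i<n. c n1 * b i * a ^ i)" by (simp add: an sum_distrib_left mult_ac)
    finally have "a ^ Suc j = (\<Sum>i<n. ((if i = 0 then 0 else c (i - 1)) + c n1 * b i) * a ^ i)"
      by (simp add: sum.distrib[symmetric] distrib_right)
    also have "\<dots> \<in> T"
      using c(1) b_Z n1 by (intro T_I Ints_add Ints_mult) (auto simp: PiE_iff)
    finally show ?case .
  qed
  hence "range (\<lambda>s. a ^ ?p ^ s) \<subseteq> T" by blast
  hence "finite (range (\<lambda>s. a ^ ?p ^ s))" using finT by (rule finite_subset)
  hence "\<not> inj (\<lambda>s. a ^ ?p ^ s)" using finite_imageD by blast
  then obtain s u where su: "s < u" "a ^ ?p ^ s = a ^ ?p ^ u"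
    unfolding inj_def by (metis linorder_neqE_nat)
  have "(a ^ ?p ^ (u - s)) ^ ?p ^ s = a ^ ?p ^ s"
    using su by (simp add: power_mult[symmetric] power_add[symmetric])
  hence "a ^ ?p ^ (u - s) = a" by (rule power_CHAR_power_inj[OF p])
  thus ?thesis using su by (intro exI[of _ "u - s"]) auto
qed

lemma frobenius_fixed_mult:
  "(a :: 'k::field) ^ p ^ s = a \<Longrightarrow> a ^ p ^ (s * u) = a"
  by (induction u) (auto simp: power_add power_mult)

lemma frobenius_fixed_finite_set:
  assumes "finite A" "\<forall>a\<in>A. \<exists>s>0. (a :: 'k::field) ^ p ^ s = a"
  shows "\<exists>s>0. \<forall>a\<in>A. a ^ p ^ s = a"
  using assms
proof (induction A rule: finite_induct)
  case (insert x A)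
  then obtain s u where "s > 0" "\<forall>a\<in>A. a ^ p ^ s = a" "u > 0" "x ^ p ^ u = x" by auto
  hence "\<forall>a\<in>insert x A. a ^ p ^ (s * u) = a" "s * u > 0"
    using frobenius_fixed_mult[of _ p s u] frobenius_fixed_mult[of x p u s] by (auto simp: mult.commute)
  then show ?case by blast
qed auto

lemma finite_power_fixed:
  assumes "q > 1"
  shows "finite {a :: 'k::field. a ^ q = a}"
proof -
  have "coeff (monom 1 q - monom 1 1 :: 'k poly) q = 1" using assms by simp
  hence "(monom 1 q - monom 1 1 :: 'k poly) \<noteq> 0" by (metis coeff_0 zero_neq_one)
  from poly_roots_finite[OF this] show ?thesis by (simp add: poly_monom)
qed

lemma fa_prod_letters: "fa_prod (map (\<lambda>j. fa_mono [\<sigma> j]) w) = fa_mono (map \<sigma> w)"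
  by (induction w) (auto simp: fa_prod_def)

context fp_algebra
begin

text \<open>Raising all coefficients to the q-th power preserves the ideal, because it is semilinear
  and fixes the relations. It also preserves supports and fixes words, so it maps the normal form of
  w to a normal form of w, that is, to itself.\<close>

lemma nf_frobenius_fixed:
  assumes p: "prime CHAR('k)" and q: "q = CHAR('k) ^ s"
    and R: "\<And>r w. r \<in> R \<Longrightarrow> r w ^ q = r w" and w: "w \<in> lists {..<k}"
  shows "nf (fa_mono w) v ^ q = nf (fa_mono w) v"
proof -
  have q0: "q > 0" using p q by (simp add: prime_gt_0_nat)
  have add: "(a + b) ^ q = a ^ q + b ^ q" for a b :: 'k by (rule freshmans_dream'[OF p q])
  have diff: "(a - b) ^ q = a ^ q - b ^ q" for a b :: 'k
    using add[of "a - b" b] by (simp add: algebra_simps)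
  define fr where "fr f = (\<lambda>w. f w ^ q)" for f :: "'k fa"
  have fr_I: "fr f \<in> I" if "f \<in> I" for f
    using that
  proof (induction rule: fa_ideal_induct)
    case zero
    have "fr 0 = 0" using q0 by (auto simp: fr_def fa_apply fun_eq_iff)
    then show ?case using J_0 by simp
  next
    case (add f g)
    have "fr (f + g) = fr f + fr g" by (auto simp: fr_def fa_apply fun_eq_iff \<open>\<And>a b. (a + b) ^ q = a ^ q + b ^ q\<close>)
    then show ?case using add J_add by simp
  next
    case (scale c f)
    have "fr (fa_scale c f) = fa_scale (c ^ q) (fr f)" by (auto simp: fr_def fa_apply fun_eq_iff power_mult_distrib)
    then show ?case using scale J_scale by simp
  next
    case (base a b r)
    have r_in: "in_fa k r" using base finite_presentationD(3)[OF fp] by blast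
    have exp: "r = (\<Sum>x\<in>fa_supp r. fa_scale (r x) (fa_mono x))"
      using r_in by (intro fa_expand) (auto simp: in_fa_def)
    have "sandwich a r b = (\<Sum>x\<in>fa_supp r. fa_scale (r x) (fa_mono (a @ x @ b)))"
      by (subst exp) (simp add: fa_mult_sum_left fa_mult_sum_right fa_mult_scale_left fa_mult_scale_right)
    hence val: "sandwich a r b y = (\<Sum>x\<in>fa_supp r. r x * (if y = a @ x @ b then 1 else 0))" for y
      by (simp add: sum_fun_apply fa_apply fa_mono_apply)
    have "fr (sandwich a r b) = sandwich a r b"
    proof
      fix y
      have "fr (sandwich a r b) y = (\<Sum>x\<in>fa_supp r. (r x * (if y = a @ x @ b then 1 else 0)) ^ q)"
        unfolding fr_def val by (rule freshmans_dream_sum'[OF p q])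
      also have "\<dots> = sandwich a r b y"
        unfolding val using R[OF base(3)] q0 by (intro sum.cong) auto
      finally show "fr (sandwich a r b) y = sandwich a r b y" .
    qed
    then show ?case using base fa_ideal_base by metis
  qed
  let ?g = "nf (fa_mono w :: 'k fa)"
  have ins: "in_fa k (fa_mono w :: 'k fa)" using w by simp
  have "fr (fa_mono w - ?g) \<in> I" using nf_props(3)[OF ins] fr_I by blast
  moreover have "fr (fa_mono w - ?g) = fa_mono w - fr ?g"
    using q0 by (auto simp: fr_def fun_eq_iff fa_apply diff fa_mono_apply)
  moreover have "fa_supp (fr ?g) \<subseteq> normal"
    using nf_props(2)[OF ins] q0 by (auto simp: fr_def fa_supp_def)
  ultimately have "?g = fr ?g" using ins by (intro nf_eqI) auto
  thus ?thesis unfolding fr_def by metis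
qed

lemma I_mult_right:
  assumes "f \<in> I" "w \<in> lists {..<k}"
  shows "fa_mult f (fa_mono w) \<in> I"
  using assms(1)
proof (induction rule: fa_ideal_induct)
  case (base a b r)
  have "in_fa k r" using base finite_presentationD(3)[OF fp] by blast
  hence "fa_mult (sandwich a r b) (fa_mono w) = sandwich a r (b @ w)"
    using fa_mult_assoc[of k "fa_mult (fa_mono a) r" "fa_mono b" "fa_mono w"] base assms(2)
    by (simp add: in_fa_mult)
  then show ?case using base assms(2) fa_ideal_base[of a k "b @ w" r R] by simp
qed (auto simp: fa_mult_add_left fa_mult_scale_left J_add J_scale J_0)

text \<open>All letters serve as generators here, even those that coincide in the algebra.\<close>

lemma card_normal_eq_hilbert_fun: "hilbert_fun k d R n = card {w \<in> normal. wdeg d w = n}"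
proof -
  have eval: "fa_eval (\<lambda>j. fa_mono [j]) u = u" if "in_fa k u" for u :: "'k fa"
  proof -
    have "fa_prod (map (\<lambda>j. fa_mono [j]) w) = (fa_mono w :: 'k fa)" for w
      using fa_prod_letters[of "\<lambda>j. j" w] by simp
    hence "fa_eval (\<lambda>j. fa_mono [j]) u = (\<Sum>w\<in>fa_supp u. fa_scale (u w) (fa_mono w))"
      by (simp only: fa_eval_def)
    also have "\<dots> = u" using fa_expand[of "fa_supp u" u] that by (simp add: in_fa_def)
    finally show ?thesis .
  qed
  have ker: "pres_kernel k R k (\<lambda>j. fa_mono [j]) = I"
    using J_in_fa eval by (auto simp: pres_kernel_def)
  have "hilbert_fun k d R n = card {w \<in> normal_words k d (\<lambda>i. i) (pres_kernel k R k (\<lambda>j. fa_mono [j])). wdeg d w = n}"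
  proof (rule hilbert_fun_eq_card_normal_words[OF fp])
    fix g :: "'k fa" assume g: "in_fa k g"
    thus "\<exists>u. in_fa k u \<and> g - fa_eval (\<lambda>j. fa_mono [j]) u \<in> I"
      using eval J_0 by (intro exI[of _ g]) simp
  qed (use e_pos in \<open>auto simp: words_of_deg_def\<close>)
  thus ?thesis by (simp add: ker)
qed

text \<open>Two letters may coincide in the algebra, so the generators are those letters that are
  normal words. Ranking them by \<open>\<sigma>\<close> makes the new order the restriction of the old one.\<close>
lemma automaton_presentable_if_finite_left_quotients:
  assumes fin: "finite ((\<lambda>w. {u \<in> lists {..<k}. u @ w \<in> normal}) ` lists {..<k})"
  shows "automaton_presentable k d R"
proof -
  define S where "S = {x. x < k \<and> [x] \<in> normal}"
  define m where "m = card S"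
  have "finite S" by (simp add: S_def)
  then obtain \<sigma> where \<sigma>: "bij_betw \<sigma> {..<m} S"
    using ex_bij_betw_nat_finite[of S] by (auto simp: m_def atLeast0LessThan)
  define e where "e j = d (\<sigma> j)" for j
  define f :: "nat \<Rightarrow> 'k fa" where "f j = fa_mono [\<sigma> j]" for j
  have \<sigma>_S: "\<sigma> j \<in> S" if "j < m" for j using \<sigma> that by (auto simp: bij_betw_def)
  hence \<sigma>_k: "\<sigma> j < k" if "j < m" for j using that by (auto simp: S_def)
  have \<sigma>_inj: "inj_on \<sigma> {..<m}" using \<sigma> by (simp add: bij_betw_def)
  have map_k: "map \<sigma> w \<in> lists {..<k}" if "w \<in> lists {..<m}" for w using that \<sigma>_k by auto
  have map_inj: "v = w" if "v \<in> lists {..<m}" "w \<in> lists {..<m}" "map \<sigma> v = map \<sigma> w" for v w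
  proof -
    have "inj_on \<sigma> (set v \<union> set w)" using that by (intro inj_on_subset[OF \<sigma>_inj]) auto
    thus ?thesis using that(3) inj_on_map_eq_map by blast
  qed
  have normal_S: "w \<in> lists S" if "w \<in> normal" for w
  proof -
    have "[x] \<in> normal" if x: "x \<in> set w" for x
    proof -
      obtain a b where ab: "w = a @ x # b" using split_list[OF x] by blast
      hence n: "x # b \<in> normal" using \<open>w \<in> normal\<close> append_normal by blast
      show ?thesis
      proof (rule ccontr)
        assume "[x] \<notin> normal"
        moreover have xb: "x < k" "b \<in> lists {..<k}" using normal_in_lists[OF n] by auto
        ultimately obtain u where u: "u \<in> I" "is_leading d (\<lambda>i. i) u [x]"
          using not_normal_iff[of "[x]"] by auto
        \<comment> \<open>After passing to degree \<open>d x\<close>, every other word z of u' is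
          nonempty and starts with a letter smaller than x. Appending b then keeps the order, so u'
          times b has leading word \<open>x # b\<close>.\<close>
        define u' where "u' = hcomp d (d x) u"
        have u': "u' \<in> I" using u hcomp_J by (simp add: u'_def)
        have fin: "finite (fa_supp u')" "fa_supp u' \<subseteq> lists {..<k}" using J_in_fa[OF u'] by (auto simp: in_fa_def)
        have exp: "u' = (\<Sum>y\<in>fa_supp u'. fa_scale (u' y) (fa_mono y))" using fin by (intro fa_expand) auto
        have val: "fa_mult u' (fa_mono b) y = (\<Sum>z\<in>fa_supp u'. if y = z @ b then u' z else 0)" for y
        proof -
          have "fa_mult u' (fa_mono b) = (\<Sum>z\<in>fa_supp u'. fa_scale (u' z) (fa_mono (z @ b)))"
            by (subst exp) (simp add: fa_mult_sum_left fa_mult_scale_left)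
          thus ?thesis by (auto simp: sum_fun_apply fa_apply fa_mono_apply intro!: sum.cong)
        qed
        have "fa_mult u' (fa_mono b) \<in> I" using u' xb by (intro I_mult_right)
        moreover have "is_leading d (\<lambda>i. i) (fa_mult u' (fa_mono b)) (x # b)"
          unfolding is_leading_def
        proof (intro conjI allI impI)
          have "u' [x] \<noteq> 0" using u(2) by (simp add: u'_def hcomp_def is_leading_def)
          moreover have "fa_mult u' (fa_mono b) (x # b) = (\<Sum>z\<in>fa_supp u'. if z = [x] then u' z else 0)"
            unfolding val by (intro sum.cong) (auto simp: append_eq_Cons_conv)
          ultimately show "fa_mult u' (fa_mono b) (x # b) \<noteq> 0" using fin by (simp add: fa_supp_def)
        next
          fix y assume y: "fa_mult u' (fa_mono b) y \<noteq> 0 \<and> y \<noteq> x # b"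
          hence "(\<Sum>z\<in>fa_supp u'. if y = z @ b then u' z else 0) \<noteq> 0" using val by simp
          then obtain z where "z \<in> fa_supp u'" "(if y = z @ b then u' z else 0) \<noteq> 0"
            by (rule sum.not_neutral_contains_not_neutral)
          hence z: "y = z @ b" "u' z \<noteq> 0" by (auto split: if_splits)
          hence zd: "wdeg d z = d x" "u z \<noteq> 0" by (auto simp: u'_def hcomp_def split: if_splits)
          have "z \<prec> [x]" using u(2) zd(2) y z(1) by (auto simp: is_leading_def)
          moreover have "z \<noteq> []" using zd(1) e_pos[OF xb(1)] by auto
          ultimately obtain c z' where "z = c # z'" "c < x"
            using zd(1) by (cases z) (auto simp: deglex_less_def)
          thus "y \<prec> x # b" using z(1) zd(1) by (simp add: deglex_less_def)
        qed
        ultimately show False using n by (auto simp: normal_words_def)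
      qed
    qed
    thus ?thesis using normal_in_lists[OF that] by (auto simp: S_def)
  qed
  have "wdeg e w = wdeg d (map \<sigma> w)" for w by (induction w) (auto simp: e_def)
  hence order: "deglex_less e \<sigma> v w \<longleftrightarrow> map \<sigma> v \<prec> map \<sigma> w" for v w
    by (simp add: deglex_less_def)
  have prod_f: "fa_prod (map f w) = fa_mono (map \<sigma> w)" for w
    unfolding f_def by (rule fa_prod_letters)
  have eval: "fa_eval f u y = (\<Sum>v\<in>fa_supp u. if y = map \<sigma> v then u v else 0)" for u y
    by (auto simp: fa_eval_def prod_f sum_fun_apply fa_apply fa_mono_apply intro!: sum.cong)
  have eval_map: "fa_eval f u (map \<sigma> w) = u w" if u: "in_fa m u" and w: "w \<in> lists {..<m}" for u w
  proof -
    have "fa_eval f u (map \<sigma> w) = (\<Sum>v\<in>fa_supp u. if v = w then u v else 0)"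
      unfolding eval
    proof (intro sum.cong refl)
      fix v assume "v \<in> fa_supp u"
      hence "v \<in> lists {..<m}" using u by (auto simp: in_fa_def)
      hence "map \<sigma> w = map \<sigma> v \<longleftrightarrow> v = w" using map_inj w by metis
      thus "(if map \<sigma> w = map \<sigma> v then u v else 0) = (if v = w then u v else 0)" by simp
    qed
    also have "\<dots> = u w" using u by (auto simp: fa_supp_def in_fa_def)
    finally show ?thesis .
  qed
  \<comment> \<open>Normal words use only letters of S, so elements supported on them have preimages
    under \<sigma>.\<close>
  have lift: "\<exists>u. in_fa m u \<and> fa_eval f u = g" if g: "finite (fa_supp g)" "fa_supp g \<subseteq> normal" for g :: "'k fa"
  proof -
    define \<tau> where "\<tau> = inv_into {..<m} \<sigma>"
    have \<tau>: "map \<tau> y \<in> lists {..<m}" "map \<sigma> (map \<tau> y) = y" if "y \<in> fa_supp g" for y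
    proof -
      have "x \<in> \<sigma> ` {..<m}" if "x \<in> set y" for x
        using normal_S[of y] \<open>y \<in> fa_supp g\<close> g(2) that \<sigma> by (auto simp: bij_betw_def)
      hence *: "\<tau> x < m \<and> \<sigma> (\<tau> x) = x" if "x \<in> set y" for x
        using that inv_into_into[of x \<sigma> "{..<m}"] f_inv_into_f[of x \<sigma> "{..<m}"] by (auto simp: \<tau>_def)
      show "map \<tau> y \<in> lists {..<m}" using * by auto
      show "map \<sigma> (map \<tau> y) = y" using * by (auto intro!: map_idI simp: o_def)
    qed
    let ?u = "\<Sum>y\<in>fa_supp g. fa_scale (g y) (fa_mono (map \<tau> y))"
    have ins: "in_fa m (fa_mono (map \<tau> y) :: 'k fa)" if "y \<in> fa_supp g" for y
      using \<tau>(1)[OF that] by (simp only: in_fa_mono)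
    have "fa_eval f ?u = (\<Sum>y\<in>fa_supp g. fa_scale (g y) (fa_mono y))"
      using ins \<tau>(2) by (subst fa_eval_sum[of _ m])
        (auto intro!: in_fa_scale sum.cong simp: fa_eval_scale[of m] fa_eval_mono prod_f simp del: in_fa_mono map_map)
    also have "\<dots> = g" using fa_expand[OF g(1), of g] by simp
    finally have "fa_eval f ?u = g" .
    moreover have "in_fa m ?u" by (rule in_fa_sum, rule in_fa_scale, rule ins)
    ultimately show ?thesis by (intro exI[of _ ?u] conjI)
  qed
  have gen: "generating_family k d R m e f"
    unfolding generating_family_def
  proof (intro conjI allI impI)
    fix j assume j: "j < m"
    show "0 < e j" using e_pos[OF \<sigma>_k[OF j]] by (simp add: e_def)
    show "homog_of k d (e j) (f j)" using \<sigma>_k[OF j] by (simp add: f_def e_def words_of_deg_def)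
  next
    fix i j assume ij: "i < m" "j < m" "i \<noteq> j"
    show "f i - f j \<notin> I"
    proof
      assume "f i - f j \<in> I"
      moreover have "fa_supp (f i - f j) \<subseteq> normal"
        using \<sigma>_S ij by (intro fa_supp_diff) (auto simp: f_def S_def)
      ultimately have "f i - f j = 0" by (rule normal_combination_in_J)
      hence "f i [\<sigma> i] = f j [\<sigma> i]" by simp
      hence "\<sigma> i = \<sigma> j" by (simp add: f_def fa_mono_apply split: if_splits)
      thus False using ij \<sigma>_inj by (auto dest: inj_onD)
    qed
  next
    fix g :: "'k fa" assume g: "in_fa k g"
    obtain u where "in_fa m u" "fa_eval f u = nf g"
      using lift[of "nf g"] nf_props[OF g] by (auto simp: in_fa_def)
    thus "\<exists>u. in_fa m u \<and> g - fa_eval f u \<in> I" using nf_props(3)[OF g] by metis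
  qed
  define L where "L = normal_words m e \<sigma> (pres_kernel k R m f)"
  have L_iff: "w \<in> L \<longleftrightarrow> map \<sigma> w \<in> normal" if w: "w \<in> lists {..<m}" for w
  proof
    assume wL: "w \<in> L"
    show "map \<sigma> w \<in> normal"
    \<comment> \<open>If \<open>map \<sigma> w\<close> is not normal, its normal form lifts to some
      u, and w - u lies in the kernel with leading word w.\<close>
    proof (rule ccontr)
      assume nn: "map \<sigma> w \<notin> normal"
      have ins: "in_fa k (fa_mono (map \<sigma> w) :: 'k fa)" using map_k[OF w] by (simp only: in_fa_mono)
      let ?g = "nf (fa_mono (map \<sigma> w) :: 'k fa)"
      obtain u where u: "in_fa m u" "fa_eval f u = ?g"
        using lift[of ?g] nf_props[OF ins] by (auto simp: in_fa_def)
      have w_in: "in_fa m (fa_mono w :: 'k fa)" using w by (simp only: in_fa_mono)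
      have d_in: "in_fa m (fa_mono w - u)" using w_in u(1) by (rule in_fa_diff)
      have "fa_eval f (fa_mono w - u) = fa_mono (map \<sigma> w) - ?g"
        using fa_eval_diff[OF w_in u(1), of f] u(2) by (simp add: fa_eval_mono prod_f)
      hence "fa_mono w - u \<in> pres_kernel k R m f"
        using nf_props(3)[OF ins] d_in by (simp add: pres_kernel_def)
      moreover have "is_leading e \<sigma> (fa_mono w - u) w"
        unfolding is_leading_def
      proof (intro conjI allI impI)
        have "u w = ?g (map \<sigma> w)" using eval_map[OF u(1) w] u(2) by simp
        also have "\<dots> = 0" using nf_props(2)[OF ins] nn by (auto simp: fa_supp_def)
        finally show "(fa_mono w - u) w \<noteq> 0" by (simp add: fa_apply fa_mono_apply)
      next
        fix v assume v: "(fa_mono w - u) v \<noteq> 0 \<and> v \<noteq> w"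
        hence uv: "u v \<noteq> 0" by (auto simp: fa_apply fa_mono_apply)
        hence "v \<in> lists {..<m}" using u(1) by (auto simp: in_fa_def fa_supp_def)
        hence "?g (map \<sigma> v) \<noteq> 0" "map \<sigma> v \<noteq> map \<sigma> w"
          using eval_map[OF u(1)] u(2) uv map_inj w v by metis+
        thus "deglex_less e \<sigma> v w" unfolding order using nf_mono_supp(3)[OF map_k[OF w]] by blast
      qed
      ultimately show False using wL by (auto simp: L_def normal_words_def)
    qed
  next
    assume wn: "map \<sigma> w \<in> normal"
    have False if u: "u \<in> pres_kernel k R m f" "is_leading e \<sigma> u w" for u
    proof -
      have ui: "in_fa m u" "fa_eval f u \<in> I" using u by (auto simp: pres_kernel_def)
      have "is_leading d (\<lambda>i. i) (fa_eval f u) (map \<sigma> w)"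
        unfolding is_leading_def
      proof (intro conjI allI impI)
        show "fa_eval f u (map \<sigma> w) \<noteq> 0" using eval_map[OF ui(1) w] u(2) by (simp add: is_leading_def)
      next
        fix y assume y: "fa_eval f u y \<noteq> 0 \<and> y \<noteq> map \<sigma> w"
        hence "(\<Sum>v\<in>fa_supp u. if y = map \<sigma> v then u v else 0) \<noteq> 0" by (simp add: eval)
        then obtain v where "v \<in> fa_supp u" "(if y = map \<sigma> v then u v else 0) \<noteq> 0"
          by (rule sum.not_neutral_contains_not_neutral)
        hence v: "y = map \<sigma> v" "u v \<noteq> 0" by (auto split: if_splits)
        hence "deglex_less e \<sigma> v w" using u(2) y by (auto simp: is_leading_def)
        thus "y \<prec> map \<sigma> w" using v order by simp
      qed
      thus False using ui(2) wn by (auto simp: normal_words_def)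
    qed
    thus "w \<in> L" using w by (auto simp: L_def normal_words_def simp del: in_lists_conv_set)
  qed
  have L_sub: "L \<subseteq> lists {..<m}" by (auto simp: L_def normal_words_def)
  have "regular_lang m L"
  proof (rule regular_lang_of_finite_left_quotients[OF L_sub])
    let ?Q = "\<lambda>w. {u \<in> lists {..<k}. u @ w \<in> normal}"
    \<comment> \<open>Each left quotient of L is the preimage under \<sigma> of a left quotient of
      the old language, so finiteness is inherited.\<close>
    have "{u \<in> lists {..<m}. u @ w \<in> L} = {u \<in> lists {..<m}. map \<sigma> u \<in> ?Q (map \<sigma> w)}" if w: "w \<in> lists {..<m}" for w
    proof (rule Collect_cong, rule conj_cong[OF refl])
      fix u assume u: "u \<in> lists {..<m}"
      hence "u @ w \<in> lists {..<m}" using w by simp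
      from L_iff[OF this] show "u @ w \<in> L \<longleftrightarrow> map \<sigma> u \<in> ?Q (map \<sigma> w)" using map_k[OF u] by simp
    qed
    hence "{u \<in> lists {..<m}. u @ w \<in> L} \<in> (\<lambda>Q. {u \<in> lists {..<m}. map \<sigma> u \<in> Q}) ` ?Q ` lists {..<k}"
      if "w \<in> lists {..<m}" for w
      using map_k that by (intro image_eqI[of _ _ "?Q (map \<sigma> w)"] imageI)
    hence "(\<lambda>w. {u \<in> lists {..<m}. u @ w \<in> L}) ` lists {..<m}
        \<subseteq> (\<lambda>Q. {u \<in> lists {..<m}. map \<sigma> u \<in> Q}) ` ?Q ` lists {..<k}"
      by (rule image_subsetI)
    thus "finite ((\<lambda>w. {u \<in> lists {..<m}. u @ w \<in> L}) ` lists {..<m})"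
      by (rule finite_subset) (intro finite_imageI fin)
  qed
  thus ?thesis unfolding automaton_presentable_def L_def using gen \<sigma>_inj by blast
qed

end

text \<open>One power q of p fixes the finitely many coefficients of the relations. Normal forms
  then have coefficients among the roots of X^q = X, and linear growth bounds the number of normal
  words per degree.\<close>

theorem automaton_presentable_if_algebraic:
  fixes R :: "'k::field fa set"
  assumes char: "CHAR('k) > 0" and alg: "\<And>x :: 'k. algebraic_prime x"
    and fp: "finite_presentation k d R" and lin: "linear_growth k d R"
  shows "automaton_presentable k d R"
proof -
  interpret fp_algebra k d R by unfold_locales (rule fp)
  have p: "prime CHAR('k)" using char by (rule prime_CHAR_semidom)
  have "finite (\<Union>r\<in>R. r ` fa_supp r)"
    using finite_presentationD(2,3)[OF fp] by (auto simp: in_fa_def)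
  then obtain s where s: "s > 0" "\<forall>a\<in>(\<Union>r\<in>R. r ` fa_supp r). a ^ CHAR('k) ^ s = a"
    using frobenius_fixed_finite_set[of _ "CHAR('k)"] algebraic_prime_frobenius_fixed[OF char alg] by metis
  define q where "q = CHAR('k) ^ s"
  have q: "q > 1" unfolding q_def using s(1) prime_gt_1_nat[OF p] by (rule one_less_power[rotated])
  have R_fix: "r w ^ q = r w" if "r \<in> R" for r w
    using s(2) that char by (cases "r w = 0") (auto simp: q_def fa_supp_def power_0_left)
  obtain C where C: "\<And>n. hilbert_fun k d R n \<le> C" using lin unfolding linear_growth_def by blast
  show ?thesis
  proof (rule automaton_presentable_if_finite_left_quotients, rule finite_left_quotients)
    show "card {w \<in> normal. wdeg d w = n} \<le> C" for n using C card_normal_eq_hilbert_fun by simp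
    show "finite {a :: 'k. a ^ q = a}" using q by (rule finite_power_fixed)
    show "nf (fa_mono w) v \<in> {a. a ^ q = a}" if "w \<in> lists {..<k}" for w v
      using nf_frobenius_fixed[OF p q_def, of w v] R_fix that by blast
  qed
qed

section \<open>A quadratic algebra with irrational Hilbert series\<close>

text \<open>The linear functional with values \<phi> on words. Functionals that vanish on the ideal
  certify independence modulo it, with no need to resolve ambiguities between relations.\<close>

definition pairing :: "(nat list \<Rightarrow> 'k::field) \<Rightarrow> 'k fa \<Rightarrow> 'k" where
  "pairing \<phi> f = (\<Sum>w\<in>fa_supp f. f w * \<phi> w)"

lemma pairing_superset: "finite A \<Longrightarrow> fa_supp f \<subseteq> A \<Longrightarrow> pairing \<phi> f = (\<Sum>w\<in>A. f w * \<phi> w)"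
  unfolding pairing_def by (intro sum.mono_neutral_left) (auto simp: fa_supp_def)

lemma pairing_add:
  assumes "in_fa k f" "in_fa k g"
  shows "pairing \<phi> (f + g) = pairing \<phi> f + pairing \<phi> g"
proof -
  let ?A = "fa_supp f \<union> fa_supp g"
  have A: "finite ?A" using assms by (auto simp: in_fa_def)
  have "fa_supp (f + g) \<subseteq> ?A" by (auto simp: fa_supp_def fa_apply)
  thus ?thesis using A by (simp add: pairing_superset[of ?A] fa_apply algebra_simps sum.distrib)
qed

lemma pairing_scale: "in_fa k f \<Longrightarrow> pairing \<phi> (fa_scale c f) = c * pairing \<phi> f"
proof -
  assume "in_fa k f"
  hence A: "finite (fa_supp f)" by (auto simp: in_fa_def)
  have "fa_supp (fa_scale c f) \<subseteq> fa_supp f" by (auto simp: fa_supp_def fa_apply)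
  thus ?thesis using A by (simp add: pairing_superset[of "fa_supp f"] fa_apply sum_distrib_left mult.assoc)
qed

lemma pairing_diff:
  assumes "in_fa k f" "in_fa k g"
  shows "pairing \<phi> (f - g) = pairing \<phi> f - pairing \<phi> g"
  using pairing_add[of k "f - g" g \<phi>] in_fa_diff[OF assms] assms by simp

lemma pairing_0 [simp]: "pairing \<phi> 0 = 0"
  by (simp add: pairing_def fa_apply fa_supp_def)

lemma pairing_mono [simp]: "pairing \<phi> (fa_mono w) = \<phi> w"
  by (simp add: pairing_def fa_mono_apply)

lemma pairing_sum: "(\<And>i. i \<in> A \<Longrightarrow> in_fa k (F i)) \<Longrightarrow> pairing \<phi> (\<Sum>i\<in>A. F i) = (\<Sum>i\<in>A. pairing \<phi> (F i))"
  by (induction A rule: infinite_finite_induct) (auto simp: pairing_add[of k] in_fa_sum)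

lemma pairing_fa_ideal:
  assumes R: "\<And>r. r \<in> R \<Longrightarrow> in_fa k r"
    and "\<And>u v r. u \<in> lists {..<k} \<Longrightarrow> v \<in> lists {..<k} \<Longrightarrow> r \<in> R \<Longrightarrow> pairing \<phi> (sandwich u r v) = 0"
    and "f \<in> fa_ideal k R"
  shows "pairing \<phi> f = 0"
  using assms(3)
  by (induction rule: fa_ideal_induct)
    (use assms(2) fa_ideal_in_fa[OF R] in \<open>auto simp: pairing_add[of k] pairing_scale[of k]\<close>)

definition unit_deg :: "nat \<Rightarrow> nat" where "unit_deg i = 1"

lemma wdeg_unit: "wdeg unit_deg w = length w"
  by (induction w) (auto simp: unit_deg_def)

text \<open>The letters are \<open>x = 0\<close>, \<open>z = 1\<close>, \<open>s = 2\<close> and \<open>e\<^sub>i = 3, 4, 5\<close>. The relations are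
  \<open>x e\<^sub>i = \<lambda>\<^sub>i e\<^sub>i x\<close> with \<open>\<lambda> = (1, t, 1 + t)\<close>, \<open>e\<^sub>3 z + e\<^sub>4 z = e\<^sub>5 z\<close>, \<open>s e\<^sub>3 = s e\<^sub>4 = s e\<^sub>5\<close> and the
  vanishing of the words in \<open>zero_pairs\<close>. They imply
  \<open>(1 + t\<^sup>n - (1 + t)\<^sup>n) s e\<^sub>3 x\<^sup>n z = s x\<^sup>n (e\<^sub>3 + e\<^sub>4 - e\<^sub>5) z = 0\<close>.\<close>
locale lech =
  fixes t :: "'k::field"
  assumes t1: "1 + t \<noteq> 0"
begin

definition lam :: "nat \<Rightarrow> 'k" where
  "lam i = (if i = 3 then 1 else if i = 4 then t else 1 + t)"

text \<open>These relations allow s only at the front, z only at the end and, once x is moved to the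
  right, at most one \<open>e_i\<close>. What survives has the shape of an optional s, an optional
  \<open>e_i\<close>, a power of x and an optional z.\<close>

definition zero_pairs :: "(nat \<times> nat) set" where
  "zero_pairs = {3, 4, 5} \<times> {3, 4, 5} \<union> {1} \<times> {..<6} \<union> {0, 2, 3, 4, 5} \<times> {2}"

definition rels :: "'k fa set" where
  "rels = (\<lambda>(i, j). fa_mono [i, j]) ` zero_pairs
     \<union> (\<lambda>i. fa_mono [0, i] - fa_scale (lam i) (fa_mono [i, 0])) ` {3, 4, 5}
     \<union> {fa_mono [3, 1] + fa_mono [4, 1] - fa_mono [5, 1],
        fa_mono [2, 3] - fa_mono [2, 4], fa_mono [2, 3] - fa_mono [2, 5]}"


lemma zero_pairs_bound: "(i, j) \<in> zero_pairs \<Longrightarrow> i < 6 \<and> j < 6"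
  by (auto simp: zero_pairs_def)

lemma mono_pair_homog: "i < 6 \<Longrightarrow> j < 6 \<Longrightarrow> fa_mono [i, j] \<in> fa.span (fa_mono ` words_of_deg 6 unit_deg 2)"
  by (intro fa.span_base imageI) (auto simp: words_of_deg_def unit_deg_def)

lemma rels_homog:
  assumes "r \<in> rels"
  shows "homog_of 6 unit_deg 2 r"
  unfolding homog_of_iff_span
  using assms unfolding rels_def
  by (auto intro!: mono_pair_homog fa.span_diff fa.span_add fa.span_scale dest: zero_pairs_bound)

lemma rels_in_fa: "r \<in> rels \<Longrightarrow> in_fa 6 r"
  using rels_homog homog_of_in_fa by blast

lemma presentation: "finite_presentation 6 unit_deg rels"
proof -
  have "finite rels" by (auto simp: rels_def zero_pairs_def)
  thus ?thesis using rels_homog by (auto simp: finite_presentation_def unit_deg_def[abs_def] intro!: exI[of _ 2])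
qed

abbreviation I :: "'k fa set" where "I \<equiv> fa_ideal 6 rels"

text \<open>The equations \<open>pairing \<phi> (sandwich u r v) = 0\<close>, one for each relation
  r, spelled out on words.\<close>

definition annihilates_at :: "nat list \<Rightarrow> nat list \<Rightarrow> (nat list \<Rightarrow> 'k) \<Rightarrow> bool" where
  "annihilates_at u v \<phi> \<longleftrightarrow>
     (\<forall>(i, j)\<in>zero_pairs. \<phi> (u @ i # j # v) = 0) \<and>
     (\<forall>i\<in>{3, 4, 5}. \<phi> (u @ 0 # i # v) = lam i * \<phi> (u @ i # 0 # v)) \<and>
     \<phi> (u @ 3 # 1 # v) + \<phi> (u @ 4 # 1 # v) = \<phi> (u @ 5 # 1 # v) \<and>
     \<phi> (u @ 2 # 3 # v) = \<phi> (u @ 2 # 4 # v) \<and> \<phi> (u @ 2 # 3 # v) = \<phi> (u @ 2 # 5 # v)"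

definition annihilates :: "(nat list \<Rightarrow> 'k) \<Rightarrow> bool" where
  "annihilates \<phi> \<longleftrightarrow> (\<forall>u v. annihilates_at u v \<phi>)"

lemma annihilates_I:
  assumes "annihilates \<phi>" "f \<in> I"
  shows "pairing \<phi> f = 0"
proof (rule pairing_fa_ideal[OF rels_in_fa _ assms(2)])
  fix u v :: "nat list" and r assume uv: "u \<in> lists {..<6}" "v \<in> lists {..<6}" and r: "r \<in> rels"
  have ins: "in_fa 6 (fa_mono (u @ i # j # v) :: 'k fa)" if "i < 6" "j < 6" for i j
    using uv that by simp
  note a = assms(1)[unfolded annihilates_def, rule_format, of u v, unfolded annihilates_at_def]
  note lin = fa_mult_add_left fa_mult_add_right fa_mult_diff_left fa_mult_diff_right
     fa_mult_scale_left fa_mult_scale_right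
  have "(\<exists>p\<in>zero_pairs. r = (case p of (i, j) \<Rightarrow> fa_mono [i, j]))
      \<or> (\<exists>i\<in>{3, 4, 5}. r = fa_mono [0, i] - fa_scale (lam i) (fa_mono [i, 0]))
      \<or> r = fa_mono [3, 1] + fa_mono [4, 1] - fa_mono [5, 1]
      \<or> r = fa_mono [2, 3] - fa_mono [2, 4] \<or> r = fa_mono [2, 3] - fa_mono [2, 5]"
    using r unfolding rels_def Un_iff image_iff singleton_iff insert_iff empty_iff by argo
  then show "pairing \<phi> (sandwich u r v) = 0"
  proof (elim disjE bexE)
    fix p assume p: "p \<in> zero_pairs" "r = (case p of (i, j) \<Rightarrow> fa_mono [i, j])"
    obtain i j where ij: "p = (i, j)" by (cases p)
    have "\<phi> (u @ i # j # v) = 0" using a p ij by auto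
    thus ?thesis using p ij by simp
  next
    fix i assume i: "i \<in> {3, 4, 5}" "r = fa_mono [0, i] - fa_scale (lam i) (fa_mono [i, 0])"
    have "i < 6" using i by auto
    hence "in_fa 6 (fa_mono (u @ 0 # i # v) :: 'k fa)" "in_fa 6 (fa_mono (u @ i # 0 # v) :: 'k fa)"
      by (intro ins; simp)+
    moreover have "\<phi> (u @ 0 # i # v) = lam i * \<phi> (u @ i # 0 # v)" using a i by blast
    ultimately show ?thesis unfolding i(2)
      by (simp add: lin pairing_diff[of 6] pairing_scale[of 6] in_fa_scale del: in_fa_mono)
  next
    assume "r = fa_mono [3, 1] + fa_mono [4, 1] - fa_mono [5, 1]"
    moreover have "\<phi> (u @ 3 # 1 # v) + \<phi> (u @ 4 # 1 # v) = \<phi> (u @ 5 # 1 # v)" using a by blast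
    ultimately show ?thesis using ins[of 3 1] ins[of 4 1] ins[of 5 1]
      by (simp add: lin pairing_diff[of 6] pairing_add[of 6] in_fa_add del: in_fa_mono)
  next
    assume "r = fa_mono [2, 3] - fa_mono [2, 4]"
    moreover have "\<phi> (u @ 2 # 3 # v) = \<phi> (u @ 2 # 4 # v)" using a by blast
    ultimately show ?thesis using ins[of 2 3] ins[of 2 4]
      by (simp add: lin pairing_diff[of 6] del: in_fa_mono)
  next
    assume "r = fa_mono [2, 3] - fa_mono [2, 5]"
    moreover have "\<phi> (u @ 2 # 3 # v) = \<phi> (u @ 2 # 5 # v)" using a by blast
    ultimately show ?thesis using ins[of 2 3] ins[of 2 5]
      by (simp add: lin pairing_diff[of 6] del: in_fa_mono)
  qed
qed

text \<open>The word x^n, followed by z if b holds.\<close>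

definition xz :: "nat \<Rightarrow> bool \<Rightarrow> nat list" where
  "xz n b = replicate n 0 @ (if b then [1] else [])"

definition phiX :: "nat \<Rightarrow> bool \<Rightarrow> nat list \<Rightarrow> 'k" where
  "phiX n b w = (if w = xz n b then 1 else 0)"

text \<open>On the word x^a \<open>e_i\<close> x^(n - a), followed by z if b holds, the value is
  \<open>lam i ^ a * c i\<close>; on all other words it is 0. The factor is what moving
  \<open>e_i\<close> to the front costs.\<close>

fun phiE :: "(nat \<Rightarrow> 'k) \<Rightarrow> nat \<Rightarrow> bool \<Rightarrow> nat list \<Rightarrow> 'k" where
  "phiE c n b [] = 0"
| "phiE c n b (y # w) =
     (if y = 0 then (if n = 0 then 0 else phiE (\<lambda>i. lam i * c i) (n - 1) b w)
      else if y \<in> {3, 4, 5} then c y * phiX n b w else 0)"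

definition phiS :: "nat \<Rightarrow> bool \<Rightarrow> nat list \<Rightarrow> 'k" where
  "phiS n b w = (case w of [] \<Rightarrow> 0 | y # v \<Rightarrow> if y = 2 then phiX n b v else 0)"

text \<open>The constant family 1 after s reflects that s \<open>e_i\<close> is the same for all
  three i.\<close>

definition phiT :: "nat \<Rightarrow> bool \<Rightarrow> nat list \<Rightarrow> 'k" where
  "phiT n b w = (case w of [] \<Rightarrow> 0 | y # v \<Rightarrow> if y = 2 then phiE (\<lambda>_. 1) n b v else 0)"

lemma phiX_Cons: "phiX n b (y # w) = (if y = 0 then (if n = 0 then 0 else phiX (n - 1) b w)
    else if y = 1 \<and> n = 0 \<and> b \<and> w = [] then 1 else 0)"
  by (cases n) (auto simp: phiX_def xz_def)

text \<open>Every word in a relation contains s or some \<open>e_i\<close> or begins with z, so none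
  is a factor of x^n or of x^n z.\<close>

lemma annihilates_phiX: "annihilates (phiX n b)"
  unfolding annihilates_def
proof (intro allI)
  fix u v
  show "annihilates_at u v (phiX n b)"
  proof (induction u arbitrary: n)
    case Nil
    then show ?case by (auto simp: annihilates_at_def phiX_Cons zero_pairs_def)
  next
    case (Cons y u)
    show ?case using Cons[of "n - 1"] by (auto simp: annihilates_at_def phiX_Cons)
  qed
qed

text \<open>The commutation relations hold by construction. The hypothesis is the relation for
  \<open>e_3 + e_4 - e_5\<close> before z, which meets the support only in the words x^n
  \<open>e_i\<close> z, with values \<open>lam i ^ n * c i\<close>.\<close>

lemma annihilates_phiE:
  assumes "b \<Longrightarrow> lam 3 ^ n * c 3 + lam 4 ^ n * c 4 = lam 5 ^ n * c 5"
  shows "annihilates (phiE c n b)"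
  unfolding annihilates_def
proof (intro allI)
  fix u v
  show "annihilates_at u v (phiE c n b)"
    using assms
  proof (induction u arbitrary: n c)
    case Nil
    then show ?case by (auto simp: annihilates_at_def phiX_Cons zero_pairs_def)
  next
    case (Cons y u)
    consider "y = 0" "n = 0" | n' where "y = 0" "n = Suc n'" | "y \<in> {3, 4, 5}" | "y \<notin> {0, 3, 4, 5}"
      by (cases n) auto
    then show ?case
    proof cases
      \<comment> \<open>A leading x moves one factor \<open>lam i\<close> from the power into c,
        which leaves the hypothesis unchanged.\<close>
      case 2
      have "b \<Longrightarrow> lam 3 ^ n' * (lam 3 * c 3) + lam 4 ^ n' * (lam 4 * c 4) = lam 5 ^ n' * (lam 5 * c 5)"
        using Cons.prems 2 by (simp add: mult_ac)
      note IH = Cons.IH[of n' "\<lambda>i. lam i * c i", OF this]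
      have eq: "phiE c n b ((y # u) @ w) = phiE (\<lambda>i. lam i * c i) n' b (u @ w)" for w using 2 by simp
      show ?thesis using IH unfolding annihilates_at_def eq .
    next
      case 3
      hence y: "y \<noteq> 0" by auto
      have eq: "phiE c n b ((y # u) @ w) = c y * phiX n b (u @ w)" for w using 3 y by simp
      note ann = annihilates_phiX[of n b, unfolded annihilates_def, rule_format, of u v, unfolded annihilates_at_def]
      have f1: "c y * phiX n b (u @ i # j # v) = 0" if "(i, j) \<in> zero_pairs" for i j
        using ann that by auto
      have f2: "c y * phiX n b (u @ 0 # i # v) = lam i * (c y * phiX n b (u @ i # 0 # v))"
        if "i \<in> {3, 4, 5}" for i
        using ann that by (metis mult.left_commute)
      have f3: "c y * phiX n b (u @ 3 # 1 # v) + c y * phiX n b (u @ 4 # 1 # v) = c y * phiX n b (u @ 5 # 1 # v)"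
        using ann by (metis distrib_left)
      have f4: "phiX n b (u @ 2 # 3 # v) = phiX n b (u @ 2 # 4 # v)"
        "phiX n b (u @ 2 # 3 # v) = phiX n b (u @ 2 # 5 # v)" using ann by blast+
      show ?thesis unfolding annihilates_at_def eq
      proof (intro conjI ballI)
        fix p assume "p \<in> zero_pairs"
        thus "case p of (i, j) \<Rightarrow> c y * phiX n b (u @ i # j # v) = 0" using f1 by (cases p) simp
      qed (use f2 f3 f4 in simp_all)
    qed (auto simp: annihilates_at_def)
  qed
qed

lemma annihilates_phiS: "annihilates (phiS n b)"
  unfolding annihilates_def
proof (intro allI)
  fix u v
  note annihilates_phiX[of n b, unfolded annihilates_def, rule_format, of "tl u" v]
  thus "annihilates_at u v (phiS n b)"
    by (cases u) (auto simp: annihilates_at_def phiS_def phiX_Cons zero_pairs_def)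
qed

text \<open>With all values c equal to 1, the condition of \<open>annihilates_phiE\<close> is the
  equation that the algebra is built to test.\<close>

lemma annihilates_phiT:
  assumes "b \<Longrightarrow> lam 3 ^ n + lam 4 ^ n = lam 5 ^ n"
  shows "annihilates (phiT n b)"
  unfolding annihilates_def
proof (intro allI)
  fix u v
  have "annihilates (phiE (\<lambda>_. 1) n b)" using assms by (intro annihilates_phiE) simp
  note this[unfolded annihilates_def, rule_format, of "tl u" v]
  thus "annihilates_at u v (phiT n b)"
    by (cases u) (auto simp: annihilates_at_def phiT_def zero_pairs_def)
qed

end

section \<open>Spanning words of the quadratic algebra\<close>

context lech
begin

lemma I_0: "0 \<in> I" and I_add: "f \<in> I \<Longrightarrow> g \<in> I \<Longrightarrow> f + g \<in> I"
  and I_diff: "f \<in> I \<Longrightarrow> g \<in> I \<Longrightarrow> f - g \<in> I" and I_scale: "f \<in> I \<Longrightarrow> fa_scale c f \<in> I"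
  using subspace_fa_ideal[of 6 rels]
  by (auto intro: fa.subspace_0 fa.subspace_add fa.subspace_diff fa.subspace_scale)

lemma I_Cons: "f \<in> I \<Longrightarrow> y < 6 \<Longrightarrow> fa_mult (fa_mono [y]) f \<in> I"
  by (rule fa_ideal_mult_left[OF rels_in_fa]) auto

lemma I_rel:
  assumes "r \<in> rels" "v \<in> lists {..<6}"
  shows "fa_mult r (fa_mono v) \<in> I"
  using fa_ideal_base[of "[]" 6 v r rels] assms by simp

lemma I_zero_pair: "(i, j) \<in> zero_pairs \<Longrightarrow> v \<in> lists {..<6} \<Longrightarrow> fa_mono (i # j # v) \<in> I"
  using I_rel[of "fa_mono [i, j]" v] unfolding rels_def by fastforce

lemma I_comm:
  assumes "i \<in> {3, 4, 5}" "v \<in> lists {..<6}"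
  shows "fa_mono (0 # i # v) - fa_scale (lam i) (fa_mono (i # 0 # v)) \<in> I"
proof -
  have "fa_mono [0, i] - fa_scale (lam i) (fa_mono [i, 0]) \<in> rels" using assms unfolding rels_def by blast
  from I_rel[OF this assms(2)] show ?thesis by (simp add: fa_mult_diff_left fa_mult_scale_left)
qed

lemma I_s:
  assumes "i \<in> {3, 4, 5}" "v \<in> lists {..<6}"
  shows "fa_mono (2 # 3 # v) - fa_mono (2 # i # v) \<in> I"
proof -
  have "fa_mono [2, 3] - fa_mono [2, 4] \<in> rels" "fa_mono [2, 3] - fa_mono [2, 5] \<in> rels"
    unfolding rels_def by blast+
  from I_rel[OF this(1) assms(2)] I_rel[OF this(2) assms(2)] assms(1) I_0 show ?thesis
    by (auto simp: fa_mult_diff_left)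
qed

lemma xz_in_lists: "xz n b \<in> lists {..<6}"
  by (auto simp: xz_def)

lemma xz_Suc: "xz (Suc n) b = 0 # xz n b"
  by (simp add: xz_def)

lemma length_xz: "length (xz n b) = n + (if b then 1 else 0)"
  by (simp add: xz_def)

lemma I_move:
  assumes "i \<in> {3, 4, 5}" and v: "v \<in> lists {..<6}"
  shows "fa_mono (replicate n 0 @ i # v) - fa_scale (lam i ^ n) (fa_mono (i # replicate n 0 @ v)) \<in> I"
proof (induction n)
  case 0
  then show ?case using I_0 by simp
next
  case (Suc n)
  have l: "replicate n 0 @ v \<in> lists {..<6}" using v by auto
  have "fa_mult (fa_mono [0]) (fa_mono (replicate n 0 @ i # v) - fa_scale (lam i ^ n) (fa_mono (i # replicate n 0 @ v))) \<in> I"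
    using Suc by (intro I_Cons) auto
  hence 1: "fa_mono (0 # replicate n 0 @ i # v) - fa_scale (lam i ^ n) (fa_mono (0 # i # replicate n 0 @ v)) \<in> I"
    by (simp add: fa_mult_diff_right fa_mult_scale_right)
  have 2: "fa_scale (lam i ^ n) (fa_mono (0 # i # replicate n 0 @ v) - fa_scale (lam i) (fa_mono (i # 0 # replicate n 0 @ v))) \<in> I"
    by (rule I_scale, rule I_comm[OF assms(1) l])
  from I_add[OF 1 2] show ?case
    by (simp add: fa.scale_right_diff_distrib mult.commute)
qed

definition cn :: "nat \<Rightarrow> 'k" where "cn n = lam 3 ^ n + lam 4 ^ n - lam 5 ^ n"

text \<open>In x^n (\<open>e_3 + e_4 - e_5\<close>) z, which lies in the ideal, each
  \<open>e_i\<close> is moved to the front.\<close>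

lemma I_exz:
  "fa_scale (lam 3 ^ n) (fa_mono (3 # xz n True)) + fa_scale (lam 4 ^ n) (fa_mono (4 # xz n True))
     - fa_scale (lam 5 ^ n) (fa_mono (5 # xz n True)) \<in> I"
proof -
  let ?x = "\<lambda>i. fa_mono (replicate n 0 @ [i, 1]) :: 'k fa"
  let ?y = "\<lambda>i. fa_scale (lam i ^ n) (fa_mono (i # xz n True))"
  have mv: "?x i - ?y i \<in> I" if "i \<in> {3, 4, 5}" for i
    using I_move[OF that, of "[1]" n] by (simp add: xz_def)
  have "fa_mono [3, 1] + fa_mono [4, 1] - fa_mono [5, 1] \<in> rels" unfolding rels_def by blast
  from fa_ideal_base[of "replicate n 0" 6 "[]", OF _ _ this]
  have "?x 3 + ?x 4 - ?x 5 \<in> I"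
    by (simp add: fa_mult_diff_left fa_mult_add_left fa_mult_diff_right fa_mult_add_right in_lists_conv_set)
  moreover have "(?x 3 - ?y 3) + (?x 4 - ?y 4) - (?x 5 - ?y 5) \<in> I" by (intro I_add I_diff mv) auto
  ultimately have "(?x 3 + ?x 4 - ?x 5) - ((?x 3 - ?y 3) + (?x 4 - ?y 4) - (?x 5 - ?y 5)) \<in> I" by (rule I_diff)
  thus ?thesis by (simp add: algebra_simps)
qed

text \<open>After multiplication by s the three terms of \<open>I_exz\<close> become equal modulo
  the ideal, and their coefficients add up to \<open>cn n\<close>.\<close>

lemma I_sexz:
  assumes "cn n \<noteq> 0"
  shows "fa_mono (2 # 3 # xz n True) \<in> I"
proof -
  let ?w = "\<lambda>i. fa_mono (2 # i # xz n True) :: 'k fa"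
  have s: "?w 3 - ?w i \<in> I" if "i \<in> {3, 4, 5}" for i by (rule I_s[OF that xz_in_lists])
  have "fa_scale (lam 3 ^ n) (?w 3) + fa_scale (lam 4 ^ n) (?w 4) - fa_scale (lam 5 ^ n) (?w 5) \<in> I"
    using I_Cons[OF I_exz[of n], of 2] by (simp add: fa_mult_diff_right fa_mult_add_right fa_mult_scale_right)
  moreover have "fa_scale (lam 4 ^ n) (?w 3 - ?w 4) - fa_scale (lam 5 ^ n) (?w 3 - ?w 5) \<in> I"
    by (intro I_diff I_scale s) auto
  ultimately have "(fa_scale (lam 3 ^ n) (?w 3) + fa_scale (lam 4 ^ n) (?w 4) - fa_scale (lam 5 ^ n) (?w 5))
      + (fa_scale (lam 4 ^ n) (?w 3 - ?w 4) - fa_scale (lam 5 ^ n) (?w 3 - ?w 5)) \<in> I" by (rule I_add)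
  hence "fa_scale (cn n) (?w 3) \<in> I"
    by (simp add: cn_def fa.scale_right_diff_distrib fa.scale_left_distrib fa.scale_left_diff_distrib algebra_simps)
  from I_scale[OF this, of "inverse (cn n)"] show ?thesis using assms by simp
qed

text \<open>What precedes x^n, and whether z follows. The head \<open>([5], True)\<close> is missing
  because \<open>I_exz\<close> expresses it by \<open>[3]\<close> and \<open>[4]\<close>; after s
  only \<open>e_3\<close> is kept; and \<open>([2, 3], True)\<close> vanishes by
  \<open>I_sexz\<close> unless \<open>cn n = 0\<close>.\<close>

definition heads :: "nat \<Rightarrow> (nat list \<times> bool) set" where
  "heads n = {([], False), ([], True), ([2], False), ([2], True), ([3], False), ([4], False), ([5], False),
     ([3], True), ([4], True), ([2, 3], False)} \<union> (if cn n = 0 then {([2, 3], True)} else {})"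

definition nwords :: "nat \<Rightarrow> nat list set" where
  "nwords l = {h @ xz n b | h n b. (h, b) \<in> heads n \<and> length h + n + (if b then 1 else 0) = l}"

lemma nwords_I: "(h, b) \<in> heads n \<Longrightarrow> l = length h + n + (if b then 1 else 0) \<Longrightarrow> h @ xz n b \<in> nwords l"
  unfolding nwords_def by blast

text \<open>The span of these words modulo the ideal is closed under left multiplication by letters;
  starting from the empty word, it contains every word.\<close>

lemma mono_Cons_nwords:
  assumes w: "w \<in> nwords l" and y: "y < 6"
  shows "fa_mono (y # w) \<in> fa.span (fa_mono ` nwords (Suc l) \<union> I)"
proof -
  let ?S = "fa.span (fa_mono ` nwords (Suc l) \<union> I)"
  have S_I: "f \<in> I \<Longrightarrow> f \<in> ?S" for f by (rule fa.span_base) simp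
  obtain h n b where h: "w = h @ xz n b" "(h, b) \<in> heads n" and l: "l = length h + n + (if b then 1 else 0)"
    using w by (auto simp: nwords_def)
  have S_w: "fa_mono (h' @ xz n' b) \<in> ?S" if "(h', b) \<in> heads n'" "length h' + n' = Suc (length h + n)" for h' n'
    by (intro fa.span_base UnI1 imageI nwords_I) (use that l in auto)
  have h_cases: "h \<in> {[], [2], [3], [4], [5], [2, 3]}" using h(2) by (auto simp: heads_def split: if_splits)
  have wl: "w \<in> lists {..<6}" using h_cases xz_in_lists[of n b] by (auto simp: h(1))
  have S_zero: ?thesis if "w = j # v" "(y, j) \<in> zero_pairs" for j v
    using S_I I_zero_pair[OF that(2), of v] wl that(1) by auto
  have zpE: "(j, 2) \<in> zero_pairs \<and> (j, 3) \<in> zero_pairs \<and> (j, 4) \<in> zero_pairs \<and> (j, 5) \<in> zero_pairs"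
    if "j \<in> {3, 4, 5}" for j using that by (auto simp: zero_pairs_def)
  consider "y = 0" | "y = 1" | "y = 2" | "y \<in> {3, 4, 5}" using y by force
  then show ?thesis
  proof cases
    case 1
    consider "h = []" | v where "h = 2 # v" | i where "h = [i]" "i \<in> {3, 4, 5}" using h_cases by auto
    then show ?thesis
    proof cases
      assume "h = []"
      then show ?thesis using S_w[of "[]" "Suc n"] h 1 by (simp add: xz_Suc heads_def)
    next
      fix v assume "h = 2 # v"
      then show ?thesis using S_zero[of 2 "v @ xz n b"] h 1 by (simp add: zero_pairs_def)
    next
      fix i assume i: "h = [i]" "i \<in> {3, 4, 5}"
      have "(h, b) \<in> heads (Suc n)" using h(2) i by (auto simp: heads_def split: if_splits)
      hence "fa_mono (i # 0 # xz n b) \<in> ?S" using S_w[of "[i]" "Suc n"] i by (simp add: xz_Suc)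
      hence "fa_scale (lam i) (fa_mono (i # 0 # xz n b)) \<in> ?S" by (rule fa.span_scale)
      moreover have "fa_mono (0 # i # xz n b) - fa_scale (lam i) (fa_mono (i # 0 # xz n b)) \<in> ?S"
        by (intro S_I I_comm i xz_in_lists)
      ultimately have "(fa_mono (0 # i # xz n b) - fa_scale (lam i) (fa_mono (i # 0 # xz n b)))
          + fa_scale (lam i) (fa_mono (i # 0 # xz n b)) \<in> ?S" by (intro fa.span_add)
      thus ?thesis using 1 h i by simp
    qed
  next
    case 2
    show ?thesis
    proof (cases w)
      case Nil
      hence "h = []" "n = 0" "\<not> b" using h by (auto simp: xz_def split: if_splits)
      moreover have "[] @ xz 0 True \<in> nwords (Suc l)" using l calculation by (intro nwords_I) (auto simp: heads_def)
      ultimately show ?thesis using Nil 2 by (intro fa.span_base UnI1 imageI) (simp add: xz_def)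
    next
      case (Cons j v)
      hence "j < 6" using wl by auto
      thus ?thesis using S_zero[OF Cons] 2 by (auto simp: zero_pairs_def)
    qed
  next
    case 3
    consider "h = []" | v where "h = 2 # v" | i where "h = [i]" "i \<in> {3, 4, 5}" using h_cases by auto
    then show ?thesis
    proof cases
      assume "h = []"
      then show ?thesis using S_w[of "[2]" n] h 3 by (simp add: heads_def)
    next
      fix v assume "h = 2 # v"
      then show ?thesis using S_zero[of 2 "v @ xz n b"] h 3 by (simp add: zero_pairs_def)
    next
      fix i assume i: "h = [i]" "i \<in> {3, 4, 5}"
      have "fa_mono (2 # 3 # xz n b) \<in> ?S"
      \<comment> \<open>Either the word lies in the ideal or it is one of the listed words.\<close>
      proof (cases "b \<and> cn n \<noteq> 0")
        case True
        then show ?thesis using S_I[OF I_sexz[of n]] by simp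
      next
        case False
        hence "([2, 3], b) \<in> heads n" by (auto simp: heads_def)
        then show ?thesis using S_w[of "[2, 3]" n] i by simp
      qed
      moreover have "fa_mono (2 # 3 # xz n b) - fa_mono (2 # i # xz n b) \<in> ?S"
        by (intro S_I I_s i xz_in_lists)
      ultimately have "fa_mono (2 # 3 # xz n b) - (fa_mono (2 # 3 # xz n b) - fa_mono (2 # i # xz n b)) \<in> ?S"
        by (rule fa.span_diff)
      thus ?thesis using 3 h i by simp
    qed
  next
    case 4
    show ?thesis
    proof (cases h)
      case (Cons j v)
      hence "j \<in> {2, 3, 4, 5}" using h_cases by auto
      thus ?thesis using S_zero[of j "v @ xz n b"] zpE[OF 4] h Cons by auto
    next
      case Nil
      show ?thesis
      proof (cases "y = 5 \<and> b")
        case False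
        hence "([y], b) \<in> heads n" using 4 by (auto simp: heads_def)
        then show ?thesis using S_w[of "[y]" n] h Nil by simp
      next
        case True
        let ?e = "\<lambda>i. fa_mono (i # xz n b) :: 'k fa"
        have e: "?e 3 \<in> ?S" "?e 4 \<in> ?S" using S_w[of "[3]" n] S_w[of "[4]" n] Nil by (auto simp: heads_def)
        have "fa_scale (lam 3 ^ n) (?e 3) + fa_scale (lam 4 ^ n) (?e 4) \<in> ?S"
          using e by (intro fa.span_add fa.span_scale)
        moreover have "fa_scale (lam 3 ^ n) (?e 3) + fa_scale (lam 4 ^ n) (?e 4) - fa_scale (lam 5 ^ n) (?e 5) \<in> ?S"
          using S_I[OF I_exz[of n]] True by simp
        ultimately have "(fa_scale (lam 3 ^ n) (?e 3) + fa_scale (lam 4 ^ n) (?e 4)) -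
           (fa_scale (lam 3 ^ n) (?e 3) + fa_scale (lam 4 ^ n) (?e 4) - fa_scale (lam 5 ^ n) (?e 5)) \<in> ?S"
          by (rule fa.span_diff)
        hence "fa_scale (lam 5 ^ n) (?e 5) \<in> ?S" by simp
        \<comment> \<open>Solving for the term with \<open>e_5\<close> divides by a power of 1 +
          t.\<close>
        from fa.span_scale[OF this, of "inverse (lam 5 ^ n)"] have "?e 5 \<in> ?S"
          using t1 by (simp add: lam_def)
        thus ?thesis using True h Nil by simp
      qed
    qed
  qed
qed

lemma mono_in_span_nwords:
  assumes "w \<in> lists {..<6}"
  shows "fa_mono w \<in> fa.span (fa_mono ` nwords (length w) \<union> I)"
  using assms
proof (induction w)
  case Nil
  have "[] @ xz 0 False \<in> nwords (length [])" by (intro nwords_I) (auto simp: heads_def)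
  then show ?case by (intro fa.span_base UnI1 imageI) (simp add: xz_def)
next
  case (Cons y w)
  have y: "y < 6" using Cons by auto
  have "fa_mult (fa_mono [y]) f \<in> fa.span (fa_mono ` nwords (Suc (length w)) \<union> I)"
    if "f \<in> fa.span (fa_mono ` nwords (length w) \<union> I)" for f
    using that
  proof (induction rule: fa.span_induct)
    case base
    show ?case
      by (rule fa.subspaceI) (auto simp: fa_mult_add_right fa_mult_scale_right intro: fa.span_add fa.span_scale fa.span_zero)
  next
    case (step f)
    then show ?case
    proof
      assume "f \<in> fa_mono ` nwords (length w)"
      then show ?thesis using mono_Cons_nwords[OF _ y] by auto
    next
      assume "f \<in> I"
      then show ?thesis using I_Cons[OF _ y] by (intro fa.span_base) auto
    qed
  qed
  from this[of "fa_mono w"] show ?case using Cons by simp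
qed

text \<open>The degree is written as N + 3 so that s \<open>e_3\<close> x^N z, the only word whose
  survival depends on the exponent, has exponent N. The same set \<open>heads N\<close> then lists
  the whole degree.\<close>

definition nword :: "nat \<Rightarrow> nat list \<times> bool \<Rightarrow> nat list" where
  "nword N = (\<lambda>(h, b). h @ xz (N + 3 - length h - (if b then 1 else 0)) b)"

text \<open>The dual basis to \<open>nword N\<close>. For \<open>[3]\<close> and \<open>[4]\<close>
  followed by z, the value at \<open>e_5\<close> is chosen to satisfy the condition of
  \<open>annihilates_phiE\<close>; for \<open>([2, 3], True)\<close> the condition is
  \<open>cn N = 0\<close>, which membership in \<open>heads N\<close> provides.\<close>

definition functional :: "nat \<Rightarrow> nat list \<times> bool \<Rightarrow> nat list \<Rightarrow> 'k" where
  "functional N = (\<lambda>(h, b). let n = N + 3 - length h - (if b then 1 else 0) in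
     if h = [] then phiX n b else if h = [2] then phiS n b else if h = [2, 3] then phiT n b
     else phiE (\<lambda>i. if [i] = h then 1 else if i = 5 \<and> b then lam (hd h) ^ n / lam 5 ^ n else 0) n b)"

lemma lam5: "lam 5 \<noteq> 0"
  using t1 by (simp add: lam_def)

lemma functional_annihilates:
  assumes "p \<in> heads N"
  shows "annihilates (functional N p)"
  using assms lam5 unfolding heads_def
  by (auto simp: functional_def Let_def cn_def intro!: annihilates_phiX annihilates_phiS annihilates_phiT
      annihilates_phiE split: if_splits)

lemma phiX_xz: "phiX n b (xz n' b') = (if n = n' \<and> b = b' then 1 else 0)"
proof -
  have "xz n' b' = xz n b \<Longrightarrow> n = n' \<and> b = b'"
    by (induction n' arbitrary: n) (case_tac [!] n, auto simp: xz_def split: if_splits)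
  thus ?thesis by (auto simp: phiX_def)
qed

lemma phiE_xz: "phiE c n b (xz n' b') = 0"
  by (induction n' arbitrary: n c) (auto simp: xz_def)

lemma phiX_head: "y \<noteq> 0 \<Longrightarrow> y \<noteq> 1 \<Longrightarrow> phiX n b (y # w) = 0"
  by (simp add: phiX_Cons)

lemma phiS_xz: "phiS n b (xz n' b') = 0"
  by (cases n') (auto simp: phiS_def xz_def)

lemma phiT_xz: "phiT n b (xz n' b') = 0"
  by (cases n') (auto simp: phiT_def xz_def)

lemma functional_nword:
  assumes "p \<in> heads N" "q \<in> heads N"
  shows "functional N p (nword N q) = (if p = q then 1 else 0)"
  using assms unfolding heads_def
  by (auto simp: functional_def nword_def Let_def phiX_xz phiE_xz phiX_head phiS_xz phiT_xz phiS_def[of _ _ "_ # _"]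
      phiT_def[of _ _ "_ # _"] split: if_splits)

lemma nwords_eq: "nwords (N + 3) \<subseteq> nword N ` heads N"
proof
  fix w assume "w \<in> nwords (N + 3)"
  then obtain h n b where w: "w = h @ xz n b" "(h, b) \<in> heads n" "length h + n + (if b then 1 else 0) = N + 3"
    by (auto simp: nwords_def)
  have "n = N + 3 - length h - (if b then 1 else 0)" using w(3) by auto
  hence "w = nword N (h, b)" using w by (simp add: nword_def)
  moreover have "(h, b) \<in> heads N"
  proof (cases "(h, b) = ([2, 3], True)")
    case True
    hence "n = N" using w(3) by simp
    thus ?thesis using w(2) by simp
  next
    case False
    thus ?thesis using w(2) by (auto simp: heads_def split: if_splits)
  qed
  ultimately show "w \<in> nword N ` heads N" by blast
qed

lemma length_nword: "p \<in> heads N \<Longrightarrow> length (nword N p) = N + 3"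
  unfolding heads_def by (auto simp: nword_def length_xz split: if_splits)

lemma nword_in_lists:
  assumes "p \<in> heads N"
  shows "nword N p \<in> lists {..<6}"
proof -
  have "fst p \<in> lists {..<6}" using assms by (auto simp: heads_def split: if_splits)
  thus ?thesis by (simp add: nword_def case_prod_beta xz_in_lists)
qed

text \<open>The words \<open>nword N\<close> form a basis of degree N + 3: they span by rewriting
  and are separated by the dual functionals. There are ten, and an eleventh when
  \<open>cn N = 0\<close>.\<close>

lemma hilbert_fun_lech: "hilbert_fun 6 unit_deg rels (N + 3) = (if cn N = 0 then 11 else 10)"
proof -
  let ?V = "graded_component 6 unit_deg (N + 3) :: 'k fa set"
  let ?b = "\<lambda>p. fa_mono (nword N p) :: 'k fa"
  have sV: "fa.subspace ?V" by (simp add: graded_component_eq_span)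
  have ins: "in_fa 6 (?b p)" if "p \<in> heads N" for p using nword_in_lists[OF that] by (simp only: in_fa_mono)
  have nV: "?b p \<in> ?V" if "p \<in> heads N" for p
    using nword_in_lists[OF that] length_nword[OF that]
    by (simp add: graded_component_def words_of_deg_def wdeg_unit)
  have fin: "finite (heads N)" by (simp add: heads_def)
  have "fa.dim ?V - fa.dim (I \<inter> ?V) = card (heads N)"
  proof (rule fa.dim_diff_eq_card[where b = ?b])
    show "finite (fa_mono ` words_of_deg 6 unit_deg (N + 3))"
      by (intro finite_imageI finite_words_of_deg) (simp add: unit_deg_def)
    show "?V \<subseteq> fa.span (fa_mono ` words_of_deg 6 unit_deg (N + 3))" by (simp add: graded_component_eq_span)
    show "fa.subspace ?V" by (rule sV)
    show "fa.subspace (I \<inter> ?V)" using sV subspace_fa_ideal fa.subspace_inter by blast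
    show "?b ` heads N \<subseteq> ?V" using nV by blast
  next
    fix c assume c: "(\<Sum>p\<in>heads N. fa_scale (c p) (?b p)) \<in> I \<inter> ?V"
    show "\<forall>p\<in>heads N. c p = 0"
    proof
      fix p assume p: "p \<in> heads N"
      have "0 = pairing (functional N p) (\<Sum>q\<in>heads N. fa_scale (c q) (?b q))"
        using annihilates_I[OF functional_annihilates[OF p]] c by simp
      also have "\<dots> = (\<Sum>q\<in>heads N. pairing (functional N p) (fa_scale (c q) (?b q)))"
        by (rule pairing_sum[of _ 6]) (intro in_fa_scale ins)
      also have "\<dots> = (\<Sum>q\<in>heads N. if q = p then c q else 0)"
        using p by (intro sum.cong refl) (simp add: pairing_scale[OF ins] functional_nword)
      also have "\<dots> = c p" using p fin by simp
      finally show "c p = 0" by simp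
    qed
  next
    show "?V \<subseteq> fa.span (?b ` heads N \<union> (I \<inter> ?V))"
    proof
      fix f assume f: "f \<in> ?V"
      have w: "fa_mono w \<in> fa.span (?b ` heads N \<union> I)" if w: "w \<in> words_of_deg 6 unit_deg (N + 3)" for w
      proof -
        have wl: "w \<in> lists {..<6}" "length w = N + 3" using w by (auto simp: words_of_deg_def wdeg_unit)
        have "fa_mono ` nwords (N + 3) \<union> I \<subseteq> ?b ` heads N \<union> I" using nwords_eq[of N] by auto
        from fa.span_mono[OF this] show ?thesis using mono_in_span_nwords[OF wl(1)] unfolding wl(2) by blast
      qed
      have "f \<in> fa.span (fa_mono ` words_of_deg 6 unit_deg (N + 3))" using f by (simp add: graded_component_eq_span)
      moreover have "fa.span (fa_mono ` words_of_deg 6 unit_deg (N + 3)) \<subseteq> fa.span (?b ` heads N \<union> I)"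
        using w by (intro fa.span_minimal) auto
      ultimately have "f \<in> fa.span (?b ` heads N \<union> I)" by blast
      then obtain g i where gi: "f = g + i" "g \<in> fa.span (?b ` heads N)" "i \<in> fa.span I"
        unfolding fa.span_Un by blast
      have i: "i \<in> I" using gi(3) subspace_fa_ideal fa.span_eq_iff by blast
      \<comment> \<open>Both f and g are homogeneous of degree N + 3, hence so is the ideal part
        i.\<close>
      have "g \<in> ?V" using gi(2) fa.span_minimal[OF _ sV, of "?b ` heads N"] nV by blast
      hence "i \<in> ?V" using fa.subspace_diff[OF sV f] gi(1) by fastforce
      thus "f \<in> fa.span (?b ` heads N \<union> (I \<inter> ?V))"
        unfolding fa.span_Un using gi(1,2) i fa.span_base[of i "I \<inter> ?V"] by blast
    qed
  qed (use fin in auto)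
  moreover have "card (heads N) = (if cn N = 0 then 11 else 10)" by (simp add: heads_def)
  ultimately show ?thesis by (simp add: hilbert_fun_def)
qed

lemma hilbert_fun_bounded: "\<exists>C. \<forall>n. hilbert_fun 6 unit_deg rels n \<le> C"
proof (intro exI allI)
  fix n
  let ?h = "hilbert_fun 6 unit_deg rels"
  show "?h n \<le> 11 + ?h 0 + ?h 1 + ?h 2"
  proof (cases "n < 3")
    case True
    hence "n = 0 \<or> n = 1 \<or> n = 2" by auto
    thus ?thesis by auto
  next
    case False
    then obtain N where "n = N + 3" by (metis add.commute le_Suc_ex not_less)
    thus ?thesis by (simp add: hilbert_fun_lech)
  qed
qed

end

lemma coeff_one_plus_X_power: "coeff ([:1, 1:] ^ n :: 'a::comm_semiring_1 poly) i = of_nat (n choose i)"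
proof (cases "i \<le> n")
  case True
  thus ?thesis by (simp add: coeff_linear_poly_power)
next
  case False
  have "degree ([:1, 1:] ^ n :: 'a poly) \<le> n" using degree_power_le[of "[:1, 1:] :: 'a poly" n] by simp
  thus ?thesis using False by (simp add: coeff_eq_0 binomial_eq_0)
qed

section \<open>Lech's equation and irrationality\<close>

context lech
begin

lemma cn_eq: "cn n = 1 + t ^ n - (1 + t) ^ n"
  by (simp add: cn_def lam_def)

text \<open>Frobenius is additive, so \<open>cn\<close> commutes with it; zeros of \<open>cn\<close>
  can be multiplied and divided by powers of p.\<close>

lemma cn_power_CHAR:
  assumes "prime CHAR('k)"
  shows "cn (m * CHAR('k) ^ j) = cn m ^ (CHAR('k) ^ j)"
proof -
  let ?q = "CHAR('k) ^ j"
  have add: "(a + b) ^ ?q = a ^ ?q + b ^ ?q" for a b :: 'k by (rule freshmans_dream'[OF assms refl])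
  have diff: "(a - b) ^ ?q = a ^ ?q - b ^ ?q" for a b :: 'k
    using add[of "a - b" b] by (simp add: algebra_simps)
  show ?thesis unfolding cn_eq by (simp add: diff add power_mult)
qed

lemma hilbert_fun_irrational:
  assumes char: "CHAR('k) > 0" and t: "\<not> algebraic_prime t"
  shows "\<not> rational_series (hilbert_fun 6 unit_deg rels)"
proof
  let ?p = "CHAR('k)" and ?h = "hilbert_fun 6 unit_deg rels"
  assume rat: "rational_series ?h"
  have p: "prime ?p" using char by (rule prime_CHAR_semidom)
  obtain C where "\<And>n. ?h n \<le> C" using hilbert_fun_bounded by blast
  then obtain P n1 where P: "0 < P" "\<forall>n\<ge>n1. ?h (n + P) = ?h n"
    using eventually_periodic_of_rational_series[OF rat] by blast
  \<comment> \<open>The two values 10 and 11 reveal whether \<open>cn\<close> vanishes, so a period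
    of the Hilbert function carries zeros of \<open>cn\<close> along.\<close>
  have per: "cn (N + i * P) = 0" if "n1 \<le> N" "cn N = 0" for N i
  proof (induction i)
    case (Suc i)
    have "?h (N + i * P + 3 + P) = ?h (N + i * P + 3)" using P(2) that by simp
    hence "?h ((N + Suc i * P) + 3) = ?h ((N + i * P) + 3)" by (simp add: ac_simps)
    then show ?case using Suc by (simp only: hilbert_fun_lech) (simp split: if_splits)
  qed (use that in simp)
  \<comment> \<open>Starting from p^n1, a zero beyond the preperiod, p * p^n1 periods lead to M *
    p^n1, so M itself is a zero. The factor p makes M equal to 1 in the field, and P > 0 makes it
    different from 1.\<close>
  let ?M = "1 + ?p * P"
  have "cn (1 * ?p ^ n1) = cn 1 ^ (?p ^ n1)" by (rule cn_power_CHAR[OF p])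
  also have "\<dots> = 0" using char by (simp add: cn_eq)
  finally have "cn (?p ^ n1) = 0" by simp
  moreover have "n1 \<le> ?p ^ n1" using less_exp[of n1] prime_ge_2_nat[OF p] power_mono[of 2 ?p n1]
    by (meson less_imp_le order_trans zero_le)
  ultimately have "cn (?p ^ n1 + (?p * ?p ^ n1) * P) = 0" by (intro per)
  moreover have "?p ^ n1 + (?p * ?p ^ n1) * P = ?M * ?p ^ n1" by (simp add: algebra_simps)
  ultimately have "cn (?M * ?p ^ n1) = 0" by metis
  hence "cn ?M ^ (?p ^ n1) = 0" using cn_power_CHAR[OF p, of ?M n1] by metis
  hence cM: "cn ?M = 0" using char by simp
  define M where "M = ?M"
  have M: "M \<noteq> 1" "(of_nat M :: 'k) = 1" using char P by (auto simp: M_def)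
  define q :: "'k poly" where "q = 1 + monom 1 M - [:1, 1:] ^ M"
  \<comment> \<open>The monomial of degree M does not contribute since M is not 1, and the binomial
    coefficient is M = 1 in the field.\<close>
  have "coeff q 1 = - 1"
    unfolding q_def coeff_diff coeff_add coeff_one_plus_X_power using M by simp
  hence "q \<noteq> 0" by auto
  moreover have "coeff q i \<in> \<int>" for i
    unfolding q_def coeff_diff coeff_add coeff_one_plus_X_power coeff_monom by simp
  moreover have "poly q t = 0" using cM by (simp add: q_def cn_eq poly_monom M_def[symmetric] del: One_nat_def)
  ultimately show False using t unfolding algebraic_prime_def by blast
qed

end

theorem exists_quadratic_irrational:
  assumes char: "CHAR('k::field) > 0" and t: "\<not> algebraic_prime (t :: 'k)"
  shows "\<exists>d (R :: 'k fa set). finite_presentation 6 d R \<and> (\<forall>i<6. d i = 1) \<and>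
              (\<forall>r\<in>R. homog_of 6 d 2 r) \<and> linear_growth 6 d R \<and>
              \<not> rational_series (hilbert_fun 6 d R)"
proof -
  interpret lech t
  proof
    \<comment> \<open>Otherwise t = -1 would be a root of 1 + X.\<close>
    show "1 + t \<noteq> 0"
    proof
      assume "1 + t = 0"
      hence "poly [:1, 1:] t = 0" by simp
      moreover have "coeff [:1, 1 :: 'k:] i \<in> \<int>" for i by (auto simp: coeff_pCons split: nat.splits)
      moreover have "[:1, 1 :: 'k:] \<noteq> 0" by simp
      ultimately show False using t unfolding algebraic_prime_def by blast
    qed
  qed
  show ?thesis
    using presentation rels_homog hilbert_fun_bounded hilbert_fun_irrational[OF char t]
    by (intro exI[of _ unit_deg] exI[of _ rels]) (auto simp: linear_growth_def unit_deg_def)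
qed

theorem theorem1p1:
  assumes "CHAR('k::field) > 0"
  shows "((\<forall>k d (R :: 'k fa set). finite_presentation k d R \<and> linear_growth k d R
              \<longrightarrow> rational_series (hilbert_fun k d R))
          \<longleftrightarrow> (\<forall>k d (R :: 'k fa set). finite_presentation k d R \<and> linear_growth k d R
              \<longrightarrow> automaton_presentable k d R))
       \<and> ((\<forall>k d (R :: 'k fa set). finite_presentation k d R \<and> linear_growth k d R
              \<longrightarrow> automaton_presentable k d R)
          \<longleftrightarrow> (\<forall>x :: 'k. algebraic_prime x))
       \<and> (\<not> (\<forall>x :: 'k. algebraic_prime x) \<longrightarrow>
           (\<exists>d (R :: 'k fa set). finite_presentation 6 d R \<and> (\<forall>i<6. d i = 1) \<and>
              (\<forall>r\<in>R. homog_of 6 d 2 r) \<and> linear_growth 6 d R \<and>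
              \<not> rational_series (hilbert_fun 6 d R)))"
proof -
  have 12: "rational_series (hilbert_fun k d R)"
    if "automaton_presentable k d R" "finite_presentation k d R" "linear_growth k d R" for k d and R :: "'k fa set"
    using that by (intro rational_series_of_automaton_presentable)
  have 32: "automaton_presentable k d R"
    if "\<forall>x :: 'k. algebraic_prime x" "finite_presentation k d R" "linear_growth k d R" for k d and R :: "'k fa set"
    using that assms by (intro automaton_presentable_if_algebraic) auto
  have ex: "\<exists>d (R :: 'k fa set). finite_presentation 6 d R \<and> (\<forall>i<6. d i = 1) \<and>
              (\<forall>r\<in>R. homog_of 6 d 2 r) \<and> linear_growth 6 d R \<and>
              \<not> rational_series (hilbert_fun 6 d R)" if "\<not> (\<forall>x :: 'k. algebraic_prime x)"
    using that exists_quadratic_irrational[OF assms] by blast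
  \<comment> \<open>Condition (i) yields (iii) by contraposition, since \<open>ex\<close> provides a
    counterexample to (i); this closes the cycle.\<close>
  show ?thesis using 12 32 ex by meson
qed

end
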